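(* Let $0<q<1$ and $\alpha=(q^{1/2}+q^{-1/2})/2$. Let $(P_n)_{n\ge 0}$ be a monic orthogonal polynomial sequence with three-term recurrence relation $$P_{-1}(z)=0,\quad P_0(z)=1,\quad P_{n+1}(z)=(z-B_n)P_n(z)-C_nP_{n-1}(z)\quad (n\ge 0),\qquad C_n\ne 0 \ (n\geq 1).$$ Suppose that there are complex numbers $a,b,c$ and complex sequences $(a_n)_{n\ge0},(b_n)_{n\ge0},(c_n)_{n\ge0}$ with $c_n\neq 0$ for all $n=0,1,\ldots$ such that $$(az^2+bz+c)\,\mathcal{D}_qP_{n}(z)= a_n\,\mathcal{S}_qP_{n+1}(z)+b_n\,\mathcal{S}_q P_{n}(z)+c_n\,\mathcal{S}_qP_{n-1}(z)\qquad (n=0,1,\ldots).$$ Put $r_i=c_i+2aC_i$ for $i=2,3$, and suppose that $a,b,c$ are such that: (i) whenever $a\ne 0$, $$(4\alpha^2-1)\,a\,C_2C_3+\frac{r_3}{2}\Big[(B_0+B_1)^2+4\alpha^2\,(C_1-B_0B_1+\alpha^2-1)-2(2\alpha^2-1)C_2\Big]=0;$$ (ii) $$a\,C_2C_3\Big(b_2+2aB_2+\frac{b}{\alpha}\Big)-r_3\left(a(B_2+B_1)C_2+\frac{b}{\alpha}C_2-\frac{r_2}{2}(B_1-B_0)\right)=0.$$ Then the $P_n$ are multiples of Askey-Wilson polynomials, or special or limiting cases of them. Moreover, for every $n=0,1,\ldots$, $Y=P_n$ satisfies $$\phi(z)\,\mathcal{D}_q^2Y+\psi(z)\,\mathcal{S}_q\mathcal{D}_qY+h(z)\,Y=\lambda_n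 Y,$$ where $$\phi(z)=\mathfrak{a}z^2+\mathfrak{b}z+\mathfrak{c},\qquad \psi(z)=z-B_0,\qquad h(z)=0,\qquad \lambda_n=\gamma_n(\mathfrak{a}\gamma_{n-1}+\alpha_{n-1}),$$ and $$\mathfrak{a}=-\frac{aC_3+(\alpha^2-1)r_3}{\alpha r_3},$$ $$\mathfrak{b}=-\frac{1}{2\alpha}\left(\Big(1-2a\frac{C_3}{r_3}\Big)(B_0+B_1)-2\alpha^2B_0\right),$$ $$\mathfrak{c}=-\frac{1}{2\alpha}\left(\Big(1-2a\frac{C_3}{r_3}\Big)(C_1-B_0B_1)+C_1+B_0^2\right).$$
   Context: Polynomials have complex coefficients. Fix $0<q<1$ and let $x(s)=\tfrac12(q^s+q^{-s})$. For a polynomial $p$, the Askey-Wilson operator $\mathcal{D}_q$ and the averaging operator $\mathcal{S}_q$ are the linear maps from polynomials to polynomials determined, with $z=x(s)$, by $$(\mathcal{D}_qp)(x(s))=\frac{p(x(s+1/2))-p(x(s-1/2))}{x(s+1/2)-x(s-1/2)},\qquad (\mathcal{S}_qp)(x(s))=\tfrac12\big(p(x(s+1/2))+p(x(s-1/2))\big).$$ For integers $n\ge 0$ put $$\alpha_n=\tfrac12(q^{n/2}+q^{-n/2}),\qquad \gamma_n=\frac{q^{n/2}-q^{-n/2}}{q^{1/2}-q^{-1/2}},$$ and $\alpha_{-1}=\alpha$, $\gamma_{-1}=-1$; thus $\alpha=\alpha_1$. A monic orthogonal polynomial sequence is a sequence of monic polynomials $(P_n)_{n\ge0}$ with $\deg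 P_n=n$ for which there is a linear functional $\mathbf{u}$ on the space of complex polynomials with $\langle \mathbf{u},P_nP_m\rangle=\kappa_n\delta_{n,m}$, $\kappa_n\in\mathbb{C}\setminus\{0\}$. Equivalently, it satisfies a three-term recurrence relation as in the claim with $C_n\ne0$ for $n\ge 1$. Askey-Wilson polynomials. For complex parameters $a_1,a_2,a_3,a_4$ such that for all $n\ge0$ $$(1-a_1a_2a_3a_4q^n)(1-a_1a_2q^n)(1-a_1a_3q^n)(1-a_1a_4q^n)(1-a_2a_3q^n)(1-a_2a_4q^n)(1-a_3a_4q^n)\ne0,$$ the monic Askey-Wilson polynomials $Q_n(z;a_1,a_2,a_3,a_4|q)$ are given by $Q_{-1}=0$, $Q_0=1$, $Q_{n+1}=(z-\beta_n)Q_n-\eta_nQ_{n-1}$ with $$\beta_n=\tfrac12\Big[a_1+\tfrac1{a_1}-\frac{(1-a_1a_2q^n)(1-a_1a_3q^n)(1-a_1a_4q^n)(1-a_1a_2a_3a_4q^{n-1})}{a_1(1-a_1a_2a_3a_4q^{2n-1})(1-a_1a_2a_3a_4q^{2n})}-\frac{a_1(1-q^n)(1-a_2a_3q^{n-1})(1-a_2a_4q^{n-1})(1-a_3a_4q^{n-1})}{(1-a_1a_2a_3a_4q^{2n-1})(1-a_1a_2a_3a_4q^{2n-2})}\Big],$$ $$\eta_{n+1}=\frac{(1-q^{n+1})(1-a_1a_2a_3a_4q^{n-1})(1-a_1a_2q^n)(1-a_1a_3q^n)(1-a_1a_4q^n)(1-a_2a_3q^n)(1-a_2a_4q^n)(1-a_3a_4q^n)}{4(1-a_1a_2a_3a_4q^{2n-1})(1-a_1a_2a_3a_4q^{2n})^2(1-a_1a_2a_3a_4q^{2n+1})}.$$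 The phrase "multiples of Askey-Wilson polynomials, or special or limiting cases of them" is used as in M. E. H. Ismail's theorem characterizing the polynomial solutions (of exact degree $n$ for each $n=0,1,\ldots$) of operator equations of the form $\phi\,\mathcal{D}_q^2Y+\psi\,\mathcal{S}_q\mathcal{D}_qY+hY=\lambda_nY$: that theorem says such solutions exist if and only if $Y_n$ is a multiple of the Askey-Wilson polynomials, or special or limiting cases of them. *)

theory Defs
  imports "HOL-Analysis.Analysis" "HOL-Computational_Algebra.Polynomial"
begin

definition aw_x :: "real \<Rightarrow> complex \<Rightarrow> complex" where
  "aw_x q s = (of_real q powr s + of_real q powr (- s)) / 2"

text \<open>
  The operators act on polynomials, so each is the unique polynomial that satisfies its defining
  relation on the lattice. In the divided difference the points \<open>s\<close> with vanishing denominator are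
  left out. Existence and uniqueness are proved below for \<open>0 < q < 1\<close>.
\<close>

definition is_aw_D :: "real \<Rightarrow> complex poly \<Rightarrow> complex poly \<Rightarrow> bool" where
  "is_aw_D q p r \<longleftrightarrow> (\<forall>s. aw_x q (s + 1/2) \<noteq> aw_x q (s - 1/2) \<longrightarrow>
     poly r (aw_x q s) =
       (poly p (aw_x q (s + 1/2)) - poly p (aw_x q (s - 1/2))) / (aw_x q (s + 1/2) - aw_x q (s - 1/2)))"

definition is_aw_S :: "real \<Rightarrow> complex poly \<Rightarrow> complex poly \<Rightarrow> bool" where
  "is_aw_S q p r \<longleftrightarrow> (\<forall>s.
     poly r (aw_x q s) = (poly p (aw_x q (s + 1/2)) + poly p (aw_x q (s - 1/2))) / 2)"

definition aw_D :: "real \<Rightarrow> complex poly \<Rightarrow> complex poly" where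
  "aw_D q p = (THE r. is_aw_D q p r)"

definition aw_S :: "real \<Rightarrow> complex poly \<Rightarrow> complex poly" where
  "aw_S q p = (THE r. is_aw_S q p r)"

text \<open>
  The index is an integer: at \<open>n = -1\<close> these formulas give the values \<open>\<alpha>\<close> and \<open>-1\<close> by which the
  two sequences are extended (lemma \<open>aw_alpha_gamma_minus_one\<close>).
\<close>

definition aw_alpha :: "real \<Rightarrow> int \<Rightarrow> complex" where
  "aw_alpha q n = of_real ((q powr (of_int n / 2) + q powr (- (of_int n / 2))) / 2)"

definition aw_gamma :: "real \<Rightarrow> int \<Rightarrow> complex" where
  "aw_gamma q n = of_real ((q powr (of_int n / 2) - q powr (- (of_int n / 2))) /
     (q powr (1/2) - q powr (- (1/2))))"

text \<open>The sequence \<open>P\<^sub>n\<^sub>-\<^sub>1\<close>, with \<open>P\<^sub>-\<^sub>1 = 0\<close>.\<close>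

definition prev :: "(nat \<Rightarrow> 'a::zero) \<Rightarrow> nat \<Rightarrow> 'a" where
  "prev P n = (case n of 0 \<Rightarrow> 0 | Suc m \<Rightarrow> P m)"

definition monic_OPS :: "(nat \<Rightarrow> complex poly) \<Rightarrow> bool" where
  "monic_OPS P \<longleftrightarrow> (\<forall>n. degree (P n) = n \<and> lead_coeff (P n) = 1) \<and>
     (\<exists>u \<kappa>. Vector_Spaces.linear smult (*) u \<and>
        (\<forall>n. \<kappa> n \<noteq> 0) \<and> (\<forall>n m. u (P n * P m) = (if n = m then \<kappa> n else 0)))"

definition TTRR :: "(nat \<Rightarrow> complex) \<Rightarrow> (nat \<Rightarrow> complex) \<Rightarrow> (nat \<Rightarrow> complex poly) \<Rightarrow> bool" where
  "TTRR B C P \<longleftrightarrow> P 0 = 1 \<and>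
     (\<forall>n. P (Suc n) = [:- B n, 1:] * P n - smult (C n) (prev P n))"

text \<open>
  The recurrence coefficients of the monic Askey-Wilson polynomials. The case \<open>n = 0\<close> is given
  separately: there the factor \<open>1 - a\<^sub>1 a\<^sub>2 a\<^sub>3 a\<^sub>4 q\<^sup>-\<^sup>1\<close> occurs in both numerator and denominator and
  has to be cancelled, since it vanishes for the admissible value \<open>a\<^sub>1 a\<^sub>2 a\<^sub>3 a\<^sub>4 = q\<close>, and the last
  term of \<open>\<beta>\<^sub>0\<close> vanishes because of its factor \<open>1 - q\<^sup>0\<close>.
\<close>

definition aw_beta :: "real \<Rightarrow> complex \<Rightarrow> complex \<Rightarrow> complex \<Rightarrow> complex \<Rightarrow> nat \<Rightarrow> complex" where
  "aw_beta q a1 a2 a3 a4 n =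
     (let Q = (\<lambda>k::int. (of_real q :: complex) powi k); \<sigma> = a1 * a2 * a3 * a4; m = int n in
      if n = 0 then
        (a1 + 1 / a1 - (1 - a1 * a2) * (1 - a1 * a3) * (1 - a1 * a4) / (a1 * (1 - \<sigma>))) / 2
      else
        (a1 + 1 / a1
         - (1 - a1 * a2 * Q m) * (1 - a1 * a3 * Q m) * (1 - a1 * a4 * Q m) * (1 - \<sigma> * Q (m - 1))
           / (a1 * (1 - \<sigma> * Q (2 * m - 1)) * (1 - \<sigma> * Q (2 * m)))
         - a1 * (1 - Q m) * (1 - a2 * a3 * Q (m - 1)) * (1 - a2 * a4 * Q (m - 1)) * (1 - a3 * a4 * Q (m - 1))
           / ((1 - \<sigma> * Q (2 * m - 1)) * (1 - \<sigma> * Q (2 * m - 2)))) / 2)"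

text \<open>\<open>aw_eta\<close> at \<open>n\<close> is the coefficient \<open>\<eta>\<^sub>n\<^sub>+\<^sub>1\<close>.\<close>

definition aw_eta :: "real \<Rightarrow> complex \<Rightarrow> complex \<Rightarrow> complex \<Rightarrow> complex \<Rightarrow> nat \<Rightarrow> complex" where
  "aw_eta q a1 a2 a3 a4 n =
     (let Q = (\<lambda>k::int. (of_real q :: complex) powi k); \<sigma> = a1 * a2 * a3 * a4; m = int n in
      if n = 0 then
        (1 - Q 1) * (1 - a1 * a2) * (1 - a1 * a3) * (1 - a1 * a4)
          * (1 - a2 * a3) * (1 - a2 * a4) * (1 - a3 * a4)
        / (4 * (1 - \<sigma>)^2 * (1 - \<sigma> * Q 1))
      else
        (1 - Q (m + 1)) * (1 - \<sigma> * Q (m - 1))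
          * (1 - a1 * a2 * Q m) * (1 - a1 * a3 * Q m) * (1 - a1 * a4 * Q m)
          * (1 - a2 * a3 * Q m) * (1 - a2 * a4 * Q m) * (1 - a3 * a4 * Q m)
        / (4 * (1 - \<sigma> * Q (2 * m - 1)) * (1 - \<sigma> * Q (2 * m))^2 * (1 - \<sigma> * Q (2 * m + 1))))"

fun aw_poly :: "real \<Rightarrow> complex \<Rightarrow> complex \<Rightarrow> complex \<Rightarrow> complex \<Rightarrow> nat \<Rightarrow> complex poly" where
  "aw_poly q a1 a2 a3 a4 0 = 1"
| "aw_poly q a1 a2 a3 a4 (Suc 0) = [:- aw_beta q a1 a2 a3 a4 0, 1:]"
| "aw_poly q a1 a2 a3 a4 (Suc (Suc n)) =
     [:- aw_beta q a1 a2 a3 a4 (Suc n), 1:] * aw_poly q a1 a2 a3 a4 (Suc n)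
     - smult (aw_eta q a1 a2 a3 a4 n) (aw_poly q a1 a2 a3 a4 n)"

text \<open>
  The requirement \<open>a\<^sub>1 \<noteq> 0\<close> is there because the formula for \<open>\<beta>\<^sub>n\<close> divides by \<open>a\<^sub>1\<close>. The polynomials
  with \<open>a\<^sub>1 = 0\<close> are limits of those with \<open>a\<^sub>1 \<noteq> 0\<close>.
\<close>

definition aw_admissible :: "real \<Rightarrow> complex \<Rightarrow> complex \<Rightarrow> complex \<Rightarrow> complex \<Rightarrow> bool" where
  "aw_admissible q a1 a2 a3 a4 \<longleftrightarrow> a1 \<noteq> 0 \<and>
     (\<forall>n::nat. let Q = (of_real q :: complex) ^ n in
        (1 - a1 * a2 * a3 * a4 * Q) * (1 - a1 * a2 * Q) * (1 - a1 * a3 * Q) * (1 - a1 * a4 * Q)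
        * (1 - a2 * a3 * Q) * (1 - a2 * a4 * Q) * (1 - a3 * a4 * Q) \<noteq> 0)"

text \<open>
  Multiples of the Askey-Wilson polynomials, or of special or limiting cases of them. The base \<open>q\<close>
  and the variable stay fixed, and the parameters vary along one sequence that serves all degrees
  at once. Constant parameter sequences give the Askey-Wilson polynomials themselves, including
  special values of the parameters. In the other sequences the parameters may tend to \<open>0\<close> or to
  infinity, or approach a value where the recurrence coefficients have removable singularities.
  Letting parameters tend to infinity yields the families with base \<open>q\<^sup>-\<^sup>1\<close>.
\<close>

definition aw_limiting_case :: "real \<Rightarrow> (nat \<Rightarrow> complex poly) \<Rightarrow> bool" where
  "aw_limiting_case q R \<longleftrightarrow>
     (\<exists>a1 a2 a3 a4 :: nat \<Rightarrow> complex.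
        (\<forall>k. aw_admissible q (a1 k) (a2 k) (a3 k) (a4 k)) \<and>
        (\<forall>n i. (\<lambda>k. coeff (aw_poly q (a1 k) (a2 k) (a3 k) (a4 k) n) i) \<longlonglongrightarrow> coeff (R n) i))"

definition multiples_of_aw_or_limiting :: "real \<Rightarrow> (nat \<Rightarrow> complex poly) \<Rightarrow> bool" where
  "multiples_of_aw_or_limiting q P \<longleftrightarrow>
     (\<exists>R \<kappa>. aw_limiting_case q R \<and> (\<forall>n. \<kappa> n \<noteq> 0 \<and> P n = smult (\<kappa> n) (R n)))"


lemma aw_alpha_gamma_minus_one:
  assumes "0 < q" "q < 1"
  shows "aw_alpha q (-1) = aw_alpha q 1" "aw_gamma q (-1) = -1"
proof -
  have "q powr (1/2) < q powr (- (1/2))"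
    using assms by (intro powr_less_mono') auto
  hence "(q powr (- (1/2)) - q powr (1/2)) / (q powr (1/2) - q powr (- (1/2))) = -1"
    by (simp add: divide_simps)
  thus "aw_gamma q (-1) = -1" by (simp add: aw_gamma_def)
  show "aw_alpha q (-1) = aw_alpha q 1" by (simp add: aw_alpha_def add.commute)
qed

lemma aw_x_shift:
  fixes q :: real and s :: complex
  assumes "0 < q"
  defines "u \<equiv> (of_real q :: complex) powr (1/2)"
  shows "u \<noteq> 0"
    and "of_real q powr s \<noteq> (0::complex)"
    and "aw_x q s = (of_real q powr s + inverse (of_real q powr s)) / 2"
    and "aw_x q (s + 1/2) = (of_real q powr s * u + inverse (of_real q powr s * u)) / 2"
    and "aw_x q (s - 1/2) = (of_real q powr s * inverse u + inverse (of_real q powr s) * u) / 2"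
proof -
  have inv: "aw_x q s = (of_real q powr s + inverse (of_real q powr s)) / 2" for s
    by (simp add: aw_x_def powr_minus)
  show "u \<noteq> 0" "of_real q powr s \<noteq> (0::complex)"
    using assms(1) by (simp_all add: u_def)
  show "aw_x q s = (of_real q powr s + inverse (of_real q powr s)) / 2" by (rule inv)
  have "of_real q powr (s + 1/2) = of_real q powr s * u"
    unfolding u_def by (rule powr_add)
  thus "aw_x q (s + 1/2) = (of_real q powr s * u + inverse (of_real q powr s * u)) / 2"
    by (simp only: inv)
  have "of_real q powr (s - 1/2) = of_real q powr s * inverse u"
    unfolding u_def by (simp only: powr_diff divide_inverse)
  thus "aw_x q (s - 1/2) = (of_real q powr s * inverse u + inverse (of_real q powr s) * u) / 2"
    by (simp only: inv inverse_mult_distrib inverse_inverse_eq)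
qed

lemma aw_x_half_square_ne:
  assumes "0 < q" "q < 1"
  shows "(of_real q :: complex) powr (1/2) * of_real q powr (1/2) \<noteq> 1"
  using assms by (simp flip: powr_add)

lemma aw_x_surj:
  assumes "0 < q" "q < 1"
  shows "\<exists>s. aw_x q s = z"
proof -
  define w where "w = z + csqrt (z^2 - 1)"
  have w: "w * (z - csqrt (z^2 - 1)) = 1"
    by (simp add: w_def algebra_simps flip: power2_eq_square)
  hence w0: "w \<noteq> 0" by auto
  have inv: "inverse w = z - csqrt (z^2 - 1)"
    using w by (rule inverse_unique)
  have lnq: "ln (of_real q :: complex) \<noteq> 0"
    using assms by (simp add: Ln_of_real)
  define s where "s = ln w / ln (of_real q)"
  have "of_real q powr s = w"
    using assms w0 lnq by (simp add: powr_def s_def)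
  hence "aw_x q s = (w + inverse w) / 2"
    using aw_x_shift(3)[OF assms(1)] by simp
  also have "\<dots> = z" by (simp only: inv) (simp add: w_def)
  finally show ?thesis by blast
qed

lemma aw_x_shift_eq_imp:
  assumes "0 < q" "q < 1" "aw_x q (s + 1/2) = aw_x q (s - 1/2)"
  shows "aw_x q s \<in> {1, -1}"
proof -
  define u where "u = (of_real q :: complex) powr (1/2)"
  define w where "w = (of_real q :: complex) powr s"
  note sh = aw_x_shift(1)[OF assms(1), folded u_def] aw_x_shift(2-5)[OF assms(1), where s = s, folded u_def w_def]
  have "(w * u + inverse (w * u)) / 2 = (w * inverse u + inverse w * u) / 2"
    using assms(3) by (simp only: sh(4,5))
  hence "w * u + inverse (w * u) = w * inverse u + inverse w * u"
    by (metis divide_cancel_right zero_neq_numeral)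
  hence "(u * u - 1) * (w * w - 1) = 0"
    using sh(1,2) by (simp add: field_simps)
  moreover have "u * u \<noteq> 1"
    using aw_x_half_square_ne[OF assms(1,2)] by (simp add: u_def)
  ultimately have "w * w = 1" by simp
  hence "w = 1 \<or> w = -1" by (simp add: square_eq_1_iff)
  thus ?thesis using sh(3) by auto
qed

lemma poly_eq_if_eq_off_pm1:
  fixes r r' :: "complex poly"
  assumes "\<And>z. z \<notin> {1, -1} \<Longrightarrow> poly r z = poly r' z"
  shows "r = r'"
proof (rule ccontr)
  assume "r \<noteq> r'"
  hence "finite {z. poly (r - r') z = 0}" by (intro poly_roots_finite) auto
  moreover have "UNIV - {1, -1} \<subseteq> {z. poly (r - r') z = 0}" using assms by auto
  ultimately have "finite (UNIV - {1, -1 :: complex})" by (rule rev_finite_subset)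
  thus False by (simp add: infinite_UNIV_char_0)
qed

lemma aw_D_S_exist:
  assumes "0 < q" "q < 1"
  shows "\<exists>r t. is_aw_D q p r \<and> is_aw_S q p t"
proof -
  define u where "u = (of_real q :: complex) powr (1/2)"
  define \<alpha> where "\<alpha> = (u + inverse u) / 2"
  have plus: "aw_x q (s + 1/2) + aw_x q (s - 1/2) = 2 * \<alpha> * aw_x q s" for s
  proof -
    note sh = aw_x_shift(1)[OF assms(1), folded u_def]
      aw_x_shift(2-5)[OF assms(1), where s = s, folded u_def]
    define w where "w = (of_real q :: complex) powr s"
    show ?thesis
      using sh(1,2) unfolding sh(3-5) \<alpha>_def w_def[symmetric]
      by (simp add: field_simps)
  qed
  have diff: "(aw_x q (s + 1/2) - aw_x q (s - 1/2))^2
      = 4 * ((\<alpha>^2 - 1) * ((aw_x q s)^2 - 1))" for s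
  proof -
    note sh = aw_x_shift(1)[OF assms(1), folded u_def] aw_x_shift(2-5)[OF assms(1), where s = s, folded u_def]
    define w where "w = (of_real q :: complex) powr s"
    show ?thesis
      using sh(1,2) unfolding sh(3-5) \<alpha>_def w_def[symmetric]
      by (simp add: divide_simps power2_eq_square) algebra
  qed
  have "\<exists>r t. \<forall>s. poly p (aw_x q (s + 1/2)) - poly p (aw_x q (s - 1/2))
            = (aw_x q (s + 1/2) - aw_x q (s - 1/2)) * poly r (aw_x q s)
        \<and> poly p (aw_x q (s + 1/2)) + poly p (aw_x q (s - 1/2)) = 2 * poly t (aw_x q s)"
  proof (induction p)
    case 0
    show ?case by (intro exI[of _ 0]) simp
  next
    case (pCons c p)
    then obtain r t where IH:
      "\<And>s. poly p (aw_x q (s + 1/2)) - poly p (aw_x q (s - 1/2))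
            = (aw_x q (s + 1/2) - aw_x q (s - 1/2)) * poly r (aw_x q s)"
      "\<And>s. poly p (aw_x q (s + 1/2)) + poly p (aw_x q (s - 1/2)) = 2 * poly t (aw_x q s)"
      by blast
    show ?case
    proof (rule exI[of _ "[:0, \<alpha>:] * r + t"],
        rule exI[of _ "[:c:] + [:0, \<alpha>:] * t + smult (\<alpha>^2 - 1) ([:-1, 0, 1:] * r)"],
        intro allI conjI)
      fix s
      define X Y z P P' where "X = aw_x q (s + 1/2)" and "Y = aw_x q (s - 1/2)" and "z = aw_x q s"
        and "P = poly p X" and "P' = poly p Y"
      note d = X_def Y_def z_def P_def P'_def
      have 1: "X + Y = 2 * \<alpha> * z" "(X - Y)^2 = 4 * ((\<alpha>^2 - 1) * (z^2 - 1))"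
        "P - P' = (X - Y) * poly r z" "P + P' = 2 * poly t z"
        using plus[of s] diff[of s] IH[of s] by (simp_all only: d)
      have "X * P - Y * P' = ((X + Y) * (P - P') + (X - Y) * (P + P')) / 2"
        by (simp add: algebra_simps)
      also have "\<dots> = (X - Y) * (\<alpha> * z * poly r z + poly t z)"
        unfolding 1(1,3,4) by (simp add: field_simps)
      finally show "poly (pCons c p) (aw_x q (s + 1/2)) - poly (pCons c p) (aw_x q (s - 1/2))
          = (aw_x q (s + 1/2) - aw_x q (s - 1/2)) * poly ([:0, \<alpha>:] * r + t) (aw_x q s)"
        unfolding d[symmetric] poly_pCons by (simp add: d(4,5) algebra_simps)
      have "X * P + Y * P' = ((X + Y) * (P + P') + (X - Y) * (P - P')) / 2"
        by (simp add: algebra_simps)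
      also have "\<dots> = 2 * \<alpha> * z * poly t z + (X - Y)^2 * poly r z / 2"
        unfolding 1(1,3,4) by (simp add: field_simps power2_eq_square)
      also have "\<dots> = 2 * (\<alpha> * z * poly t z + (\<alpha>^2 - 1) * (z^2 - 1) * poly r z)"
        unfolding 1(2) by (simp add: field_simps)
      finally show "poly (pCons c p) (aw_x q (s + 1/2)) + poly (pCons c p) (aw_x q (s - 1/2))
          = 2 * poly ([:c:] + [:0, \<alpha>:] * t + smult (\<alpha>^2 - 1) ([:-1, 0, 1:] * r)) (aw_x q s)"
        unfolding d[symmetric] poly_pCons by (simp add: d(4,5) algebra_simps power2_eq_square)
    qed
  qed
  then obtain r t where rt:
    "\<And>s. poly p (aw_x q (s + 1/2)) - poly p (aw_x q (s - 1/2))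
            = (aw_x q (s + 1/2) - aw_x q (s - 1/2)) * poly r (aw_x q s)"
    "\<And>s. poly p (aw_x q (s + 1/2)) + poly p (aw_x q (s - 1/2)) = 2 * poly t (aw_x q s)"
    by blast
  have "is_aw_D q p r" unfolding is_aw_D_def rt(1) by simp
  moreover have "is_aw_S q p t" unfolding is_aw_S_def rt(2) by simp
  ultimately show ?thesis by blast
qed

lemma is_aw_D_unique:
  assumes "0 < q" "q < 1" "is_aw_D q p r" "is_aw_D q p r'"
  shows "r = r'"
proof (rule poly_eq_if_eq_off_pm1)
  fix z :: complex assume z: "z \<notin> {1, -1}"
  obtain s where s: "aw_x q s = z" using aw_x_surj[OF assms(1,2)] by blast
  hence "aw_x q (s + 1/2) \<noteq> aw_x q (s - 1/2)"
    using aw_x_shift_eq_imp[OF assms(1,2)] z by blast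
  thus "poly r z = poly r' z"
    using assms(3,4) s unfolding is_aw_D_def by metis
qed

lemma is_aw_S_unique:
  assumes "0 < q" "q < 1" "is_aw_S q p r" "is_aw_S q p r'"
  shows "r = r'"
proof (rule poly_eq_if_eq_off_pm1)
  fix z :: complex
  obtain s where s: "aw_x q s = z" using aw_x_surj[OF assms(1,2)] by blast
  thus "poly r z = poly r' z"
    using assms(3,4) unfolding is_aw_S_def by metis
qed

lemma is_aw_D_aw_D:
  assumes "0 < q" "q < 1"
  shows "is_aw_D q p (aw_D q p)"
  unfolding aw_D_def using aw_D_S_exist[OF assms, of p] is_aw_D_unique[OF assms] by (metis theI')

lemma is_aw_S_aw_S:
  assumes "0 < q" "q < 1"
  shows "is_aw_S q p (aw_S q p)"
  unfolding aw_S_def using aw_D_S_exist[OF assms, of p] is_aw_S_unique[OF assms] by (metis theI')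

end

(* Put v(g) = u(S^-1 g), so that u(f) = v(S f) for the orthogonality functional u. The structure
   relation at n = 0 says that v solves a Pearson equation v(phi0 D f + psi0 S f) = 0 of degrees
   2 and 1. For such a functional the solutions (F, G) of v(F D f + G S f) = 0 for all f form a
   principal module, generated by (phi0, psi0). Testing the relation against P_1 and P_2 and
   comparing leading coefficients gives a <> 0 and the value of c_3 / C_3. With these,
   u(phi D f + psi S f) is a multiple of v(F D D f) for some F of degree at most 2, and conditions
   (i), (ii) say that this vanishes for f of degree at most 4. Multiples of F on which v has to vanish
   beyond that degree are produced by the Pearson equation, so u itself satisfies the Pearson equation
   with phi and psi. The operator phi D D + psi S D is then symmetric for u, hence has the P_n as eigenvectors.
   Comparing the three leading coefficients expresses B_n and C_n through the coefficients of the
   quartic that the lattice substitution attaches to (phi, psi), in the same way as the Askey-Wilson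
   coefficients are obtained from the product of the 1 - a_i w. Factoring the quartic and moving its
   roots slightly yields the admissible parameters. *)

theory Submission
  imports Defs "HOL-Computational_Algebra.Fundamental_Theorem_Algebra"
begin

section \<open>Product rules and leading coefficients\<close>

text \<open>In the code the orthogonality functional is \<open>L\<close>, while \<open>u\<close> is
  the square root of q. The structure relation sets D against S, so it describes no single operator
  on the P_n. Once S is inverted it says that \<open>W\<close> = S^-1 \<pi> D is tridiagonal on
  them, and transposing \<open>W\<close> with respect to \<open>L\<close> gives one identity for
  each P_k. The price is that regularity is not carried over to \<open>v\<close>: what passes from
  \<open>L\<close> is that no nonzero polynomial multiple of \<open>v\<close> vanishes, and that
  \<open>v\<close> does not vanish at 1. The nonvanishing of the leading coefficients
  \<open>d n\<close>, on which the solvability and degree arguments rest, has to be derived from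
  these two facts. The polynomial F is a priori cubic. The constant \<open>t\<close> is fixed by the
  vanishing of its cubic term, and the value of c_3 / C_3 turns \<open>t\<close> into 1 - 2 a C_3 /
  r_3, the combination in the claimed formulas. The quartic may lack its top degrees or vanish at 0;
  it is therefore split into forms x - y w with ratios y / x as parameters, and a vanishing x is a
  parameter at infinity.\<close>

locale askey_wilson_base =
  fixes q :: real
  assumes q_pos: "0 < q" and q_less_1: "q < 1"
begin

abbreviation D :: "complex poly \<Rightarrow> complex poly" where "D \<equiv> aw_D q"
abbreviation S :: "complex poly \<Rightarrow> complex poly" where "S \<equiv> aw_S q"

definition u :: complex where "u = of_real (q powr (1/2))"
definition \<alpha> :: complex where "\<alpha> = (u + inverse u) / 2"
text \<open>\<open>A\<close> and \<open>G\<close> are \<alpha>_n and \<gamma>_n with powers of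
  \<open>u\<close> in place of real powers of q, so that relations between them become polynomial
  identities.\<close>

definition A :: "nat \<Rightarrow> complex" where "A n = (u ^ n + inverse u ^ n) / 2"
definition G :: "nat \<Rightarrow> complex" where "G n = (u ^ n - inverse u ^ n) / (u - inverse u)"

text \<open>A quarter of (x(s+1/2) - x(s-1/2))^2 as a polynomial in x(s).\<close>

definition U2 :: "complex poly" where "U2 = [:1 - \<alpha>\<^sup>2, 0, \<alpha>\<^sup>2 - 1:]"

lemma u_real: "u = of_real (sqrt q)" "0 < sqrt q" "sqrt q < 1"
  using q_pos q_less_1 by (auto simp: u_def powr_half_sqrt)

lemma u_nz [simp]: "u \<noteq> 0"
  using u_real by auto

lemma u_sq: "u\<^sup>2 = of_real q"
  using u_real(1) q_pos by (simp flip: of_real_power)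

lemma u_power_eq_iff: "u ^ m = u ^ n \<longleftrightarrow> m = n"
proof -
  have "u ^ m = u ^ n \<longleftrightarrow> sqrt q ^ m = sqrt q ^ n"
    unfolding u_real(1) of_real_power[symmetric] of_real_eq_iff ..
  then show ?thesis
    using u_real(2,3) by (simp add: power_inject_exp')
qed

lemma u_power_eq_1_iff [simp]: "u ^ n = 1 \<longleftrightarrow> n = 0"
  using u_power_eq_iff[of n 0] by simp

lemma u_ne_inverse [simp]: "u \<noteq> inverse u"
proof
  assume "u = inverse u"
  then have "u * u = 1" by (metis right_inverse u_nz)
  then show False using u_power_eq_1_iff[of 2] by (simp add: power2_eq_square)
qed

lemma two_alpha: "2 * \<alpha> = u + inverse u"
  by (simp add: \<alpha>_def)

lemma four_alpha_sq_sub_1: "4 * (\<alpha>\<^sup>2 - 1) = (u - inverse u)\<^sup>2"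
proof -
  have "u * inverse u = 1" by simp
  with two_alpha show ?thesis by algebra
qed

lemma alpha_sq_sub_1: "\<alpha>\<^sup>2 - 1 = (u - inverse u)\<^sup>2 / 4"
  using four_alpha_sq_sub_1 by (simp add: field_simps)

lemma alpha_sq_nz [simp]: "\<alpha>\<^sup>2 - 1 \<noteq> 0" "\<alpha>\<^sup>2 \<noteq> 1"
proof -
  show "\<alpha>\<^sup>2 - 1 \<noteq> 0" unfolding alpha_sq_sub_1 by simp
  then show "\<alpha>\<^sup>2 \<noteq> 1" by simp
qed

lemma A_0 [simp]: "A 0 = 1" and G_0 [simp]: "G 0 = 0"
  and A_1: "A (Suc 0) = \<alpha>" and G_1 [simp]: "G (Suc 0) = 1"
  by (simp_all add: A_def G_def \<alpha>_def)

lemma G_mult: "(u - inverse u) * G n = u ^ n - inverse u ^ n"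
  by (simp add: G_def)

lemma two_A: "2 * A n = u ^ n + inverse u ^ n"
  by (simp add: A_def)

lemma A_Suc: "A (Suc n) = \<alpha> * A n + (\<alpha>\<^sup>2 - 1) * G n"
proof -
  have "4 * a' = 4 * (al * a + (al\<^sup>2 - 1) * g)"
    if "2 * a = x + y" "2 * a' = v * x + w * y" "(v - w) * g = x - y" "2 * al = v + w"
      "4 * (al\<^sup>2 - 1) = (v - w)\<^sup>2" for a a' al g x y v w :: complex
    using that by algebra
  from this[OF two_A[of n] two_A[of "Suc n", unfolded power_Suc] G_mult two_alpha four_alpha_sq_sub_1]
  show ?thesis by (metis mult_left_cancel zero_neq_numeral)
qed

lemma G_Suc: "G (Suc n) = \<alpha> * G n + A n"
proof -
  have "2 * (v - w) * g' = 2 * (v - w) * (al * g + a)"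
    if "2 * a = x + y" "(v - w) * g = x - y" "(v - w) * g' = v * x - w * y" "2 * al = v + w"
    for a al g g' x y v w :: complex
    using that by algebra
  from this[OF two_A G_mult[of n] G_mult[of "Suc n", unfolded power_Suc] two_alpha]
  show ?thesis by simp
qed

lemma A_nz [simp]: "A n \<noteq> 0"
proof -
  have "A n = of_real ((sqrt q ^ n + inverse (sqrt q) ^ n) / 2)"
    by (simp add: A_def u_real(1) del: real_sqrt_inverse)
  moreover have "sqrt q ^ n + inverse (sqrt q) ^ n > 0"
    using u_real(2) by (intro add_pos_pos) auto
  ultimately show ?thesis by (metis divide_eq_0_iff of_real_eq_0_iff order_less_irrefl zero_neq_numeral)
qed

lemma alpha_nz [simp]: "\<alpha> \<noteq> 0"
  using A_nz[of 1] A_1 by simp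

lemma G_nz [simp]: "G n = 0 \<longleftrightarrow> n = 0"
proof
  assume "G n = 0"
  then have "u ^ n = inverse u ^ n" using G_mult[of n] by simp
  then have "u ^ n * u ^ n = u ^ n * inverse u ^ n" by (rule arg_cong)
  also have "\<dots> = (u * inverse u) ^ n" by (rule power_mult_distrib[symmetric])
  finally have "u ^ n * u ^ n = 1" by simp
  then have "u ^ (n + n) = 1" by (simp only: power_add)
  then show "n = 0" by (simp only: u_power_eq_1_iff)
qed simp

text \<open>This is cosh^2 - sinh^2 = 1: \<open>A n\<close> is cosh (n log u), and (\<alpha>^2 - 1)
  \<open>G n\<close>^2 is sinh^2 of the same argument. Because of it the leading coefficients
  \<open>d n\<close> and \<open>e n\<close> of a Pearson pair cannot vanish together.\<close>

lemma A_G_det: "A n ^ 2 - (\<alpha>\<^sup>2 - 1) * G n ^ 2 = 1"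
proof (induction n)
  case (Suc n)
  have "A (Suc n) ^ 2 - (\<alpha>\<^sup>2 - 1) * G (Suc n) ^ 2 = A n ^ 2 - (\<alpha>\<^sup>2 - 1) * G n ^ 2"
    unfolding A_Suc G_Suc by algebra
  with Suc show ?case by simp
qed simp

lemma powr_half_nat: "q powr (real n / 2) = sqrt q ^ n"
proof -
  have "q powr (real n / 2) = (q powr (1/2)) powr real n"
    by (simp add: powr_powr)
  then show ?thesis
    using q_pos by (simp add: powr_half_sqrt powr_realpow)
qed

lemma powr_neg_half_nat: "q powr (- (real n / 2)) = inverse (sqrt q) ^ n"
  using powr_half_nat by (simp add: powr_minus power_inverse)

lemma aw_alpha_nat: "aw_alpha q (int n) = A n"
  unfolding aw_alpha_def A_def u_real(1) of_int_of_nat_eq powr_half_nat powr_neg_half_nat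
  by (simp only: of_real_add of_real_divide of_real_power of_real_inverse of_real_numeral)

lemma aw_gamma_nat: "aw_gamma q (int n) = G n"
proof -
  have "q powr (1/2) = sqrt q" "q powr (- (1/2)) = inverse (sqrt q)"
    using powr_half_nat[of 1] powr_neg_half_nat[of 1] by simp_all
  then show ?thesis
    unfolding aw_gamma_def G_def u_real(1) of_int_of_nat_eq powr_half_nat powr_neg_half_nat
    by (simp only: of_real_diff of_real_divide of_real_power of_real_inverse)
qed

text \<open>Away from 1 and -1 every z is a lattice point with distinct neighbours X and Y, and
  there both operators are expressions in the values at X and Y. Operator identities reduce to
  algebra in X and Y, and the two excluded points do not matter for polynomials.\<close>

lemma shift_values:
  assumes "z \<notin> {1, -1}"
  obtains X Y where "X \<noteq> Y" "X + Y = 2 * \<alpha> * z" "(X - Y)\<^sup>2 = 4 * ((\<alpha>\<^sup>2 - 1) * (z\<^sup>2 - 1))"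
    "\<And>p. poly (D p) z = (poly p X - poly p Y) / (X - Y)"
    "\<And>p. poly (S p) z = (poly p X + poly p Y) / 2"
proof -
  obtain s where s: "aw_x q s = z" using aw_x_surj[OF q_pos q_less_1] by blast
  define X where "X = aw_x q (s + 1/2)"
  define Y where "Y = aw_x q (s - 1/2)"
  have neq: "X \<noteq> Y"
    using aw_x_shift_eq_imp[OF q_pos q_less_1, of s] assms s by (auto simp: X_def Y_def)
  have u': "of_real q powr (1/2) = u"
    using q_pos powr_of_real[of q "1/2"] by (simp add: u_def)
  define w where "w = of_real q powr s"
  have w: "w \<noteq> 0" using aw_x_shift(2)[OF q_pos] by (simp add: w_def)
  have z: "z = (w + inverse w) / 2"
    using aw_x_shift(3)[OF q_pos, of s] s by (simp add: w_def)
  have X: "X = (w * u + inverse (w * u)) / 2"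
    using aw_x_shift(4)[OF q_pos, of s] by (simp only: X_def w_def u')
  have Y: "Y = (w * inverse u + inverse w * u) / 2"
    using aw_x_shift(5)[OF q_pos, of s] by (simp only: Y_def w_def u')
  have sum: "X + Y = 2 * \<alpha> * z"
    using w by (simp add: X Y z \<alpha>_def field_simps)
  have "X - Y = (u - inverse u) * (w - inverse w) / 2"
    using w by (simp add: X Y field_simps)
  moreover have "z\<^sup>2 - 1 = (w - inverse w)\<^sup>2 / 4"
    using w by (simp add: z field_simps power2_eq_square)
  ultimately have sq: "(X - Y)\<^sup>2 = 4 * ((\<alpha>\<^sup>2 - 1) * (z\<^sup>2 - 1))"
    unfolding alpha_sq_sub_1 by (simp only: power_mult_distrib power_divide) simp
  show ?thesis
  proof (rule that[OF neq sum sq])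
    fix p
    show "poly (D p) z = (poly p X - poly p Y) / (X - Y)"
      using is_aw_D_aw_D[OF q_pos q_less_1, of p] neq s unfolding is_aw_D_def X_def Y_def by blast
    show "poly (S p) z = (poly p X + poly p Y) / 2"
      using is_aw_S_aw_S[OF q_pos q_less_1, of p] s unfolding is_aw_S_def X_def Y_def by blast
  qed
qed

section \<open>Product rules, linearity and the action on coefficient lists\<close>

lemma D_mult: "D (f * g) = D f * S g + S f * D g"
proof (rule poly_eq_if_eq_off_pm1)
  fix z :: complex assume "z \<notin> {1, -1}"
  then show "poly (D (f * g)) z = poly (D f * S g + S f * D g) z"
  proof (rule shift_values)
    fix X Y assume *: "X \<noteq> Y"
      "\<And>p. poly (D p) z = (poly p X - poly p Y) / (X - Y)" "\<And>p. poly (S p) z = (poly p X + poly p Y) / 2"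
    show ?thesis
      unfolding poly_add poly_mult *(2,3) using *(1) by (simp add: divide_simps) (simp add: algebra_simps)
  qed
qed

lemma poly_U2: "poly U2 z = (\<alpha>\<^sup>2 - 1) * (z\<^sup>2 - 1)"
  by (simp add: U2_def algebra_simps power2_eq_square)

lemma S_mult: "S (f * g) = S f * S g + U2 * D f * D g"
proof (rule poly_eq_if_eq_off_pm1)
  fix z :: complex assume "z \<notin> {1, -1}"
  then show "poly (S (f * g)) z = poly (S f * S g + U2 * D f * D g) z"
  proof (rule shift_values)
    fix X Y assume *: "X \<noteq> Y" "(X - Y)\<^sup>2 = 4 * ((\<alpha>\<^sup>2 - 1) * (z\<^sup>2 - 1))"
      "\<And>p. poly (D p) z = (poly p X - poly p Y) / (X - Y)" "\<And>p. poly (S p) z = (poly p X + poly p Y) / 2"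
    define f' where "f' = (poly f X - poly f Y) / (X - Y)"
    define g' where "g' = (poly g X - poly g Y) / (X - Y)"
    have "(X - Y) * f' = poly f X - poly f Y" "(X - Y) * g' = poly g X - poly g Y"
      using *(1) by (simp_all add: f'_def g'_def)
    moreover have "4 * poly U2 z = (X - Y)\<^sup>2" using *(2) by (simp add: poly_U2)
    ultimately have "4 * (poly U2 z * f' * g') = (poly f X - poly f Y) * (poly g X - poly g Y)"
      by algebra
    then have "poly U2 z * f' * g' = (poly f X - poly f Y) * (poly g X - poly g Y) / 4"
      by (metis nonzero_mult_div_cancel_left zero_neq_numeral)
    then have "poly U2 z * poly (D f) z * poly (D g) z = (poly f X - poly f Y) * (poly g X - poly g Y) / 4"
      unfolding *(3) f'_def g'_def .
    then show ?thesis
      unfolding poly_add poly_mult *(4) by (simp only:) (simp add: field_simps)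
  qed
qed

lemma D_S_eqI:
  assumes "\<And>z X Y. X \<noteq> Y \<Longrightarrow> X + Y = 2 * \<alpha> * z \<Longrightarrow>
     (\<And>p. poly (D p) z = (poly p X - poly p Y) / (X - Y)) \<Longrightarrow>
     (\<And>p. poly (S p) z = (poly p X + poly p Y) / 2) \<Longrightarrow> poly f z = poly g z"
  shows "f = g"
proof (rule poly_eq_if_eq_off_pm1)
  fix z :: complex assume "z \<notin> {1, -1}"
  then show "poly f z = poly g z"
    by (rule shift_values) (rule assms)
qed

lemma D_add: "D (f + g) = D f + D g"
proof (rule D_S_eqI)
  fix z X Y assume *: "\<And>p. poly (D p) z = (poly p X - poly p Y) / (X - Y)"
  show "poly (D (f + g)) z = poly (D f + D g) z"
    unfolding poly_add * by (simp add: add_divide_distrib diff_divide_distrib)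
qed

lemma S_add: "S (f + g) = S f + S g"
proof (rule D_S_eqI)
  fix z X Y assume *: "\<And>p. poly (S p) z = (poly p X + poly p Y) / 2"
  show "poly (S (f + g)) z = poly (S f + S g) z"
    unfolding poly_add * by (simp add: add_divide_distrib)
qed

lemma D_const [simp]: "D [:c:] = 0"
proof (rule D_S_eqI)
  fix z X Y assume *: "\<And>p. poly (D p) z = (poly p X - poly p Y) / (X - Y)"
  show "poly (D [:c:]) z = poly 0 z" unfolding * by simp
qed

lemma S_const [simp]: "S [:c:] = [:c:]"
proof (rule D_S_eqI)
  fix z X Y assume *: "\<And>p. poly (S p) z = (poly p X + poly p Y) / 2"
  show "poly (S [:c:]) z = poly [:c:] z" unfolding * by simp
qed

lemma D_smult: "D (smult c f) = smult c (D f)" and S_smult: "S (smult c f) = smult c (S f)"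
  using D_mult[of "[:c:]" f] S_mult[of "[:c:]" f] by simp_all

lemma D_0 [simp]: "D 0 = 0" and S_0 [simp]: "S 0 = 0"
  and D_1 [simp]: "D 1 = 0" and S_1 [simp]: "S 1 = 1"
  using D_const[of 0] S_const[of 0] D_const[of 1] S_const[of 1] by (simp_all add: one_pCons)

lemma D_diff: "D (f - g) = D f - D g" and S_diff: "S (f - g) = S f - S g"
  using D_add[of "f - g" g] S_add[of "f - g" g] by simp_all

lemma D_X: "D [:0, 1:] = 1"
proof (rule D_S_eqI)
  fix z X Y assume *: "X \<noteq> Y" "\<And>p. poly (D p) z = (poly p X - poly p Y) / (X - Y)"
  show "poly (D [:0, 1:]) z = poly 1 z" unfolding *(2) using *(1) by simp
qed

lemma S_X: "S [:0, 1:] = [:0, \<alpha>:]"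
proof (rule D_S_eqI)
  fix z X Y assume *: "X + Y = 2 * \<alpha> * z" "\<And>p. poly (S p) z = (poly p X + poly p Y) / 2"
  have "poly [:0, 1:] X + poly [:0, 1:] Y = 2 * \<alpha> * z" using *(1) by simp
  then show "poly (S [:0, 1:]) z = poly [:0, \<alpha>:] z" unfolding *(2) by simp
qed

lemma D_pCons: "D (pCons c p) = pCons 0 (smult \<alpha> (D p)) + S p"
  and S_pCons: "S (pCons c p) = [:c:] + pCons 0 (smult \<alpha> (S p)) + U2 * D p"
proof -
  have *: "pCons c p = [:c:] + [:0, 1:] * p" by simp
  show "D (pCons c p) = pCons 0 (smult \<alpha> (D p)) + S p"
    using arg_cong[OF *, of D] unfolding D_add D_mult D_X S_X by simp
  show "S (pCons c p) = [:c:] + pCons 0 (smult \<alpha> (S p)) + U2 * D p"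
    using arg_cong[OF *, of S] unfolding S_add S_mult D_X S_X by simp
qed

lemma degree_leading_D_S:
  "degree p \<le> n \<Longrightarrow> degree (S p) \<le> n \<and> coeff (S p) n = A n * coeff p n \<and>
     degree (D p) \<le> n - 1 \<and> (n = 0 \<longrightarrow> D p = 0) \<and> (\<forall>m. n = Suc m \<longrightarrow> coeff (D p) m = G n * coeff p n)"
proof (induction p arbitrary: n)
  case 0
  show ?case by simp
next
  case (pCons c p)
  show ?case
  proof (cases n)
    case 0
    then obtain d where "pCons c p = [:d:]" using pCons.prems by (metis le_zero_eq degree_eq_zeroE)
    then show ?thesis using 0 by simp
  next
    case (Suc m)
    have dp: "degree p \<le> m" using pCons.prems Suc by (auto simp: degree_pCons_eq_if split: if_splits)
    note IH = pCons.IH[OF dp]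
    have U: "degree (U2 * D p) \<le> Suc m" and UL: "coeff (U2 * D p) (Suc m) = (\<alpha>\<^sup>2 - 1) * G m * coeff p m"
    proof -
      consider "m = 0" | k where "m = Suc k" by (cases m) auto
      then have "degree (U2 * D p) \<le> Suc m \<and> coeff (U2 * D p) (Suc m) = (\<alpha>\<^sup>2 - 1) * G m * coeff p m"
      proof cases
        case 1
        then show ?thesis using IH by simp
      next
        case 2
        have dD: "degree (D p) \<le> k" using IH 2 by simp
        have dU: "degree U2 \<le> 2" by (simp add: U2_def)
        have "degree (U2 * D p) \<le> 2 + k" using degree_mult_le[of U2 "D p"] dD dU by linarith
        moreover have "coeff (U2 * D p) (2 + k) = coeff U2 2 * coeff (D p) k"
        proof -
          have "coeff (U2 * D p) (2 + k) = (\<Sum>i\<le>2 + k. coeff U2 i * coeff (D p) (2 + k - i))"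
            by (rule coeff_mult)
          also have "\<dots> = (\<Sum>i\<in>{2}. coeff U2 i * coeff (D p) (2 + k - i))"
          proof (rule sum.mono_neutral_right)
            show "\<forall>i\<in>{..2 + k} - {2}. coeff U2 i * coeff (D p) (2 + k - i) = 0"
            proof
              fix i assume "i \<in> {..2 + k} - {2}"
              then have "i < 2 \<or> i > 2" by auto
              then show "coeff U2 i * coeff (D p) (2 + k - i) = 0"
                using dU dD by (auto intro: coeff_eq_0)
            qed
          qed auto
          finally show ?thesis by simp
        qed
        ultimately show ?thesis
          using IH 2 by (simp add: U2_def numeral_2_eq_2)
      qed
      then show "degree (U2 * D p) \<le> Suc m" "coeff (U2 * D p) (Suc m) = (\<alpha>\<^sup>2 - 1) * G m * coeff p m"
        by auto
    qed
    have 1: "degree (pCons 0 (smult \<alpha> (S p))) \<le> Suc m"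
      using IH by (auto simp: degree_pCons_eq_if)
    have "degree (S (pCons c p)) \<le> Suc m"
      unfolding S_pCons by (intro degree_add_le) (use 1 U in auto)
    moreover have "coeff (S (pCons c p)) (Suc m) = A (Suc m) * coeff p m"
      unfolding S_pCons using IH UL by (simp add: A_Suc algebra_simps)
    moreover have "degree (D (pCons c p)) \<le> m"
    proof (cases m)
      case 0
      then show ?thesis using IH by (simp add: D_pCons)
    next
      case (Suc k)
      then show ?thesis unfolding D_pCons
        by (intro degree_add_le) (use IH in \<open>auto simp: degree_pCons_eq_if\<close>)
    qed
    moreover have "coeff (D (pCons c p)) m = G (Suc m) * coeff p m"
    proof (cases m)
      case 0
      then show ?thesis using IH by (simp add: D_pCons)
    next
      case (Suc k)
      then show ?thesis using IH by (simp add: D_pCons G_Suc algebra_simps)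
    qed
    ultimately show ?thesis using Suc by simp
  qed
qed

lemma degree_S_le: "degree (S p) \<le> degree p"
  using degree_leading_D_S[of p "degree p"] by simp

lemma degree_D_le: "degree (D p) \<le> degree p - 1"
  using degree_leading_D_S[of p "degree p"] by simp

lemma coeff_S_top: "degree p \<le> n \<Longrightarrow> coeff (S p) n = A n * coeff p n"
  using degree_leading_D_S[of p n] by simp

lemma coeff_D_top: "degree p \<le> Suc n \<Longrightarrow> coeff (D p) n = G (Suc n) * coeff p (Suc n)"
  using degree_leading_D_S[of p "Suc n"] by simp

section \<open>Bijectivity of S and surjectivity of D\<close>

lemma degree_S [simp]: "degree (S p) = degree p"
proof (cases "p = 0")
  case False
  then have "coeff (S p) (degree p) \<noteq> 0" by (simp add: coeff_S_top)
  then show ?thesis by (intro le_antisym degree_S_le le_degree)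
qed simp

lemma S_eq_0_iff [simp]: "S p = 0 \<longleftrightarrow> p = 0"
proof
  assume "S p = 0"
  then have "coeff (S p) (degree p) = 0" by simp
  then show "p = 0" by (simp add: coeff_S_top)
qed simp

lemma S_inj: "inj S"
proof (rule injI)
  fix p r assume "S p = S r"
  then have "S (p - r) = 0" by (simp add: S_diff)
  then show "p = r" by simp
qed

text \<open>S is triangular with the nonzero diagonal entries \<open>A n\<close>, so a leading term
  can be removed by a monomial and the degree drops.\<close>

lemma S_surj_degree: "\<exists>p. S p = g \<and> degree p = degree g"
proof (induction "degree g" arbitrary: g rule: less_induct)
  case less
  show ?case
  proof (cases "degree g = 0")
    case True
    then obtain c where "g = [:c:]" by (metis degree_eq_zeroE)
    then show ?thesis by (intro exI[of _ "[:c:]"]) simp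
  next
    case False
    define n where "n = degree g"
    define m where "m = monom (coeff g n / A n) n"
    have dm: "degree m \<le> n" by (simp add: m_def degree_monom_le)
    have "coeff (S m) n = coeff g n" using coeff_S_top[OF dm] by (simp add: m_def)
    then have c0: "coeff (g - S m) n = 0" by simp
    have "degree (g - S m) \<le> n" using dm by (intro degree_diff_le) (auto simp: n_def)
    then have lt: "degree (g - S m) < n"
      using c0 False n_def by (metis degree_0 leading_coeff_0_iff le_neq_implies_less neq0_conv)
    then obtain p where p: "S p = g - S m"
      using less[of "g - S m"] by (auto simp: n_def)
    then have "S (p + m) = g" by (simp add: S_add)
    then show ?thesis using degree_S[of "p + m"] by metis
  qed
qed

definition S_inv :: "complex poly \<Rightarrow> complex poly" where "S_inv = inv S"

lemma S_S_inv [simp]: "S (S_inv g) = g"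
proof -
  obtain p where "S p = g" using S_surj_degree by blast
  then show ?thesis unfolding S_inv_def using f_inv_into_f[of g S UNIV] by blast
qed

lemma S_inv_S [simp]: "S_inv (S p) = p"
  by (simp add: S_inv_def S_inj)

lemma S_inv_add: "S_inv (f + g) = S_inv f + S_inv g"
  by (metis S_S_inv S_add S_inv_S)

lemma S_inv_smult: "S_inv (smult c g) = smult c (S_inv g)"
  by (metis S_S_inv S_smult S_inv_S)

lemma D_surj_degree: "\<exists>p. D p = g \<and> degree p \<le> Suc (degree g)"
proof (induction "degree g" arbitrary: g rule: less_induct)
  case less
  define n where "n = degree g"
  define m where "m = monom (coeff g n / G (Suc n)) (Suc n)"
  have dm: "degree m \<le> Suc n" by (simp add: m_def degree_monom_le)
  have "coeff (D m) n = coeff g n" using coeff_D_top[OF dm] by (simp add: m_def)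
  then have c0: "coeff (g - D m) n = 0" by simp
  have dle: "degree (g - D m) \<le> n"
    using dm degree_D_le[of m] by (intro degree_diff_le) (auto simp: n_def)
  show ?case
  proof (cases "g - D m = 0")
    case True
    then show ?thesis using dm n_def by (intro exI[of _ m]) auto
  next
    case False
    then have "degree (g - D m) < n" using c0 dle by (metis leading_coeff_0_iff le_neq_implies_less)
    then obtain p where "D p = g - D m" "degree p \<le> Suc (degree (g - D m))"
      using less[of "g - D m"] by (auto simp: n_def)
    then show ?thesis using dm dle n_def
      by (intro exI[of _ "p + m"]) (auto simp: D_add intro!: degree_add_le)
  qed
qed

lemma D_eq_0_iff: "D p = 0 \<longleftrightarrow> degree p = 0"
proof
  assume "D p = 0"
  show "degree p = 0"
  proof (rule ccontr)
    assume "degree p \<noteq> 0"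
    then obtain n where n: "degree p = Suc n" by (cases "degree p") auto
    then have "coeff (D p) n = G (Suc n) * coeff p (Suc n)" by (simp add: coeff_D_top)
    moreover have "coeff p (Suc n) \<noteq> 0" using n by (metis leading_coeff_0_iff degree_0 nat.distinct(1))
    ultimately show False using \<open>D p = 0\<close> by simp
  qed
next
  assume "degree p = 0"
  then obtain c where "p = [:c:]" by (metis degree_eq_zeroE)
  then show "D p = 0" by simp
qed

end

section \<open>Pearson equations\<close>

lemma coeff_mult_top:
  fixes f g :: "'a::comm_semiring_0 poly"
  assumes "degree f \<le> m" "degree g \<le> n"
  shows "coeff (f * g) (m + n) = coeff f m * coeff g n"
proof -
  have "coeff (f * g) (m + n) = (\<Sum>i\<le>m + n. coeff f i * coeff g (m + n - i))"
    by (rule coeff_mult)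
  also have "\<dots> = (\<Sum>i\<in>{m}. coeff f i * coeff g (m + n - i))"
  proof (rule sum.mono_neutral_right)
    show "\<forall>i\<in>{..m + n} - {m}. coeff f i * coeff g (m + n - i) = 0"
    proof
      fix i assume "i \<in> {..m + n} - {m}"
      then have "i > m \<or> m + n - i > n" by auto
      then show "coeff f i * coeff g (m + n - i) = 0"
        using assms by (auto simp: coeff_eq_0)
    qed
  qed auto
  finally show ?thesis by simp
qed

lemma degree_mult_le': "degree f \<le> m \<Longrightarrow> degree g \<le> n \<Longrightarrow> degree (f * g) \<le> m + n"
  using degree_mult_le[of f g] by linarith

section \<open>Multipliers adapted to lattice neighbours\<close>

context askey_wilson_base
begin

lemma degree_U2: "degree U2 \<le> 2" and coeff_U2: "coeff U2 2 = \<alpha>\<^sup>2 - 1"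
  by (simp_all add: U2_def numeral_2_eq_2)

text \<open>For c = x(s) the neighbours have sum 2 \<alpha> c and product c^2 + \<alpha>^2 - 1, the
  latter from the formula for the square of their difference.\<close>

definition K1 :: "complex \<Rightarrow> complex poly" where
  "K1 c = [:c\<^sup>2 + \<alpha>\<^sup>2 - 1, - (2 * \<alpha> * c), 1:]"

lemma D_K1: "D (K1 c) = smult (2 * \<alpha>) [:- c, 1:]"
  and S_K1: "S (K1 c) = [:- c, 1:] * [:- c, 2 * \<alpha>\<^sup>2 - 1:]"
  by (simp_all add: K1_def D_pCons S_pCons U2_def algebra_simps power2_eq_square)

text \<open>\<^term>\<open>K1 c\<close> vanishes at the two lattice neighbours of \<open>c\<close>, so both operators map its multiples
  to polynomials that vanish at \<open>c\<close>.\<close>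

lemma S_K1_mult: "S (K1 c * f) = [:- c, 1:] * ([:- c, 2 * \<alpha>\<^sup>2 - 1:] * S f + smult (2 * \<alpha>) (U2 * D f))"
  and D_K1_mult: "D (K1 c * f) = [:- c, 1:] * ([:- c, 2 * \<alpha>\<^sup>2 - 1:] * D f + smult (2 * \<alpha>) (S f))"
proof -
  have "L * M * s + U * smult k L * t = L * (M * s + smult k (U * t))"
    "smult k L * s + L * M * t = L * (M * t + smult k s)" for L M U s t :: "complex poly" and k
    by (simp_all add: algebra_simps)
  then show "S (K1 c * f) = [:- c, 1:] * ([:- c, 2 * \<alpha>\<^sup>2 - 1:] * S f + smult (2 * \<alpha>) (U2 * D f))"
    "D (K1 c * f) = [:- c, 1:] * ([:- c, 2 * \<alpha>\<^sup>2 - 1:] * D f + smult (2 * \<alpha>) (S f))"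
    unfolding S_mult D_mult D_K1 S_K1 by blast+
qed

text \<open>Over the complex numbers Q splits, and each root c contributes a factor
  \<open>K1 c\<close>, which leaves either operator as z - c. This moves divisibility inside the
  operators, where the test polynomial of a Pearson equation sits.\<close>

lemma exists_K:
  assumes "Q \<noteq> 0"
  shows "\<exists>K. K \<noteq> 0 \<and> degree K = 2 * degree Q \<and> (\<forall>f. Q dvd S (K * f) \<and> Q dvd D (K * f))"
  using assms
proof (induction "degree Q" arbitrary: Q)
  case 0
  then have "Q dvd 1" by (simp add: is_unit_iff_degree)
  then have "\<forall>f. Q dvd S (1 * f) \<and> Q dvd D (1 * f)" by (meson dvd_trans one_dvd)
  with 0 show ?case by (intro exI[of _ 1]) simp
next
  case (Suc n)
  have "\<not> constant (poly Q)" using Suc.hyps(2) by (simp add: constant_degree)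
  then obtain c where "poly Q c = 0" using fundamental_theorem_of_algebra by blast
  then obtain R where R: "Q = [:- c, 1:] * R" using poly_eq_0_iff_dvd by (metis dvd_def)
  then have R0: "R \<noteq> 0" using Suc.prems by auto
  have "degree Q = Suc (degree R)" unfolding R using R0 by (subst degree_mult_eq) auto
  then have dR: "n = degree R" using Suc.hyps(2) by simp
  obtain K where K: "K \<noteq> 0" "degree K = 2 * degree R" "\<And>f. R dvd S (K * f)" "\<And>f. R dvd D (K * f)"
    using Suc.hyps(1)[OF dR R0] by blast
  have K10: "K1 c \<noteq> 0" and dK1: "degree (K1 c) = 2" by (simp_all add: K1_def)
  have "Q dvd S (K1 c * K * f) \<and> Q dvd D (K1 c * K * f)" for f
    unfolding mult.assoc S_K1_mult D_K1_mult R
    by (intro conjI mult_dvd_mono dvd_add dvd_smult dvd_mult K dvd_refl)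
  moreover have "degree (K1 c * K) = 2 * degree Q"
    using K10 K(1,2) dK1 dR Suc.hyps(2) by (simp add: degree_mult_eq)
  ultimately show ?case
    using K10 K(1) by (intro exI[of _ "K1 c * K"]) auto
qed

end

locale poly_functional =
  fixes v :: "complex poly \<Rightarrow> complex"
  assumes v_add: "v (f + g) = v f + v g" and v_smult: "v (smult c f) = c * v f"
begin

lemma v_0 [simp]: "v 0 = 0" using v_smult[of 0 0] by simp
lemma v_minus: "v (- f) = - v f" using v_smult[of "-1" f] by simp
lemma v_diff: "v (f - g) = v f - v g" using v_add[of f "- g"] by (simp add: v_minus)
lemma v_const: "v [:c:] = c * v 1" using v_smult[of c 1] by (simp add: one_pCons)

end

text \<open>Used for \<open>v\<close> and later for \<open>L\<close> itself. Torsion-freeness stands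
  in for regularity, because it is the property that passes from \<open>L\<close> to
  \<open>v\<close>.\<close>

locale pearson = askey_wilson_base q + poly_functional v
  for q :: real and v :: "complex poly \<Rightarrow> complex" +
  fixes \<phi> \<psi> :: "complex poly"
  assumes v_1: "v 1 \<noteq> 0"
    and torsion_free: "(\<And>g. v (Q * g) = 0) \<Longrightarrow> Q = 0"
    and degree_phi: "degree \<phi> \<le> 2" and degree_psi: "degree \<psi> \<le> 1" and psi_1: "coeff \<psi> 1 \<noteq> 0"
    and pearson: "v (\<phi> * D f + \<psi> * S f) = 0"
begin

text \<open>Putting p * f into the Pearson equation and sorting by the product rules leaves
  \<open>Fp p\<close> in front of D f and \<open>Gp p\<close> in front of S f, so each p yields a
  solution pair.\<close>

definition Fp :: "complex poly \<Rightarrow> complex poly" where "Fp p = \<phi> * S p + \<psi> * U2 * D p"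
definition Gp :: "complex poly \<Rightarrow> complex poly" where "Gp p = \<phi> * D p + \<psi> * S p"
text \<open>\<open>d n\<close> and \<open>e n\<close> are the factors by which \<open>Gp\<close> and
  \<open>Fp\<close> multiply the leading coefficient of a polynomial of degree n.\<close>

definition d :: "nat \<Rightarrow> complex" where "d n = coeff \<phi> 2 * G n + coeff \<psi> 1 * A n"
definition e :: "nat \<Rightarrow> complex" where "e n = coeff \<phi> 2 * A n + coeff \<psi> 1 * (\<alpha>\<^sup>2 - 1) * G n"

lemma v_Fp_Gp: "v (Fp p * D f + Gp p * S f) = 0"
proof -
  have "Fp p * D f + Gp p * S f = \<phi> * D (p * f) + \<psi> * S (p * f)"
    unfolding Fp_def Gp_def D_mult S_mult by (simp add: algebra_simps)
  then show ?thesis using pearson by simp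
qed

lemma v_Gp [simp]: "v (Gp p) = 0"
  using v_Fp_Gp[of p 1] by simp

lemma Gp_add: "Gp (p + r) = Gp p + Gp r" and Gp_diff: "Gp (p - r) = Gp p - Gp r"
  and Fp_0 [simp]: "Fp 0 = 0" and Gp_0 [simp]: "Gp 0 = 0"
  by (simp_all add: Fp_def Gp_def S_add D_add S_diff D_diff algebra_simps)

lemma Gp_top:
  assumes "degree p \<le> n"
  shows "degree (Gp p) \<le> Suc n" "coeff (Gp p) (Suc n) = d n * coeff p n"
proof -
  have 1: "degree (\<psi> * S p) \<le> Suc n"
    using degree_mult_le'[OF degree_psi, of "S p" n] assms by simp
  have 2: "coeff (\<psi> * S p) (Suc n) = coeff \<psi> 1 * (A n * coeff p n)"
    using coeff_mult_top[OF degree_psi, of "S p" n] assms by (simp add: coeff_S_top)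
  have 3: "degree (\<phi> * D p) \<le> Suc n \<and> coeff (\<phi> * D p) (Suc n) = coeff \<phi> 2 * (G n * coeff p n)"
  proof (cases n)
    case 0
    then have "D p = 0" using assms by (simp add: D_eq_0_iff)
    then show ?thesis using 0 by simp
  next
    case (Suc m)
    have dD: "degree (D p) \<le> m" using degree_D_le[of p] assms Suc by linarith
    show ?thesis
      using degree_mult_le'[OF degree_phi dD] coeff_mult_top[OF degree_phi dD] coeff_D_top[of p m] assms Suc
      by (simp add: numeral_2_eq_2)
  qed
  show "degree (Gp p) \<le> Suc n" unfolding Gp_def using 1 3 by (intro degree_add_le) auto
  show "coeff (Gp p) (Suc n) = d n * coeff p n"
    unfolding Gp_def using 2 3 by (simp add: d_def algebra_simps)
qed

lemma Fp_top:
  assumes "degree p \<le> n"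
  shows "degree (Fp p) \<le> n + 2" "coeff (Fp p) (n + 2) = e n * coeff p n"
proof -
  have dS: "degree (S p) \<le> n" using assms by simp
  have 1: "degree (\<phi> * S p) \<le> n + 2"
    using degree_mult_le'[OF degree_phi dS] by simp
  have 2: "coeff (\<phi> * S p) (n + 2) = coeff \<phi> 2 * (A n * coeff p n)"
    using coeff_mult_top[OF degree_phi dS] assms by (simp add: coeff_S_top add.commute)
  have dpU: "degree (\<psi> * U2) \<le> 3"
    using degree_mult_le'[OF degree_psi degree_U2] by simp
  have cpU: "coeff (\<psi> * U2) 3 = coeff \<psi> 1 * (\<alpha>\<^sup>2 - 1)"
    using coeff_mult_top[OF degree_psi degree_U2] coeff_U2 by (simp add: eval_nat_numeral)
  have 3: "degree (\<psi> * U2 * D p) \<le> n + 2 \<and> coeff (\<psi> * U2 * D p) (n + 2) = coeff \<psi> 1 * (\<alpha>\<^sup>2 - 1) * (G n * coeff p n)"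
  proof (cases n)
    case 0
    then have "D p = 0" using assms by (simp add: D_eq_0_iff)
    then show ?thesis using 0 by simp
  next
    case (Suc m)
    have dD: "degree (D p) \<le> m" using degree_D_le[of p] assms Suc by linarith
    have "n + 2 = 3 + m" using Suc by simp
    then show ?thesis
      using degree_mult_le'[OF dpU dD] coeff_mult_top[OF dpU dD] coeff_D_top[of p m] assms Suc cpU
      by (simp only:) 
  qed
  show "degree (Fp p) \<le> n + 2" unfolding Fp_def using 1 3 by (intro degree_add_le) auto
  show "coeff (Fp p) (n + 2) = e n * coeff p n"
    unfolding Fp_def using 2 3 by (simp add: e_def algebra_simps)
qed

text \<open>A triangular system with diagonal \<open>d j\<close>. Only the j < m enter, which is
  what allows its use at the least zero of \<open>d\<close> in the proof that there is none.\<close>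

lemma Gp_solve_below:
  assumes "\<And>j. j < m \<Longrightarrow> d j \<noteq> 0" "degree P \<le> m"
  shows "\<exists>p c. P = Gp p + [:c:] \<and> (\<forall>i\<ge>m. coeff p i = 0)"
  using assms
proof (induction m arbitrary: P)
  case 0
  then obtain c where "P = [:c:]" by (metis degree_eq_zeroE le_zero_eq)
  then show ?case by (intro exI[of _ 0] exI[of _ c]) simp
next
  case (Suc m)
  define p0 where "p0 = monom (coeff P (Suc m) / d m) m"
  have dp0: "degree p0 \<le> m" by (simp add: p0_def degree_monom_le)
  have "coeff (Gp p0) (Suc m) = coeff P (Suc m)"
    using Gp_top(2)[OF dp0] Suc.prems(1)[of m] by (simp add: p0_def)
  moreover have "degree (P - Gp p0) \<le> Suc m"
    using Gp_top(1)[OF dp0] Suc.prems(2) by (intro degree_diff_le) auto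
  ultimately have "degree (P - Gp p0) \<le> m"
    by (metis coeff_diff degree_0 diff_self le_Suc_eq leading_coeff_0_iff zero_le)
  then obtain p c where p: "P - Gp p0 = Gp p + [:c:]" "\<forall>i\<ge>m. coeff p i = 0"
    using Suc.IH Suc.prems(1) by (metis less_Suc_eq)
  then have "P = Gp (p0 + p) + [:c:]" by (simp add: Gp_add algebra_simps)
  moreover have "\<forall>i\<ge>Suc m. coeff (p0 + p) i = 0"
    using p(2) by (simp add: p0_def)
  ultimately show ?case by blast
qed

text \<open>At a least zero m of \<open>d\<close>, the monomial z^m corrected in lower degrees gives
  r with \<open>Gp r\<close> constant, and this constant is 0 because v 1 is not. Then
  \<open>v\<close> kills \<open>Fp r\<close> times everything in the range of D, that is, times all
  polynomials, so \<open>Fp r\<close> = 0 and \<open>e m\<close> = 0 too. But \<open>A_G_det\<close>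
  equates \<open>e m\<close> \<open>G m\<close> - \<open>d m\<close> \<open>A m\<close> with minus
  the leading coefficient of \<psi>.\<close>

lemma d_nz: "d n \<noteq> 0"
proof (rule ccontr)
  assume "\<not> d n \<noteq> 0"
  define m where "m = (LEAST m. d m = 0)"
  have m: "d m = 0"
    using LeastI[of "\<lambda>m. d m = 0" n] \<open>\<not> d n \<noteq> 0\<close> by (simp add: m_def)
  have m': "d j \<noteq> 0" if "j < m" for j
    using that not_less_Least[of j "\<lambda>m. d m = 0"] by (simp add: m_def)
  have dm: "degree (monom 1 m :: complex poly) \<le> m" by (simp add: degree_monom_le)
  have "coeff (Gp (monom 1 m)) (Suc m) = 0" using Gp_top(2)[OF dm] m by simp
  then have "degree (Gp (monom 1 m)) \<le> m"
    using Gp_top(1)[OF dm] by (metis degree_0 le_Suc_eq leading_coeff_0_iff zero_le)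
  then obtain p c where p: "Gp (monom 1 m) = Gp p + [:c:]" "\<forall>i\<ge>m. coeff p i = 0"
    using Gp_solve_below[OF m'] by blast
  define r where "r = monom 1 m - p"
  have Gr: "Gp r = [:c:]" using p(1) by (simp add: r_def Gp_diff)
  then have "c = 0" using v_Gp[of r] v_1 by (simp add: v_const)
  then have "v (Fp r * D f) = 0" for f using v_Fp_Gp[of r f] Gr by simp
  then have "v (Fp r * g) = 0" for g using D_surj_degree by metis
  then have F0: "Fp r = 0" by (rule torsion_free)
  have "degree p \<le> m" using p(2) by (metis degree_le less_imp_le)
  then have "degree r \<le> m" unfolding r_def using dm by (intro degree_diff_le)
  moreover have "coeff r m = 1" using p(2) by (simp add: r_def)
  ultimately have "e m = 0" using Fp_top(2)[of r m] F0 by simp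
  then have "e m * G m - d m * A m = 0" using m by simp
  then have "coeff \<psi> 1 * (A m ^ 2 - (\<alpha>\<^sup>2 - 1) * G m ^ 2) = 0"
    unfolding d_def e_def by algebra
  then show False using A_G_det psi_1 by simp
qed

lemma Gp_solve: "\<exists>p c. P = Gp p + [:c:] \<and> (\<forall>i\<ge>degree P. coeff p i = 0)"
  by (rule Gp_solve_below[OF d_nz]) simp_all

text \<open>Solving \<open>Gp p\<close> = H determines p; subtracting its pair leaves only F -
  \<open>Fp p\<close> against D f, and D is onto.\<close>

lemma principal:
  assumes "\<And>f. v (F * D f + H * S f) = 0"
  shows "\<exists>p. F = Fp p \<and> H = Gp p \<and> (\<forall>i\<ge>degree H. coeff p i = 0)"
proof -
  obtain p c where p: "H = Gp p + [:c:]" "\<forall>i\<ge>degree H. coeff p i = 0"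
    using Gp_solve by blast
  have "v H = 0" using assms[of 1] by simp
  then have c: "c = 0" using p(1) v_1 by (simp add: v_add v_const)
  have "v ((F - Fp p) * D f) = 0" for f
  proof -
    have "(F - Fp p) * D f = (F * D f + H * S f) - (Fp p * D f + Gp p * S f)"
      using p(1) c by (simp add: algebra_simps)
    then show ?thesis using assms v_Fp_Gp by (simp only: v_diff diff_self)
  qed
  then have "v ((F - Fp p) * g) = 0" for g using D_surj_degree by metis
  then have "F - Fp p = 0" by (rule torsion_free)
  then show ?thesis using p c by auto
qed

text \<open>With K adapted to Q, the Pearson equation at multiples of K reads v (Q h) = 0, and such
  h exist in every degree above \<open>degree Q\<close>. Modulo these h every g has degree at most
  \<open>degree Q\<close>.\<close>

lemma vanish_multiples:
  assumes "\<And>g. degree g \<le> degree Q \<Longrightarrow> v (Q * g) = 0"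
  shows "v (Q * g) = 0"
proof (cases "Q = 0")
  case False
  then obtain K where K: "K \<noteq> 0" "degree K = 2 * degree Q" "\<And>f. Q dvd S (K * f)" "\<And>f. Q dvd D (K * f)"
    using exists_K by blast
  have "v (Q * g) = 0" if "degree g \<le> n" for n g
    using that
  proof (induction n arbitrary: g)
    case 0
    then show ?case using assms by simp
  next
    case (Suc n)
    show ?case
    proof (cases "Suc n \<le> degree Q")
      case True
      then show ?thesis using assms Suc.prems by simp
    next
      case False
      \<comment> \<open>\<open>Gp\<close> raises degrees by exactly one, so \<open>Gp f\<close> has
        degree 2 \<open>degree Q\<close> + (n - \<open>degree Q\<close>) + 1; dividing by Q leaves
        degree n + 1 for h.\<close>
      define f where "f = K * monom 1 (n - degree Q)"
      have f: "degree f = n + degree Q" "f \<noteq> 0"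
        using K(1,2) False by (simp_all add: f_def degree_mult_eq degree_monom_eq)
      have "Q dvd Gp f"
        unfolding Gp_def f_def by (intro dvd_add dvd_mult K)
      then obtain h where h: "Gp f = Q * h" by (metis dvd_def)
      have "coeff (Gp f) (Suc (degree f)) \<noteq> 0"
        using Gp_top(2)[of f "degree f"] d_nz f(2) by simp
      then have "degree (Gp f) = Suc (degree f)"
        using Gp_top(1)[of f "degree f"] le_degree le_antisym by blast
      moreover have "h \<noteq> 0" using h \<open>coeff (Gp f) (Suc (degree f)) \<noteq> 0\<close> by auto
      ultimately have dh: "degree h = Suc n"
        using h f(1) \<open>Q \<noteq> 0\<close> by (simp add: degree_mult_eq)
      have vh: "v (Q * h) = 0" using v_Gp[of f] h by simp
      define c where "c = coeff g (Suc n) / coeff h (Suc n)"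
      have "coeff h (Suc n) \<noteq> 0" using dh \<open>h \<noteq> 0\<close> by (metis leading_coeff_0_iff)
      then have "coeff (g - smult c h) (Suc n) = 0" by (simp add: c_def)
      moreover have "degree (g - smult c h) \<le> Suc n"
        using Suc.prems dh by (intro degree_diff_le) (auto intro: order.trans[OF degree_smult_le])
      ultimately have "degree (g - smult c h) \<le> n"
        by (metis degree_0 le_Suc_eq leading_coeff_0_iff zero_le)
      then have "v (Q * (g - smult c h)) = 0" by (rule Suc.IH)
      then show ?thesis using vh by (simp add: right_diff_distrib v_diff v_smult)
    qed
  qed
  then show ?thesis by blast
qed simp

end

section \<open>The structure relation\<close>

locale aw_ops = askey_wilson_base q + poly_functional L
  for q :: real and L :: "complex poly \<Rightarrow> complex" +
  fixes P :: "nat \<Rightarrow> complex poly" and B C \<kappa> :: "nat \<Rightarrow> complex"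
  assumes degree_P [simp]: "degree (P n) = n" and lead_P [simp]: "coeff (P n) n = 1"
    and orth: "L (P n * P m) = (if n = m then \<kappa> n else 0)" and kappa_nz: "\<kappa> n \<noteq> 0"
    and P_0 [simp]: "P 0 = 1"
    and P_Suc: "P (Suc n) = [:- B n, 1:] * P n - smult (C n) (prev P n)"
    and C_nz: "C (Suc n) \<noteq> 0"
begin

lemma P_Suc_Suc: "P (Suc (Suc n)) = [:- B (Suc n), 1:] * P (Suc n) - smult (C (Suc n)) (P n)"
  using P_Suc[of "Suc n"] by (simp add: prev_def)

lemma P_1: "P (Suc 0) = [:- B 0, 1:]"
  using P_Suc[of 0] by (simp add: prev_def)

lemma P_2: "P 2 = [:B 0 * B 1 - C 1, - (B 0 + B 1), 1:]"
  using P_Suc_Suc[of 0] by (simp add: P_1 numeral_2_eq_2 algebra_simps)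

lemma P_expand:
  assumes "degree g \<le> n"
  shows "\<exists>r. g = smult (coeff g n) (P n) + r \<and> (n = 0 \<and> r = 0 \<or> n > 0 \<and> degree r \<le> n - 1)"
proof -
  define r where "r = g - smult (coeff g n) (P n)"
  have "degree r \<le> n" unfolding r_def
    using assms by (intro degree_diff_le) (auto intro: order.trans[OF degree_smult_le])
  moreover have "coeff r n = 0" by (simp add: r_def)
  ultimately have "n = 0 \<and> r = 0 \<or> n > 0 \<and> degree r \<le> n - 1"
    using leading_coeff_0_iff[of r] by (cases "degree r = n") auto
  then show ?thesis by (intro exI[of _ r]) (simp add: r_def)
qed

lemma linear_eq_0_on_P:
  assumes add: "\<And>f g. T (f + g) = T f + (T g :: complex)" and smult: "\<And>c f. T (smult c f) = c * T f"
    and P: "\<And>n. T (P n) = 0"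
  shows "T f = 0"
proof -
  have "T f = 0" if "degree f \<le> n" for n f
    using that
  proof (induction n arbitrary: f)
    case 0
    then show ?case using P_expand[of f 0] by (metis add.right_neutral smult P mult_zero_right less_irrefl)
  next
    case (Suc n)
    then obtain r where "f = smult (coeff f (Suc n)) (P (Suc n)) + r" "degree r \<le> n"
      using P_expand[of f "Suc n"] by auto
    then show ?case using Suc.IH[of r] by (metis add smult P add.right_neutral mult_zero_right)
  qed
  then show ?thesis by blast
qed

lemma L_P_below: "degree g < m \<Longrightarrow> L (g * P m) = 0"
proof -
  assume "degree g < m"
  moreover have "L (g * P m) = 0" if "degree g \<le> n" "n < m" for n g
    using that
  proof (induction n arbitrary: g)
    case 0
    then obtain r where "g = smult (coeff g 0) (P 0) + r" "r = 0"
      using P_expand[of g 0] by auto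
    then have "g * P m = smult (coeff g 0) (P 0 * P m)" by (metis add.right_neutral mult_smult_left)
    then have "L (g * P m) = coeff g 0 * L (P 0 * P m)" by (simp only: v_smult)
    moreover have "L (P 0 * P m) = 0" using 0 orth[of 0 m] by simp
    ultimately show ?case by simp
  next
    case (Suc n)
    then obtain r where r: "g = smult (coeff g (Suc n)) (P (Suc n)) + r" "degree r \<le> n"
      using P_expand[of g "Suc n"] by auto
    then have "g * P m = smult (coeff g (Suc n)) (P (Suc n) * P m) + r * P m"
      by (metis distrib_right mult_smult_left)
    then show ?case using Suc r(2) orth[of "Suc n" m] by (simp add: v_add v_smult)
  qed
  ultimately show ?thesis by blast
qed

lemma L_P_top: "degree g \<le> m \<Longrightarrow> L (g * P m) = coeff g m * \<kappa> m"
proof -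
  assume "degree g \<le> m"
  then obtain r where r: "g = smult (coeff g m) (P m) + r" "m = 0 \<and> r = 0 \<or> m > 0 \<and> degree r \<le> m - 1"
    using P_expand by blast
  then have "r = 0 \<or> degree r < m" by auto
  then have "L (r * P m) = 0" using L_P_below by auto
  moreover have "g * P m = smult (coeff g m) (P m * P m) + r * P m"
    using r(1) by (metis distrib_right mult_smult_left)
  ultimately have "L (g * P m) = coeff g m * L (P m * P m) + L (r * P m)" by (metis v_add v_smult)
  then show ?thesis using \<open>L (r * P m) = 0\<close> by (simp add: orth)
qed

lemma L_torsion_free:
  assumes "\<And>g. L (Q * g) = 0"
  shows "Q = 0"
proof -
  have "coeff Q (degree Q) * \<kappa> (degree Q) = 0"
    using L_P_top[of Q "degree Q"] assms by simp
  then show ?thesis using kappa_nz by simp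
qed

text \<open>P_n is orthogonal to P_(n+2); expanding the latter by the recurrence compares the two
  norms.\<close>

lemma kappa_Suc: "\<kappa> (Suc n) = C (Suc n) * \<kappa> n"
proof -
  have "P n * P (Suc (Suc n)) = ([:- B (Suc n), 1:] * P n) * P (Suc n) - smult (C (Suc n)) (P n * P n)"
    by (simp add: P_Suc_Suc algebra_simps)
  then have "L (P n * P (Suc (Suc n))) = L (([:- B (Suc n), 1:] * P n) * P (Suc n)) - C (Suc n) * L (P n * P n)"
    by (metis v_diff v_smult)
  then have *: "L (([:- B (Suc n), 1:] * P n) * P (Suc n)) - C (Suc n) * \<kappa> n = 0"
    unfolding orth by simp
  moreover have "degree ([:- B (Suc n), 1:] * P n) \<le> Suc n"
    using degree_mult_le'[of "[:- B (Suc n), 1:]" 1 "P n" n] by simp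
  moreover have "coeff ([:- B (Suc n), 1:] * P n) (Suc n) = 1"
    using coeff_mult_top[of "[:- B (Suc n), 1:]" 1 "P n" n] by simp
  ultimately have "L (([:- B (Suc n), 1:] * P n) * P (Suc n)) = 1 * \<kappa> (Suc n)"
    using L_P_top by metis
  with * show ?thesis by (simp only:) simp
qed

lemma L_P: "L (P (Suc n)) = 0"
  using orth[of 0 "Suc n"] by simp

lemma L_1: "L 1 = \<kappa> 0"
  using orth[of 0 0] by simp

definition v :: "complex poly \<Rightarrow> complex" where "v g = L (S_inv g)"

lemma v_S: "v (S f) = L f"
  by (simp add: v_def)

lemma poly_functional_v: "poly_functional v"
  by standard (simp_all add: v_def S_inv_add S_inv_smult v_add v_smult)

text \<open>If \<open>v\<close> kills all multiples of Q, then L (K f) = v (S (K f)) = 0 for the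
  multiplier K of Q, so \<open>L\<close> would kill all multiples of K.\<close>

lemma v_torsion_free:
  assumes "\<And>g. v (Q * g) = 0"
  shows "Q = 0"
proof (rule ccontr)
  assume "Q \<noteq> 0"
  then obtain K where K: "K \<noteq> 0" "\<And>f. Q dvd S (K * f)" using exists_K by blast
  have "L (K * f) = 0" for f
  proof -
    obtain g where "S (K * f) = Q * g" using K(2) by (metis dvd_def)
    then show ?thesis using assms by (simp flip: v_S)
  qed
  then show False using L_torsion_free K(1) by blast
qed

end

section \<open>The transposed structure relation and the Pearson equation of
  \<open>v\<close>\<close>

locale aw_structure = aw_ops q L P B C \<kappa>
  for q :: real and L :: "complex poly \<Rightarrow> complex" and P :: "nat \<Rightarrow> complex poly"
    and B C \<kappa> :: "nat \<Rightarrow> complex" +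
  fixes a b c :: complex and as bs cs :: "nat \<Rightarrow> complex"
  assumes structure_rel: "[:c, b, a:] * D (P n) =
      smult (as n) (S (P (Suc n))) + smult (bs n) (S (P n)) + smult (cs n) (S (prev P n))"
    and cs_nz: "cs n \<noteq> 0"
begin

definition \<pi> :: "complex poly" where "\<pi> = [:c, b, a:]"
definition W :: "complex poly \<Rightarrow> complex poly" where "W f = S_inv (\<pi> * D f)"
definition kap :: complex where "kap = cs 1 / C 1"
definition X1 :: "complex poly" where "X1 = [:- B 0, \<alpha>:]"

lemma S_P_1: "S (P (Suc 0)) = X1"
  by (simp add: P_1 S_pCons D_pCons X1_def)

lemma kap_nz: "kap \<noteq> 0"
  using cs_nz[of 1] C_nz[of 0] by (simp add: kap_def)

lemma W_add: "W (f + g) = W f + W g" and W_smult: "W (smult x f) = smult x (W f)"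
  by (simp_all add: W_def D_add D_smult S_inv_add S_inv_smult distrib_left)

lemma as_bs_0: "as 0 = 0" "bs 0 = 0"
proof -
  have "0 = smult (as 0) X1 + [:bs 0:]"
    using structure_rel[of 0] by (simp add: prev_def S_P_1 one_pCons)
  then have "pCons (bs 0 - as 0 * B 0) [:as 0 * \<alpha>:] = 0"
    by (simp add: X1_def)
  then show "as 0 = 0" "bs 0 = 0" by auto
qed

lemma W_P: "W (P n) = smult (as n) (P (Suc n)) + smult (bs n) (P n) + smult (cs n) (prev P n)"
proof -
  have "\<pi> * D (P n) = S (smult (as n) (P (Suc n)) + smult (bs n) (P n) + smult (cs n) (prev P n))"
    using structure_rel[of n] by (simp add: \<pi>_def S_add S_smult)
  then show ?thesis by (simp add: W_def)
qed

text \<open>The transpose of \<^const>\<open>W\<close> with respect to the bilinear form of the functional.\<close>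

definition \<omega> :: "nat \<Rightarrow> complex poly" where
  "\<omega> k = smult (as (k - 1) * C k) (prev P k) + smult (bs k) (P k) + smult (cs (Suc k) / C (Suc k)) (P (Suc k))"

text \<open>It suffices to test f = P_n, where the tridiagonal matrix of \<open>W\<close> is
  compared with its transpose; \<open>kappa_Suc\<close> turns ratios of norms into the factors
  C.\<close>

lemma L_W: "L (P k * W f) = L (\<omega> k * f)"
proof -
  have "L (P k * W f) - L (\<omega> k * f) = 0"
  proof (rule linear_eq_0_on_P[where T = "\<lambda>f. L (P k * W f) - L (\<omega> k * f)"])
    show "L (P k * W (f + g)) - L (\<omega> k * (f + g)) =
        L (P k * W f) - L (\<omega> k * f) + (L (P k * W g) - L (\<omega> k * g))" for f g
      by (simp add: W_add distrib_left v_add)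
    show "L (P k * W (smult x f)) - L (\<omega> k * smult x f) = x * (L (P k * W f) - L (\<omega> k * f))" for x f
      by (simp add: W_smult v_smult right_diff_distrib)
    fix n
    have 1: "L (P k * W (P n)) = as n * L (P k * P (Suc n)) + bs n * L (P k * P n) + cs n * L (P k * prev P n)"
      by (simp add: W_P distrib_left v_add v_smult)
    have 2: "L (\<omega> k * P n) = as (k - 1) * C k * L (prev P k * P n) + bs k * L (P k * P n)
        + cs (Suc k) / C (Suc k) * L (P (Suc k) * P n)"
      by (simp add: \<omega>_def distrib_right v_add v_smult)
    show "L (P k * W (P n)) - L (\<omega> k * P n) = 0"
    proof (cases k)
      case 0
      then show ?thesis unfolding 1 2
        by (cases n) (auto simp: prev_def orth as_bs_0 kappa_Suc C_nz simp del: P_0 split: nat.splits)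
    next
      case (Suc m)
      then show ?thesis unfolding 1 2
        by (cases n) (auto simp: prev_def orth as_bs_0 kappa_Suc C_nz simp del: P_0 split: nat.splits)
    qed
  qed
  then show ?thesis by simp
qed

lemma L_S_mult: "L (f * g) = v (S f * S g + U2 * D f * D g)"
  by (simp flip: v_S add: S_mult)

text \<open>The product rule writes \<open>kap\<close> L (P_1 f) = \<open>kap\<close> v (S (P_1 f))
  with coefficients \<open>kap\<close> \<open>U2\<close> and \<open>kap\<close> \<open>X1\<close>
  before D f and S f, while \<open>v_pi\<close> makes it v (\<pi> D f). The difference is this
  pair.\<close>

definition phi0 :: "complex poly" where "phi0 = smult kap U2 - \<pi>"
definition psi0 :: "complex poly" where "psi0 = smult kap X1"

lemma omega_0: "\<omega> 0 = smult kap (P 1)"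
  by (simp add: \<omega>_def prev_def as_bs_0 kap_def)

lemma v_pi: "v (\<pi> * D f) = kap * L (P 1 * f)"
proof -
  have "v (\<pi> * D f) = L (P 0 * W f)" by (simp add: v_def W_def)
  also have "\<dots> = L (\<omega> 0 * f)" by (rule L_W)
  finally show ?thesis by (simp add: omega_0 v_smult)
qed

sublocale v: poly_functional v
  by (rule poly_functional_v)

sublocale v: pearson q v phi0 psi0
proof (unfold_locales)
  show "v 1 \<noteq> 0" using v_S[of 1] L_1 kappa_nz by simp
  show "(\<And>g. v (Q * g) = 0) \<Longrightarrow> Q = 0" for Q by (rule v_torsion_free)
  show "degree phi0 \<le> 2" unfolding phi0_def \<pi>_def using degree_U2
    by (intro degree_diff_le) (auto intro: order.trans[OF degree_smult_le])
  show "degree psi0 \<le> 1" by (simp add: psi0_def X1_def)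
  show "coeff psi0 1 \<noteq> 0" using kap_nz by (simp add: psi0_def X1_def)
  have S_P1: "S (P 1) = X1" and D_P1: "D (P 1) = 1"
    using S_P_1 by (simp_all add: P_1 D_pCons one_pCons)
  fix f
  have "phi0 * D f + psi0 * S f = smult kap (S (P 1) * S f + U2 * D (P 1) * D f) - \<pi> * D f"
    unfolding S_P1 D_P1 phi0_def psi0_def by (simp add: algebra_simps smult_add_right)
  then show "v (phi0 * D f + psi0 * S f) = 0"
    by (simp only: v.v_diff v.v_smult L_S_mult[symmetric] v_pi) simp
qed

lemma v_d: "v.d n = kap * A (Suc n) - a * G n"
  and v_e: "v.e n = (kap * (\<alpha>\<^sup>2 - 1) - a) * A n + kap * \<alpha> * (\<alpha>\<^sup>2 - 1) * G n"
  unfolding v.d_def v.e_def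
  by (simp_all add: phi0_def psi0_def \<pi>_def X1_def U2_def A_Suc numeral_2_eq_2 algebra_simps)

text \<open>S Q differs from some \<open>Gp p\<close> by a constant, which vanishes because v (S Q)
  = L Q = 0. In L (Q f) = v (S Q S f + U2 D Q D f) the Pearson pair of p then trades the S f part
  for a D f part.\<close>

lemma L_as_D:
  assumes "L Q = 0"
  shows "\<exists>p. S Q = v.Gp p \<and> (\<forall>i\<ge>degree Q. coeff p i = 0) \<and> (\<forall>f. L (Q * f) = - v ((v.Fp p - U2 * D Q) * D f))"
proof -
  obtain p x where p: "S Q = v.Gp p + [:x:]" "\<forall>i\<ge>degree (S Q). coeff p i = 0"
    using v.Gp_solve by blast
  have "v (S Q) = x * v 1" using p(1) by (simp add: v.v_add v.v_const)
  then have "x = 0" using assms v.v_1 by (simp add: v_S)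
  have "L (Q * f) = - v ((v.Fp p - U2 * D Q) * D f)" for f
  proof -
    have "S Q * S f + U2 * D Q * D f = v.Fp p * D f + v.Gp p * S f - (v.Fp p - U2 * D Q) * D f"
      using p(1) \<open>x = 0\<close> by (simp add: algebra_simps)
    then show ?thesis by (simp only: L_S_mult v.v_diff v.v_Fp_Gp) simp
  qed
  moreover have "\<forall>i\<ge>degree Q. coeff p i = 0" using p(2) by (simp only: degree_S)
  moreover have "S Q = v.Gp p" using p(1) \<open>x = 0\<close> by simp
  ultimately show ?thesis by blast
qed

text \<open>\<^term>\<open>\<omega> k\<close> times the functional is the image of a polynomial multiple of \<^const>\<open>v\<close> under the
  transposed divided difference; cancelling that operator yields an identity for \<^const>\<open>v\<close> alone.\<close>

lemma exists_F_omega: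
  obtains p F where "S (\<omega> (Suc k)) = v.Gp p" "\<forall>i\<ge>k + 2. coeff p i = 0"
    "F = v.Fp p - U2 * D (\<omega> (Suc k))"
    "\<And>f y. S f = \<pi> * y \<Longrightarrow> L (P (Suc k) * f) = - v (F * y)"
proof -
  \<comment> \<open>There is no P_0 component: for k = 0 it is removed by \<open>as 0\<close> = 0,
    and for larger k the lowest index is k.\<close>
  have "L (\<omega> (Suc k)) = 0"
  proof (cases k)
    case 0
    then show ?thesis by (simp add: \<omega>_def prev_def as_bs_0 v_add v_smult L_P)
  next
    case (Suc j)
    then show ?thesis by (simp add: \<omega>_def prev_def v_add v_smult L_P)
  qed
  then obtain p where p: "S (\<omega> (Suc k)) = v.Gp p" "\<forall>i\<ge>degree (\<omega> (Suc k)). coeff p i = 0"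
    "\<And>f. L (\<omega> (Suc k) * f) = - v ((v.Fp p - U2 * D (\<omega> (Suc k))) * D f)"
    using L_as_D by blast
  have "degree (\<omega> (Suc k)) \<le> k + 2"
    unfolding \<omega>_def prev_def by (intro degree_add_le order.trans[OF degree_smult_le]) auto
  then have p2: "\<forall>i\<ge>k + 2. coeff p i = 0" using p(2) by auto
  have "L (P (Suc k) * f) = - v ((v.Fp p - U2 * D (\<omega> (Suc k))) * y)" if "S f = \<pi> * y" for f y
  proof -
    obtain g where g: "D g = y" using D_surj_degree by blast
    then have "W g = f" using that by (metis W_def S_inv_S)
    then show ?thesis using L_W[of "Suc k" g] p(3) g by simp
  qed
  then show ?thesis using that p(1) p2 by blast
qed

lemma omega_top: "degree (\<omega> k) \<le> Suc k" "coeff (\<omega> k) (Suc k) = cs (Suc k) / C (Suc k)"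
proof -
  have "degree (prev P k) \<le> k" by (cases k) (auto simp: prev_def)
  then show "degree (\<omega> k) \<le> Suc k"
    unfolding \<omega>_def by (intro degree_add_le order.trans[OF degree_smult_le]) auto
  have "coeff (prev P k) (Suc k) = 0" using \<open>degree (prev P k) \<le> k\<close> by (simp add: coeff_eq_0)
  then show "coeff (\<omega> k) (Suc k) = cs (Suc k) / C (Suc k)"
    by (simp add: \<omega>_def coeff_eq_0)
qed

end

lemma degree_le_1E:
  assumes "degree p \<le> Suc 0"
  obtains x y where "p = [:x, y:]"
proof -
  obtain x r where r: "p = pCons x r" by (cases p)
  then have "degree r = 0" using assms by (simp add: degree_pCons_eq_if split: if_splits)
  then show ?thesis using that r by (metis degree_eq_zeroE)
qed

context askey_wilson_base
begin

lemma A_2: "A 2 = 2 * \<alpha>\<^sup>2 - 1" and G_2: "G 2 = 2 * \<alpha>"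
  by (simp_all add: numeral_2_eq_2 A_Suc G_Suc power2_eq_square)

lemma A_3: "A 3 = \<alpha> * (4 * \<alpha>\<^sup>2 - 3)" and G_3: "G 3 = 4 * \<alpha>\<^sup>2 - 1"
  by (simp_all add: numeral_3_eq_3 A_Suc G_Suc power2_eq_square algebra_simps)

text \<open>The subtraction formulas of cosh and sinh. Below they evaluate the determinants left
  after an unknown leading coefficient is eliminated.\<close>

lemma A_minus: "A (m + n) * A n - (\<alpha>\<^sup>2 - 1) * G (m + n) * G n = A m"
  and G_minus: "G (m + n) * A n - A (m + n) * G n = G m"
proof (induction n)
  case 0
  { case 1 show ?case by simp }
  { case 2 show ?case by simp }
next
  case (Suc n)
  have add1: "(\<alpha> * x + (\<alpha>\<^sup>2 - 1) * y) * (\<alpha> * x' + (\<alpha>\<^sup>2 - 1) * y')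
      - (\<alpha>\<^sup>2 - 1) * (\<alpha> * y + x) * (\<alpha> * y' + x') = x * x' - (\<alpha>\<^sup>2 - 1) * y * y'" for x x' y y'
    by algebra
  have add2: "(\<alpha> * y + x) * (\<alpha> * x' + (\<alpha>\<^sup>2 - 1) * y') - (\<alpha> * x + (\<alpha>\<^sup>2 - 1) * y) * (\<alpha> * y' + x')
      = y * x' - x * y'" for x x' y y'
    by algebra
  { case 1 show ?case using Suc(1) add1[of "A (m + n)" "G (m + n)" "A n" "G n"]
      by (simp only: add_Suc_right A_Suc G_Suc) }
  { case 2 show ?case using Suc(2) add2[of "G (m + n)" "A (m + n)" "A n" "G n"]
      by (simp only: add_Suc_right A_Suc G_Suc) }
qed

end

lemma Suc_2: "Suc 2 = 3"
  by simp

section \<open>Nonvanishing of a and the ratio c_3 / C_3\<close>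

context aw_structure
begin

text \<open>For such a multiplier K, both L (P_(k+1) K f) and its transposed form become
  \<open>v\<close> of a combination of D f and S f. By \<open>principal\<close> the difference is
  the pair of a single l, which gives two polynomial identities; comparing their leading terms
  eliminates l.\<close>

lemma omega_principal:
  assumes K: "\<And>f. S (K * f) = \<pi> * (s * S f + r * D f)"
  obtains p l F where "S (\<omega> (Suc k)) = v.Gp p" "degree p \<le> Suc k"
    "F = v.Fp p - U2 * D (\<omega> (Suc k))"
    "S (P (Suc k) * K) + F * s = v.Gp l" "U2 * D (P (Suc k) * K) + F * r = v.Fp l"
    "\<forall>i\<ge>degree (S (P (Suc k) * K) + F * s). coeff l i = 0"
proof -
  obtain p F where p: "S (\<omega> (Suc k)) = v.Gp p" "\<forall>i\<ge>k + 2. coeff p i = 0"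
    "F = v.Fp p - U2 * D (\<omega> (Suc k))"
    and F: "\<And>f y. S f = \<pi> * y \<Longrightarrow> L (P (Suc k) * f) = - v (F * y)"
    using exists_F_omega by blast
  have "v ((U2 * D (P (Suc k) * K) + F * r) * D f + (S (P (Suc k) * K) + F * s) * S f) = 0" for f
  proof -
    have "v (S (P (Suc k) * K) * S f + U2 * D (P (Suc k) * K) * D f) = - v (F * (s * S f + r * D f))"
      unfolding L_S_mult[symmetric] mult.assoc[of "P (Suc k)"] by (intro F K)
    then have "v (S (P (Suc k) * K) * S f + U2 * D (P (Suc k) * K) * D f + F * (s * S f + r * D f)) = 0"
      by (simp only: v.v_add) simp
    then show ?thesis by (simp add: algebra_simps)
  qed
  then obtain l where "U2 * D (P (Suc k) * K) + F * r = v.Fp l" "S (P (Suc k) * K) + F * s = v.Gp l"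
    "\<forall>i\<ge>degree (S (P (Suc k) * K) + F * s). coeff l i = 0"
    using v.principal by blast
  moreover have "degree p \<le> Suc k"
    using p(2) by (intro degree_le) auto
  ultimately show ?thesis using that p(1,3) by blast
qed

text \<open>If \<pi> vanished, \<open>W\<close> would kill P_1, and applying \<open>L\<close> to its
  expansion would leave \<open>cs 1\<close> \<kappa>_0 = 0.\<close>

lemma c_nz_of_b:
  assumes "a = 0" "b = 0"
  shows "c \<noteq> 0"
proof
  assume "c = 0"
  then have "\<pi> = 0" unfolding \<pi>_def using assms by simp
  then have "W (P 1) = 0" by (simp add: W_def S_inv_smult[of 0, simplified])
  then have "smult (as 1) (P 2) + smult (bs 1) (P 1) + smult (cs 1) 1 = 0"
    using W_P[of 1] by (simp add: prev_def numeral_2_eq_2)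
  then have "L (smult (as 1) (P 2) + smult (bs 1) (P 1) + smult (cs 1) 1) = 0" by simp
  then have "cs 1 * \<kappa> 0 = 0"
    using L_P[of 0] L_P[of 1] by (simp only: v_add v_smult L_1) (simp add: numeral_2_eq_2)
  then show False using cs_nz kappa_nz by simp
qed

lemma S_2: "S [:x, y, 1:] = [:x + 1 - \<alpha>\<^sup>2, \<alpha> * y, 2 * \<alpha>\<^sup>2 - 1:]"
  and D_2: "D [:x, y, 1:] = [:y, 2 * \<alpha>:]"
  by (simp_all add: S_pCons D_pCons U2_def algebra_simps power2_eq_square)

lemma omega_1: "\<omega> (Suc 0) = smult (bs 1) (P 1) + smult (cs 2 / C 2) (P 2)"
  by (simp add: \<omega>_def prev_def as_bs_0 numeral_2_eq_2)

text \<open>For a constant \<pi> the multiplier K = 1 serves, with s = 1 / c and r = 0, and the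
  second identity becomes \<open>Fp l\<close> = \<open>U2\<close>. As \<open>e n\<close> has no zero
  when a = 0, l is constant and \<open>U2\<close> is a multiple of \<open>kap\<close>
  \<open>U2\<close> - c, which forces c = 0.\<close>

lemma not_a_b_0: "\<not> (a = 0 \<and> b = 0)"
proof
  assume ab: "a = 0 \<and> b = 0"
  then have c: "c \<noteq> 0" using c_nz_of_b by blast
  have "S (1 * f) = \<pi> * ([:1 / c:] * S f + 0 * D f)" for f
    unfolding \<pi>_def using ab c by simp
  then obtain p l F where "U2 * D (P (Suc 0) * 1) + F * 0 = v.Fp l"
    by (rule omega_principal[where k = 0]) blast
  then have l: "v.Fp l = U2" by (simp add: P_1 D_pCons)
  have "v.e n \<noteq> 0" for n
  proof -
    have "v.e n = kap * (\<alpha>\<^sup>2 - 1) * G (Suc n)"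
      unfolding v_e G_Suc using ab by algebra
    then show ?thesis using kap_nz by simp
  qed
  moreover have "l \<noteq> 0" using l by (auto simp: U2_def)
  ultimately have "coeff (v.Fp l) (degree l + 2) \<noteq> 0"
    using v.Fp_top(2)[of l "degree l"] by simp
  then have "degree l + 2 \<le> 2" using l degree_U2 le_degree by (metis le_trans)
  then obtain x where x: "l = [:x:]" by (metis add_le_same_cancel2 degree_eq_zeroE le_zero_eq)
  have "smult x phi0 = U2" using l x by (simp add: v.Fp_def)
  then have "poly (smult x phi0) 0 = poly U2 0" "coeff (smult x phi0) 2 = coeff U2 2" by simp_all
  then have "x * (kap * (1 - \<alpha>\<^sup>2) - c) = 1 - \<alpha>\<^sup>2" "x * (kap * (\<alpha>\<^sup>2 - 1)) = \<alpha>\<^sup>2 - 1"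
    unfolding phi0_def \<pi>_def using ab by (simp_all add: U2_def numeral_2_eq_2)
  then have "x * c = 0" "x \<noteq> 0" using alpha_sq_nz(1) by (algebra, metis mult_zero_left)
  then show False using c by simp
qed

text \<open>For a linear \<pi> the multiplier is \<open>K1\<close> at its root. When a = 0, the pair
  (\<open>d 2\<close>, \<open>e 2\<close>) is proportional to (A 3, (\<alpha>^2 - 1) G 3), while the
  two identities have leading coefficients A 3 + x A 2 / b and (\<alpha>^2 - 1) (G 3 + x G 2 / b), x
  being the top coefficient of F. Since G 3 A 2 - A 3 G 2 = 1, elimination gives x = 0, against
  \<alpha> x = - b \<open>p1\<close>.\<close>

lemma a_nz: "a \<noteq> 0"
proof
  assume a: "a = 0"
  then have b: "b \<noteq> 0" using not_a_b_0 by blast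
  define \<zeta> where "\<zeta> = - (c / b)"
  have pi: "\<pi> = smult b [:- \<zeta>, 1:]" unfolding \<pi>_def \<zeta>_def using a b by simp
  have phi0: "phi0 = smult kap U2 - [:c, b:]"
    unfolding phi0_def \<pi>_def using a by simp
  define s where "s = smult (1 / b) [:- \<zeta>, 2 * \<alpha>\<^sup>2 - 1:]"
  define r where "r = smult (2 * \<alpha> / b) U2"
  have "S (K1 \<zeta> * f) = \<pi> * (s * S f + r * D f)" for f
  proof -
    have "M * (N * X + smult k (U * Y)) = smult b M * (smult (1 / b) N * X + smult (k / b) U * Y)"
      for M N X U Y k using b by (simp add: algebra_simps smult_add_right)
    then show ?thesis unfolding S_K1_mult pi s_def r_def .
  qed
  then obtain p l F where p: "S (\<omega> (Suc 0)) = v.Gp p" "degree p \<le> Suc 0"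
    "F = v.Fp p - U2 * D (\<omega> (Suc 0))"
    "S (P (Suc 0) * K1 \<zeta>) + F * s = v.Gp l" "U2 * D (P (Suc 0) * K1 \<zeta>) + F * r = v.Fp l"
    and l: "\<forall>i\<ge>degree (S (P (Suc 0) * K1 \<zeta>) + F * s). coeff l i = 0"
    by (rule omega_principal[where k = 0]) blast
  define k2 where "k2 = cs 2 / C 2"
  have k2: "k2 \<noteq> 0" using cs_nz C_nz[of 1] by (simp add: k2_def numeral_2_eq_2)
  obtain p0 p1 where pp: "p = [:p0, p1:]"
    using p(2) degree_le_1E by blast
  have om: "\<omega> (Suc 0) = smult (bs 1) [:- B 0, 1:] + smult k2 [:B 0 * B 1 - C 1, - (B 0 + B 1), 1:]"
    using omega_1 by (simp add: k2_def P_1 P_2)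
  have Gp: "v.Gp p = [:- (c * p1) - kap * (\<alpha>\<^sup>2 - 1) * p1 - kap * B 0 * p0,
      - (b * p1) + kap * \<alpha> * p0 - kap * \<alpha> * B 0 * p1, kap * (2 * \<alpha>\<^sup>2 - 1) * p1:]"
    unfolding v.Gp_def unfolding pp phi0 psi0_def X1_def
    by (simp add: U2_def D_pCons S_pCons algebra_simps power2_eq_square)
  have Fp: "v.Fp p = [:- (c * p0) - kap * (\<alpha>\<^sup>2 - 1) * p0 + kap * (\<alpha>\<^sup>2 - 1) * B 0 * p1,
      - (b * p0) - c * p1 * \<alpha> - 2 * kap * (\<alpha>\<^sup>2 - 1) * p1 * \<alpha>,
      kap * (\<alpha>\<^sup>2 - 1) * p0 - b * p1 * \<alpha> - kap * (\<alpha>\<^sup>2 - 1) * B 0 * p1, 2 * kap * (\<alpha>\<^sup>2 - 1) * p1 * \<alpha>:]"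
    unfolding v.Fp_def unfolding pp phi0 psi0_def X1_def
    by (simp add: U2_def D_pCons S_pCons algebra_simps power2_eq_square)
  have Som: "S (\<omega> (Suc 0)) = smult (bs 1) [:- B 0, \<alpha>:]
      + smult k2 [:B 0 * B 1 - C 1 + 1 - \<alpha>\<^sup>2, - \<alpha> * (B 0 + B 1), 2 * \<alpha>\<^sup>2 - 1:]"
    unfolding om S_add S_smult S_2 by (simp add: S_pCons D_pCons algebra_simps)
  have Dom: "D (\<omega> (Suc 0)) = [:bs 1:] + smult k2 [:- (B 0 + B 1), 2 * \<alpha>:]"
    unfolding om D_add D_smult D_2 by (simp add: S_pCons D_pCons)
  have "coeff (S (\<omega> (Suc 0))) 2 = coeff (v.Gp p) 2" "coeff (S (\<omega> (Suc 0))) 1 = coeff (v.Gp p) 1"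
    using p(1) by simp_all
  then have e: "k2 * (2 * \<alpha>\<^sup>2 - 1) = kap * (2 * \<alpha>\<^sup>2 - 1) * p1"
    "bs 1 * \<alpha> - k2 * \<alpha> * (B 0 + B 1) = - (b * p1) + kap * \<alpha> * p0 - kap * \<alpha> * B 0 * p1"
    unfolding Gp Som by (simp_all add: numeral_2_eq_2 algebra_simps)
  have p1: "k2 = kap * p1" using e(1) A_nz[of 2, unfolded A_2] by (simp add: mult_ac)
  \<comment> \<open>The cubic terms of \<open>v.Fp p\<close> and of U2 times D of
    \<open>\<omega> (Suc 0)\<close> cancel by \<open>k2\<close> = \<open>kap\<close>
    \<open>p1\<close>.\<close>
  have Fexp: "F = [:coeff F 0, coeff F 1, kap * (\<alpha>\<^sup>2 - 1) * p0 - b * p1 * \<alpha> - kap * (\<alpha>\<^sup>2 - 1) * B 0 * p1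
      - (\<alpha>\<^sup>2 - 1) * (bs 1 - k2 * (B 0 + B 1)):]"
    unfolding p(3) Fp Dom using p1 by (simp add: U2_def algebra_simps)
  define x where "x = coeff F 2"
  have dF: "degree F \<le> 2" by (subst Fexp) simp
  \<comment> \<open>The linear coefficient in the equation of S applied to
    \<open>\<omega> (Suc 0)\<close> with \<open>v.Gp p\<close> removes \<open>p0\<close> and
    \<open>bs 1\<close> at once.\<close>
  have "\<alpha> * x = - (b * p1)"
  proof -
    have "x = kap * (\<alpha>\<^sup>2 - 1) * p0 - b * p1 * \<alpha> - kap * (\<alpha>\<^sup>2 - 1) * B 0 * p1
      - (\<alpha>\<^sup>2 - 1) * (bs 1 - k2 * (B 0 + B 1))"
      unfolding x_def by (subst Fexp) (simp add: numeral_2_eq_2)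
    with e(2) show ?thesis by algebra
  qed
  then have x: "x \<noteq> 0" using b k2 p1 by auto
  have PK: "degree (P (Suc 0) * K1 \<zeta>) \<le> 3" "coeff (P (Suc 0) * K1 \<zeta>) 3 = 1"
    using degree_mult_le'[of "P (Suc 0)" 1 "K1 \<zeta>" 2] coeff_mult_top[of "P (Suc 0)" 1 "K1 \<zeta>" 2]
    by (simp_all add: K1_def numeral_2_eq_2 numeral_3_eq_3 P_1)
  have s: "degree s \<le> 1" "coeff s 1 = (2 * \<alpha>\<^sup>2 - 1) / b" by (simp_all add: s_def)
  have r: "degree r \<le> 2" "coeff r 2 = 2 * \<alpha> * (\<alpha>\<^sup>2 - 1) / b"
    using degree_U2 coeff_U2 by (auto simp: r_def intro: order.trans[OF degree_smult_le])
  have H: "degree (S (P (Suc 0) * K1 \<zeta>) + F * s) \<le> 3" "coeff (S (P (Suc 0) * K1 \<zeta>) + F * s) 3 = A 3 + x * A 2 / b"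
    using degree_mult_le'[OF dF s(1)] coeff_mult_top[OF dF s(1), unfolded s(2), folded x_def A_2] PK
    by (simp_all add: degree_add_le coeff_S_top)
  have dD: "degree (D (P (Suc 0) * K1 \<zeta>)) \<le> 2" "coeff (D (P (Suc 0) * K1 \<zeta>)) 2 = G 3"
    using degree_D_le[of "P (Suc 0) * K1 \<zeta>"] coeff_D_top[of "P (Suc 0) * K1 \<zeta>" 2] PK
    by (simp_all add: numeral_2_eq_2 numeral_3_eq_3)
  have F': "coeff (U2 * D (P (Suc 0) * K1 \<zeta>) + F * r) 4 = (\<alpha>\<^sup>2 - 1) * G 3 + x * (2 * \<alpha> * (\<alpha>\<^sup>2 - 1) / b)"
    using coeff_mult_top[OF degree_U2 dD(1)] coeff_mult_top[OF dF r(1)]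
    by (simp add: dD(2) coeff_U2 r(2) x_def)
  have dl: "degree l \<le> 2" using l H(1) by (intro degree_le) auto
  have "v.d 2 * coeff l 2 = A 3 + x * A 2 / b"
    using v.Gp_top(2)[OF dl] H(2) p(4) by (simp add: numeral_2_eq_2 numeral_3_eq_3)
  moreover have "v.e 2 * coeff l 2 = (\<alpha>\<^sup>2 - 1) * G 3 + x * (2 * \<alpha> * (\<alpha>\<^sup>2 - 1) / b)"
    using v.Fp_top(2)[OF dl] F' p(5) by simp
  moreover have "v.d 2 = kap * A 3" "v.e 2 = kap * (\<alpha>\<^sup>2 - 1) * G 3"
    unfolding v_d v_e G_Suc[of 2, unfolded Suc_2] Suc_2 using a by algebra+
  ultimately have "(\<alpha>\<^sup>2 - 1) * G 3 * (A 3 + x / b * A 2) = A 3 * ((\<alpha>\<^sup>2 - 1) * (G 3 + x / b * G 2))"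
    unfolding G_2 times_divide_eq_left by algebra
  then have "(\<alpha>\<^sup>2 - 1) * (x / b) * (G 3 * A 2 - A 3 * G 2) = 0" by algebra
  moreover have "G 3 * A 2 - A 3 * G 2 = 1" using G_minus[of 1 2] by (simp add: numeral_3_eq_3)
  ultimately show False using x b by simp
qed

end

lemma (in askey_wilson_base) degree_K1: "degree (K1 c) \<le> 2" and coeff_K1: "coeff (K1 c) 2 = 1"
  by (simp_all add: K1_def numeral_2_eq_2)

context aw_structure
begin

lemma pi_factor:
  obtains x y where "\<pi> = smult a ([:- x, 1:] * [:- y, 1:])"
proof -
  define r where "r = csqrt (b\<^sup>2 - 4 * a * c)"
  have r: "r\<^sup>2 = b\<^sup>2 - 4 * a * c" by (simp add: r_def)
  define x where "x = (- b + r) / (2 * a)"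
  define y where "y = (- b - r) / (2 * a)"
  have xy: "2 * a * x = - b + r" "2 * a * y = - b - r"
    using a_nz by (simp_all add: x_def y_def)
  have "2 * (a * (x + y)) = 2 * (- b)" "(4 * a) * (a * (x * y)) = (4 * a) * c"
    using xy r by algebra+
  then have "a * (x + y) = - b" "a * (x * y) = c"
    using a_nz by (metis mult_left_cancel zero_neq_numeral) (metis \<open>4 * a * (a * (x * y)) = 4 * a * c\<close> a_nz mult_eq_0_iff mult_left_cancel zero_neq_numeral)
  then have "\<pi> = smult a ([:- x, 1:] * [:- y, 1:])"
    by (simp add: \<pi>_def algebra_simps) (algebra)
  then show ?thesis by (rule that)
qed

text \<open>The same elimination one index higher, with a multiplier built from both roots of \<pi>.
  The leading terms of degrees 6 and 7 fix x = (leading coefficient of F) / a, and the leading terms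
  defining p and F express x through c_3 / C_3.\<close>

lemma kap_3: "(cs 3 / C 3 + 2 * a) * (2 * kap * (\<alpha>\<^sup>2 - 1) - a) = - (a * kap)"
proof -
  obtain \<zeta>1 \<zeta>2 where pi: "\<pi> = smult a ([:- \<zeta>1, 1:] * [:- \<zeta>2, 1:])" by (rule pi_factor)
  define K where "K = K1 \<zeta>1 * K1 \<zeta>2"
  define M1 where "M1 = [:- \<zeta>1, 2 * \<alpha>\<^sup>2 - 1:]"
  define M2 where "M2 = [:- \<zeta>2, 2 * \<alpha>\<^sup>2 - 1:]"
  define s where "s = smult (1 / a) (M1 * M2 + smult (4 * \<alpha>\<^sup>2) U2)"
  define r where "r = smult (2 * \<alpha> / a) (U2 * (M1 + M2))"
  have "S (K * f) = \<pi> * (s * S f + r * D f)" for f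
  proof -
    have "X * (M * (Y * (N * Sf + smult k (U * Df))) + smult k (U * (Y * (N * Df + smult k Sf))))
        = smult a (X * Y) * (smult (1 / a) (M * N + smult (k\<^sup>2) U) * Sf + smult (k / a) (U * (M + N)) * Df)"
      for X Y M N U Sf Df k using a_nz by (simp add: algebra_simps smult_add_right power2_eq_square)
    from this[where k = "2 * \<alpha>"] show ?thesis
      unfolding K_def mult.assoc[of "K1 \<zeta>1"] S_K1_mult D_K1_mult pi s_def r_def M1_def M2_def
      by (simp only: power_mult_distrib) simp
  qed
  then obtain p l F where p: "S (\<omega> (Suc 1)) = v.Gp p" "degree p \<le> Suc 1"
    "F = v.Fp p - U2 * D (\<omega> (Suc 1))"
    "S (P (Suc 1) * K) + F * s = v.Gp l" "U2 * D (P (Suc 1) * K) + F * r = v.Fp l"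
    and l: "\<forall>i\<ge>degree (S (P (Suc 1) * K) + F * s). coeff l i = 0"
    by (rule omega_principal[where k = 1]) blast
  note p = p[unfolded Suc_1] note l = l[unfolded Suc_1]
  define k3 where "k3 = cs 3 / C 3"
  have om: "degree (\<omega> 2) \<le> 3" "coeff (\<omega> 2) 3 = k3"
    using omega_top[of 2] by (simp_all add: k3_def)
  have "v.d 2 * coeff p 2 = A 3 * k3"
    using v.Gp_top(2)[OF p(2)] p(1) coeff_S_top[OF om(1)] om(2) by simp
  have dDom: "degree (D (\<omega> 2)) \<le> 2" "coeff (D (\<omega> 2)) 2 = G 3 * k3"
    using degree_D_le[of "\<omega> 2"] coeff_D_top[of "\<omega> 2" 2] om by simp_all
  have dF: "degree F \<le> 4" and F4: "coeff F 4 = v.e 2 * coeff p 2 - (\<alpha>\<^sup>2 - 1) * G 3 * k3"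
    using v.Fp_top[OF p(2)] degree_mult_le'[OF degree_U2 dDom(1)] coeff_mult_top[OF degree_U2 dDom(1)]
    unfolding p(3) by (simp_all add: degree_diff_le coeff_U2 dDom(2))
  define x where "x = coeff F 4 / a"
  have K: "degree K \<le> 4" "coeff K 4 = 1"
    using degree_mult_le'[OF degree_K1 degree_K1, of \<zeta>1 \<zeta>2] coeff_mult_top[OF degree_K1 degree_K1, of \<zeta>1 \<zeta>2]
    by (simp_all add: K_def coeff_K1)
  have dP2: "degree (P 2) \<le> 2" by simp
  have PK: "degree (P 2 * K) \<le> 6" "coeff (P 2 * K) 6 = 1"
    using degree_mult_le'[OF dP2 K(1)] coeff_mult_top[OF dP2 K(1)] K(2) by simp_all
  have M: "degree M1 \<le> 1" "degree M2 \<le> 1" "coeff M1 1 = A 2" "coeff M2 1 = A 2" by (simp_all add: M1_def M2_def A_2)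
  have s: "degree s \<le> 2" "coeff s 2 = (A 2 * A 2 + 4 * \<alpha>\<^sup>2 * (\<alpha>\<^sup>2 - 1)) / a"
    using degree_mult_le'[OF M(1,2), unfolded one_add_one] coeff_mult_top[OF M(1,2), unfolded M one_add_one]
      degree_U2 coeff_U2
    by (auto simp: s_def intro!: order.trans[OF degree_smult_le] degree_add_le)
  have dM: "degree (M1 + M2) \<le> 1" "coeff (M1 + M2) 1 = 2 * A 2"
    using M(1,2) by (auto intro: degree_add_le simp only: coeff_add M mult_2)
  have r: "degree r \<le> 3" "coeff r 3 = 4 * \<alpha> * (\<alpha>\<^sup>2 - 1) * A 2 / a"
    using degree_mult_le'[OF degree_U2 dM(1)] coeff_mult_top[OF degree_U2 dM(1), unfolded dM coeff_U2]
    by (auto simp: r_def intro!: order.trans[OF degree_smult_le])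
  have H: "degree (S (P 2 * K) + F * s) \<le> 6" "coeff (S (P 2 * K) + F * s) 6 = A 6 + coeff F 4 * coeff s 2"
    using degree_mult_le'[OF dF s(1)] coeff_mult_top[OF dF s(1)] PK
    by (simp_all add: degree_add_le coeff_S_top)
  have dD: "degree (D (P 2 * K)) \<le> 5" "coeff (D (P 2 * K)) 5 = G 6"
    using degree_D_le[of "P 2 * K"] coeff_D_top[of "P 2 * K" 5] PK by simp_all
  have F': "coeff (U2 * D (P 2 * K) + F * r) 7 = (\<alpha>\<^sup>2 - 1) * G 6 + coeff F 4 * coeff r 3"
    using coeff_mult_top[OF degree_U2 dD(1)] coeff_mult_top[OF dF r(1)]
    by (simp add: dD(2) coeff_U2)
  have dl: "degree l \<le> 5" using l H(1) by (intro degree_le) auto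
  \<comment> \<open>With these, the leading coefficients of \<open>s\<close> and \<open>r\<close>
    are A 4 / a and (\<alpha>^2 - 1) G 4 / a, the form to which the subtraction formulas
    apply.\<close>
  have A4: "A 4 = A 2 * A 2 + 4 * \<alpha>\<^sup>2 * (\<alpha>\<^sup>2 - 1)" and G4: "G 4 = 4 * \<alpha> * A 2"
    unfolding A_2 by (simp_all add: eval_nat_numeral A_Suc G_Suc algebra_simps power2_eq_square)
  have dl5: "v.d 5 * coeff l 5 = A 6 + x * A 4"
    using v.Gp_top(2)[OF dl] H(2) p(4) by (simp add: s(2) x_def A4)
  have el5: "v.e 5 * coeff l 5 = (\<alpha>\<^sup>2 - 1) * (G 6 + x * G 4)"
  proof -
    have "v.e 5 * coeff l 5 = coeff (v.Fp l) 7" using v.Fp_top(2)[OF dl] by simp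
    also have "\<dots> = (\<alpha>\<^sup>2 - 1) * G 6 + coeff F 4 * coeff r 3" using F' p(5) by simp
    finally show ?thesis by (simp add: r(2) x_def G4 algebra_simps)
  qed
  have G6: "G 6 = \<alpha> * G 5 + A 5" and G3: "G 3 = \<alpha> * G 2 + A 2"
    using G_Suc[of 5] G_Suc[of 2] by simp_all
  have d5: "v.d 5 = kap * A 6 - a * G 5" "v.e 5 = kap * (\<alpha>\<^sup>2 - 1) * G 6 - a * A 5"
    unfolding v_d v_e G6 by (simp_all add: algebra_simps)
  have d2: "v.d 2 = kap * A 3 - a * G 2" "v.e 2 = kap * (\<alpha>\<^sup>2 - 1) * G 3 - a * A 2"
    unfolding v_d v_e G3 by (simp_all add: algebra_simps)
  have det: "G 6 * A 4 - A 6 * G 4 = G 2" "A 6 * A 5 - (\<alpha>\<^sup>2 - 1) * G 6 * G 5 = \<alpha>"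
    "A 5 * A 4 - (\<alpha>\<^sup>2 - 1) * G 5 * G 4 = \<alpha>" "A 3 * A 2 - (\<alpha>\<^sup>2 - 1) * G 3 * G 2 = \<alpha>"
    using G_minus[of 2 4] A_minus[of 1 5] A_minus[of 1 4] A_minus[of 1 2] by (simp_all add: A_1 numeral_3_eq_3)
  have "a * (\<alpha> * (1 + x)) = kap * (\<alpha>\<^sup>2 - 1) * (2 * \<alpha>) * x"
  proof -
    have "v.e 5 * (A 6 + x * A 4) = v.d 5 * ((\<alpha>\<^sup>2 - 1) * (G 6 + x * G 4))"
      unfolding dl5[symmetric] el5[symmetric] by (simp add: mult_ac)
    then show ?thesis using det(1-3) unfolding d5 G_2 by algebra
  qed
  then have "\<alpha> * (x * (2 * kap * (\<alpha>\<^sup>2 - 1) - a)) = \<alpha> * a" by algebra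
  then have xT: "x * (2 * kap * (\<alpha>\<^sup>2 - 1) - a) = a" by simp
  have "a * (v.d 2 * x) = - (a * (\<alpha> * k3))"
  proof -
    have "a * x = coeff F 4" using a_nz by (simp add: x_def)
    with \<open>v.d 2 * coeff p 2 = A 3 * k3\<close> F4 det(4) show ?thesis unfolding d2 by algebra
  qed
  then have "v.d 2 * x = - (\<alpha> * k3)" using a_nz by (metis mult_left_cancel mult_minus_right)
  moreover have "\<alpha> * (k * T) = - (e * a)" if "e * x = - (\<alpha> * k)" "x * T = a" for e k T
    using that by algebra
  ultimately have "\<alpha> * (k3 * (2 * kap * (\<alpha>\<^sup>2 - 1) - a)) = - (v.d 2 * a)" using xT by blast
  \<comment> \<open>After the shift of \<open>k3\<close> by 2 a the terms in a^2 cancel and a single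
    product remains on the right.\<close>
  then have "\<alpha> * ((k3 + 2 * a) * (2 * kap * (\<alpha>\<^sup>2 - 1) - a)) = \<alpha> * (- (a * kap))"
    unfolding d2 A_3 G_2 by algebra
  then show ?thesis unfolding k3_def by (metis alpha_nz mult_left_cancel)
qed

end

section \<open>From the structure relation to a Pearson equation\<close>

context askey_wilson_base
begin

definition U1 :: "complex poly" where "U1 = [:0, \<alpha>\<^sup>2 - 1:]"

text \<open>The two rules are proved together because the \<open>pCons\<close> rules feed each
  operator into the other.\<close>

lemma D_S: "D (S f) = [:\<alpha>:] * S (D f) + U1 * D (D f)"
  and S_S: "S (S f) = f + U1 * S (D f) + [:\<alpha>:] * U2 * D (D f)"
proof (induction f)
  case 0
  { case 1 show ?case by simp }
  { case 2 show ?case by simp }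
next
  case (pCons c p)
  \<comment> \<open>Writing z and \<alpha> as polynomials \<open>Z\<close> and \<open>K\<close>
    makes both induction steps identities in a commutative ring.\<close>
  define Z K where "Z = [:0, 1::complex:]" and "K = [:\<alpha>:]"
  have U1: "U1 = (K\<^sup>2 - 1) * Z" and U2: "U2 = (K\<^sup>2 - 1) * (Z\<^sup>2 - 1)"
    by (simp_all add: U1_def U2_def Z_def K_def power2_eq_square one_pCons)
  have DU: "D U2 = 2 * K * U1" and SU: "S U2 = K\<^sup>2 * U2 + U1\<^sup>2"
    by (simp_all add: U1_def U2_def S_pCons D_pCons K_def power2_eq_square numeral_poly algebra_simps)
  have DZ: "D (K * Z * f) = K * (K * Z * D f + S f)" and SZ: "S (K * Z * f) = K * (K * Z * S f + U2 * D f)" for f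
    unfolding K_def mult.assoc Z_def
    by (simp_all add: D_pCons S_pCons D_smult S_smult smult_add_right)
  have "pCons c p = [:c:] + Z * p" by (simp add: Z_def)
  moreover have "D (Z * p) = K * Z * D p + S p" "S (Z * p) = K * Z * S p + U2 * D p"
    by (simp_all add: Z_def K_def D_pCons S_pCons)
  ultimately have D: "D (pCons c p) = K * Z * D p + S p" and S: "S (pCons c p) = [:c:] + K * Z * S p + U2 * D p"
    and p: "pCons c p = [:c:] + Z * p"
    by (simp_all only: D_add S_add D_const S_const add.assoc) simp_all
  have IH1: "D (S p) = K * S (D p) + U1 * D (D p)" and IH2: "S (S p) = p + U1 * S (D p) + K * U2 * D (D p)"
    using pCons by (simp_all add: K_def)
  { case 1
    have "K * (K * Z * ds + ss) + (2 * K * U1 * sd + (K\<^sup>2 * U2 + U1\<^sup>2) * dd)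
        = K * (K * (K * Z * sd + U2 * dd) + ss) + U1 * (K * (K * Z * dd + sd) + ds)"
      if "ds = K * sd + U1 * dd" for ds ss sd dd using that U1 U2 by algebra
    from this[OF IH1] show ?case
      unfolding D S D_add S_add DZ SZ D_mult[of U2] S_mult[of U2] DU SU K_def[symmetric] D_const
      by (simp only: add_0) }
  { case 2
    have "c' + K * (K * Z * ss + U2 * ds) + ((K\<^sup>2 * U2 + U1\<^sup>2) * sd + U2 * (2 * K * U1) * dd)
        = c' + Z * p + U1 * (K * (K * Z * sd + U2 * dd) + ss) + K * U2 * (K * (K * Z * dd + sd) + ds)"
      if "ds = K * sd + U1 * dd" "ss = p + U1 * sd + K * U2 * dd" for ds ss sd dd c'
      using that U1 U2 by algebra
    from this[OF IH1 IH2, of "[:c:]", folded p] show ?case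
      unfolding D S D_add S_add DZ SZ D_mult[of U2] S_mult[of U2] DU SU K_def[symmetric] S_const . }
qed

end

context aw_structure
begin

text \<open>The value for which the cubic coefficient of F in \<open>L_phi\<close> vanishes;
  \<open>t_eq\<close> brings it into the form occurring in the theorem.\<close>

definition t :: complex where "t = 4 * \<alpha>\<^sup>2 - 3 - 2 * a / kap"

lemma kap_t: "kap * t = kap * (4 * \<alpha>\<^sup>2 - 3) - 2 * a"
  using kap_nz by (simp add: t_def field_simps)

lemma r3_nz: "cs 3 + 2 * a * C 3 \<noteq> 0" and t_eq: "t = 1 - 2 * a * (C 3 / (cs 3 + 2 * a * C 3))"
proof -
  have C3: "C 3 \<noteq> 0" using C_nz[of 2] by simp
  define k3 where "k3 = cs 3 / C 3"
  have r3: "cs 3 + 2 * a * C 3 = C 3 * (k3 + 2 * a)"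
    using C3 by (simp add: k3_def algebra_simps)
  define T where "T = 2 * kap * (\<alpha>\<^sup>2 - 1) - a"
  have *: "(k3 + 2 * a) * T = - (a * kap)" using kap_3 by (simp add: k3_def T_def)
  then have nz: "k3 + 2 * a \<noteq> 0" "T \<noteq> 0" using a_nz kap_nz by auto
  then show "cs 3 + 2 * a * C 3 \<noteq> 0" using r3 C3 by simp
  have "kap * ((k3 + 2 * a) * (T * t)) = kap * (T * k3)"
    using * kap_t unfolding T_def by algebra
  then have "(k3 + 2 * a) * t = k3" using nz kap_nz by simp
  then have "t = 1 - 2 * a / (k3 + 2 * a)" using nz by (simp add: field_simps)
  then show "t = 1 - 2 * a * (C 3 / (cs 3 + 2 * a * C 3))" using C3 by (simp add: r3)
qed

text \<open>The claimed \<phi> in terms of P_1 and P_2. The part with z P_1 is there to cancel the S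
  (D f) contribution of 2 \<alpha> P_1 S f.\<close>

definition phi :: "complex poly" where
  "phi = smult (1 / (2 * \<alpha>)) (smult (t + 1) (P 2) + smult (B 0 + B 1) (P 1) - smult (2 * \<alpha>\<^sup>2) ([:0, 1:] * P 1))"

lemma two_alpha_L_phi:
  "2 * \<alpha> * L (phi * g) = (t + 1) * L (P 2 * g) + (B 0 + B 1) * L (P 1 * g) - 2 * \<alpha>\<^sup>2 * L (P 1 * ([:0, 1:] * g))"
proof -
  have "smult (2 * \<alpha>) (phi * g) = smult (t + 1) (P 2 * g) + smult (B 0 + B 1) (P 1 * g) - smult (2 * \<alpha>\<^sup>2) (P 1 * ([:0, 1:] * g))"
    by (simp add: phi_def algebra_simps)
  then have "L (smult (2 * \<alpha>) (phi * g)) = L \<dots>" by (rule arg_cong)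
  then show ?thesis by (simp only: v_add v_diff v_smult)
qed

text \<open>With g = D f, \<open>v_pi\<close> and the commutation rule turn every term into
  \<open>v\<close> of a multiple of D g or S g. The S g parts coming from P_1 cancel. The P_2 part
  contributes v (\<pi> S g) - \<open>kap\<close> C_1 L g; this is v (\<open>Gp p\<close> S g)
  because \<pi> = \<open>Gp p\<close> + \<open>kap\<close> C_1, and the pair of p turns it into - v
  (\<open>Fp p\<close> D g).\<close>

lemma L_phi:
  obtains F where "degree F \<le> 2"
    "\<And>f. 2 * \<alpha> * kap * L (phi * D f + P 1 * S f) = v (F * D (D f))"
proof -
  obtain p x where p: "\<pi> = v.Gp p + [:x:]" "\<forall>i\<ge>degree \<pi>. coeff p i = 0"
    using v.Gp_solve by blast
  have dpi: "degree \<pi> = 2" "coeff \<pi> 2 = a" using a_nz by (simp_all add: \<pi>_def numeral_2_eq_2)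
  have dp: "degree p \<le> 1" using p(2) dpi by (intro degree_le) auto
  have "v \<pi> = x * v 1" using p(1) by (simp add: v.v_add v.v_const)
  moreover have "v \<pi> = kap * (C 1 * v 1)"
  proof -
    have "v \<pi> = v (\<pi> * D (P 1))" by (simp add: P_1 D_pCons one_pCons[symmetric])
    also have "\<dots> = kap * \<kappa> 1" by (simp add: v_pi orth)
    also have "\<kappa> 1 = C 1 * v 1" using kappa_Suc[of 0] L_1 v_S[of 1] by simp
    finally show ?thesis .
  qed
  ultimately have x: "x = kap * C 1" using v.v_1 by simp
  define Q where "Q = [:B 0 - t * B 1, (t - 1) * \<alpha>:]"
  define F where "F = \<pi> * Q - smult (t + 1) (v.Fp p)"
  have dQ: "degree Q \<le> 1" "coeff Q 1 = (t - 1) * \<alpha>" by (simp_all add: Q_def)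
  have dpi': "degree \<pi> \<le> 2" using dpi by simp
  have "v.d 1 * coeff p 1 = a"
    using v.Gp_top(2)[OF dp] p(1) dpi(2) by (simp add: numeral_2_eq_2)
  moreover have "v.d 1 = kap * (2 * \<alpha>\<^sup>2 - 1) - a" "v.e 1 = 2 * \<alpha> * kap * (\<alpha>\<^sup>2 - 1) - a * \<alpha>"
    unfolding v_d v_e Suc_1 A_2 by (simp_all add: A_1 algebra_simps)
  moreover have "coeff (v.Fp p) 3 = v.e 1 * coeff p 1"
    using v.Fp_top(2)[OF dp] by (simp add: numeral_3_eq_3)
  moreover have "coeff (\<pi> * Q) 3 = a * ((t - 1) * \<alpha>)"
    using coeff_mult_top[OF dpi' dQ(1)] dpi dQ(2) by simp
  \<comment> \<open>The cubic coefficient of F, multiplied by \<open>v.d 1\<close>: it vanishes by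
    the choice of \<open>t\<close>.\<close>
  moreover have "d * (a * ((t - 1) * \<alpha>) - (t + 1) * (e * p1)) = 0"
    if "d * p1 = a" "d = kap * (2 * \<alpha>\<^sup>2 - 1) - a" "e = 2 * \<alpha> * kap * (\<alpha>\<^sup>2 - 1) - a * \<alpha>" for d e p1
  proof -
    have "(t + 1) * e = \<alpha> * ((kap * t) * (2 * \<alpha>\<^sup>2 - 2) - kap * (2 - 2 * \<alpha>\<^sup>2) - (t + 1) * a)"
      unfolding that(3) by (simp add: algebra_simps)
    also have "\<dots> = (t - 1) * \<alpha> * d"
      using kap_t unfolding that(2) by algebra
    finally show ?thesis using that(1) by algebra
  qed
  ultimately have "v.d 1 * coeff F 3 = 0" unfolding F_def by (simp only: coeff_diff coeff_smult)
  then have "coeff F 3 = 0" using v.d_nz by simp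
  moreover have "degree F \<le> 3"
    using degree_mult_le'[OF dpi' dQ(1)] v.Fp_top(1)[OF dp] unfolding F_def
    by (intro degree_diff_le) (auto intro: order.trans[OF degree_smult_le])
  ultimately have "degree F \<le> 2"
    using leading_coeff_0_iff[of F] by (cases "degree F = 3") auto
  moreover have "2 * \<alpha> * kap * L (phi * D f + P 1 * S f) = v (F * D (D f))" for f
  proof -
    define g where "g = D f"
    note e0 = two_alpha_L_phi[of g]
    have e1: "L (P 2 * g) = L (P 1 * ([:0, 1:] * g)) - B 1 * L (P 1 * g) - C 1 * L g"
    proof -
      have "P 2 = [:0, 1:] * P 1 - smult (B 1) (P 1) - smult (C 1) 1"
        by (simp add: P_1 P_2 one_pCons algebra_simps)
      moreover have "Q2 * g = Q1 * (Z * g) - smult x (Q1 * g) - smult y g"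
        if "Q2 = Z * Q1 - smult x Q1 - smult y 1" for Q1 Q2 Z x y
        unfolding that by (simp add: algebra_simps)
      ultimately have "P 2 * g = P 1 * ([:0, 1:] * g) - smult (B 1) (P 1 * g) - smult (C 1) g"
        by blast
      then show ?thesis by (simp only: v_diff v_smult)
    qed
    have e2: "kap * L (P 1 * ([:0, 1:] * g)) = v (\<pi> * (smult \<alpha> ([:0, 1:] * D g) + S g))"
      unfolding v_pi[symmetric] D_mult D_X S_X by (simp add: add.commute)
    have e3: "kap * L (P 1 * S f) = v (\<pi> * (smult \<alpha> (S g) + smult (\<alpha>\<^sup>2 - 1) ([:0, 1:] * D g)))"
      unfolding v_pi[symmetric] D_S g_def by (simp add: U1_def)
    define v1 v2 v3 where "v1 = v (\<pi> * ([:0, 1:] * D g))" and "v2 = v (\<pi> * S g)" and "v3 = v (\<pi> * D g)"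
    have e: "kap * L (P 1 * ([:0, 1:] * g)) = \<alpha> * v1 + v2" "kap * L (P 1 * S f) = \<alpha> * v2 + (\<alpha>\<^sup>2 - 1) * v1"
      "kap * L (P 1 * g) = v3"
      using e2 e3 v_pi[of g, symmetric] unfolding v1_def v2_def v3_def
      by (simp_all only: distrib_left mult_smult_right v.v_add v.v_smult)
    have "v (v.Fp p * D g) + v (v.Gp p * S g) = 0"
      using v.v_Fp_Gp[of p g] by (simp only: v.v_add)
    moreover have "v (v.Gp p * S g) = v2 - kap * C 1 * L g"
    proof -
      have "v.Gp p * S g = \<pi> * S g - smult (kap * C 1) (S g)"
        using p(1) x by (simp add: algebra_simps)
      then show ?thesis by (simp only: v.v_diff v.v_smult v_S v2_def)
    qed
    moreover have "v (F * D g) = (t - 1) * \<alpha> * v1 + (B 0 - t * B 1) * v3 - (t + 1) * v (v.Fp p * D g)"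
    proof -
      have "F * D g = smult ((t - 1) * \<alpha>) (\<pi> * ([:0, 1:] * D g)) + smult (B 0 - t * B 1) (\<pi> * D g) - smult (t + 1) (v.Fp p * D g)"
        by (simp add: F_def Q_def algebra_simps)
      then show ?thesis by (simp only: v.v_add v.v_diff v.v_smult v1_def v3_def)
    qed
    moreover have "L (phi * g + P 1 * S f) = L (phi * g) + L (P 1 * S f)" by (rule v_add)
    ultimately show ?thesis using e e0 e1 unfolding g_def[symmetric] by algebra
  qed
  ultimately show ?thesis by (rule that)
qed

end

section \<open>Low moments and the conditions (i) and (ii)\<close>

context aw_ops
begin

text \<open>As a rewrite rule this strips one coefficient at a time, so the values of
  \<open>L\<close> on P_n times an explicit polynomial are computed by simplification.\<close>

lemma L_P_pCons:
  "L (P n * pCons x f) = x * L (P n) + (L (P (Suc n) * f) + B n * L (P n * f) + C n * L (prev P n * f))"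
proof -
  have 1: "P n * pCons x f = smult x (P n) + ([:0, 1:] * P n) * f"
    by (simp add: algebra_simps)
  have 2: "[:0, 1:] * P n = P (Suc n) + smult (B n) (P n) + smult (C n) (prev P n)"
    by (simp add: P_Suc algebra_simps)
  show ?thesis unfolding 1 2 by (simp add: distrib_right v_add v_smult)
qed

end

context aw_structure
begin

text \<open>\<open>Z\<close> is the bracket of condition (i). \<open>R\<close> is what the test in
  degree 4 still demands once the one in degree 3 holds.\<close>

definition Z :: complex where
  "Z = (B 0 + B 1)\<^sup>2 + 4 * \<alpha>\<^sup>2 * (C 1 - B 0 * B 1 + \<alpha>\<^sup>2 - 1) - 2 * (2 * \<alpha>\<^sup>2 - 1) * C 2"
definition R :: complex where
  "R = (4 * \<alpha>\<^sup>2 - 3) * (B 0 + B 2) - 2 * B 1 - (1 - t) * (2 * (2 * \<alpha>\<^sup>2 - 1) * B 2 - B 0 - B 1)"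

definition Epol :: "complex poly \<Rightarrow> complex" where "Epol f = 2 * \<alpha> * L (phi * D f + P 1 * S f)"

lemma D_S_powers:
  "D [:0, 0, 1:] = [:0, 2 * \<alpha>:]" "S [:0, 0, 1:] = [:1 - \<alpha>\<^sup>2, 0, 2 * \<alpha>\<^sup>2 - 1:]"
  "D [:0, 0, 0, 1:] = [:1 - \<alpha>\<^sup>2, 0, 4 * \<alpha>\<^sup>2 - 1:]"
  "S [:0, 0, 0, 1:] = [:0, - 3 * \<alpha> * (\<alpha>\<^sup>2 - 1), 0, 4 * \<alpha> ^ 3 - 3 * \<alpha>:]"
  "D [:0, 0, 0, 0, 1:] = [:0, - 4 * \<alpha> * (\<alpha>\<^sup>2 - 1), 0, 8 * \<alpha> ^ 3 - 4 * \<alpha>:]"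
  "S [:0, 0, 0, 0, 1:] = [:(\<alpha>\<^sup>2 - 1)\<^sup>2, 0, (\<alpha>\<^sup>2 - 1) * (2 - 8 * \<alpha>\<^sup>2), 0, 8 * \<alpha> ^ 4 - 8 * \<alpha>\<^sup>2 + 1:]"
  by (simp_all add: D_pCons S_pCons U2_def algebra_simps eval_nat_numeral)

lemma Epol_eq: "Epol f = (t + 1) * L (P 2 * D f) + (B 0 + B 1) * L (P 1 * D f)
    - 2 * \<alpha>\<^sup>2 * L (P 1 * pCons 0 (D f)) + 2 * \<alpha> * L (P 1 * S f)"
proof -
  have "pCons 0 (D f) = [:0, 1:] * D f" by simp
  then show ?thesis unfolding Epol_def v_add distrib_left two_alpha_L_phi by (simp only:)
qed

lemma L_P_012: "L (P 0) = \<kappa> 0" "L (P (Suc n)) = 0" "L (P 1) = 0" "L (P 2) = 0"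
  using L_P[of 0] L_P[of 1] by (simp_all add: L_1 L_P numeral_2_eq_2)

lemma prev_Suc: "prev P (Suc n) = P n" "prev P 0 = 0"
  by (simp_all add: prev_def)

lemmas L_eval = L_P_pCons L_P_012 prev_Suc numeral_2_eq_2 numeral_3_eq_3

text \<open>This holds for any \<open>t\<close>, as P_2 is orthogonal to degree 1. The coefficient
  B_0 + B_1 of P_1 in \<open>phi\<close> makes the rest cancel, because L (P_1 z^2) is B_0 + B_1
  times the norm of P_1.\<close>

lemma Epol_2: "Epol [:0, 0, 1:] = 0"
  unfolding Epol_eq D_S_powers by (simp add: L_eval del: P_0 mult_pCons_right) algebra

lemma Epol_3: "Epol [:0, 0, 0, 1:] = - \<kappa> 0 * C 1 * (Z + (4 * \<alpha>\<^sup>2 - 1) * (1 - t) * C 2)"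
  unfolding Epol_eq D_S_powers Z_def by (simp add: L_eval del: P_0 mult_pCons_right) algebra

lemma Epol_4: "Epol [:0, 0, 0, 0, 1:] = \<kappa> 0 * C 1 * (2 * \<alpha> * C 2 * R
    - 2 * \<alpha> * (B 0 + B 1) * (Z + (4 * \<alpha>\<^sup>2 - 1) * (1 - t) * C 2))"
  unfolding Epol_eq D_S_powers Z_def R_def by (simp add: L_eval del: P_0 mult_pCons_right) algebra

text \<open>Coefficients of z^3, z^2, z and 1. The first three express \<open>as 2\<close>,
  \<open>bs 2\<close>, \<open>cs 2\<close> through a, b, c; the last one is then a genuine
  constraint.\<close>

lemma structure_2:
  defines "f \<equiv> 4 * \<alpha>\<^sup>2 - 3" and "h \<equiv> B 0 * B 1 - C 1"
  shows "as 2 * f = 2 * a"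
    and "2 * \<alpha> * b - a * (B 0 + B 1) = - as 2 * (2 * \<alpha>\<^sup>2 - 1) * (B 0 + B 1 + B 2) + bs 2 * (2 * \<alpha>\<^sup>2 - 1)"
    and "2 * \<alpha> * c - b * (B 0 + B 1) = as 2 * \<alpha> * (h + B 2 * (B 0 + B 1) - C 2 - 3 * (\<alpha>\<^sup>2 - 1))
      - bs 2 * \<alpha> * (B 0 + B 1) + cs 2 * \<alpha>"
    and "- c * (B 0 + B 1) = as 2 * (- B 2 * h + C 2 * B 0 + (B 0 + B 1 + B 2) * (\<alpha>\<^sup>2 - 1))
      + bs 2 * (h + 1 - \<alpha>\<^sup>2) - cs 2 * B 0"
proof -
  have P3: "P 3 = [:- B 2 * h + C 2 * B 0, h + B 2 * (B 0 + B 1) - C 2, - (B 0 + B 1 + B 2), 1:]"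
    using P_Suc_Suc[of 1] by (simp add: P_2 P_1 h_def algebra_simps flip: numeral_2_eq_2 numeral_3_eq_3)
  have S3: "S [:x, y, z, 1:] = [:x + z * (1 - \<alpha>\<^sup>2), \<alpha> * y - 3 * \<alpha> * (\<alpha>\<^sup>2 - 1), z * (2 * \<alpha>\<^sup>2 - 1), \<alpha> * f:]" for x y z
    by (simp add: D_pCons S_pCons U2_def f_def algebra_simps eval_nat_numeral)
  have "[:c, b, a:] * D (P 2) = smult (as 2) (S (P 3)) + smult (bs 2) (S (P 2)) + smult (cs 2) X1"
    using structure_rel[of 2] by (simp add: prev_def S_P_1 flip: numeral_2_eq_2)
  then have eq: "[:c, b, a:] * [:- (B 0 + B 1), 2 * \<alpha>:] = smult (as 2)
      [:- B 2 * h + C 2 * B 0 + - (B 0 + B 1 + B 2) * (1 - \<alpha>\<^sup>2), \<alpha> * (h + B 2 * (B 0 + B 1) - C 2) - 3 * \<alpha> * (\<alpha>\<^sup>2 - 1),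
        - (B 0 + B 1 + B 2) * (2 * \<alpha>\<^sup>2 - 1), \<alpha> * f:]
      + smult (bs 2) [:B 0 * B 1 - C 1 + 1 - \<alpha>\<^sup>2, \<alpha> * (- (B 0 + B 1)), 2 * \<alpha>\<^sup>2 - 1:] + smult (cs 2) [:- B 0, \<alpha>:]"
    unfolding P3 P_2 S3 S_2 D_2 X1_def .
  note eqs = arg_cong[OF eq, of "\<lambda>p. coeff p 0"] arg_cong[OF eq, of "\<lambda>p. coeff p 1"]
    arg_cong[OF eq, of "\<lambda>p. coeff p 2"] arg_cong[OF eq, of "\<lambda>p. coeff p 3"]
  have "\<alpha> * (as 2 * f) = \<alpha> * (2 * a)"
    using eqs(4) by (simp add: numeral_3_eq_3 mult_ac)
  then show "as 2 * f = 2 * a" by (metis alpha_nz mult_left_cancel)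
  show "2 * \<alpha> * b - a * (B 0 + B 1) = - as 2 * (2 * \<alpha>\<^sup>2 - 1) * (B 0 + B 1 + B 2) + bs 2 * (2 * \<alpha>\<^sup>2 - 1)"
    using eqs(3) by (simp add: numeral_2_eq_2) algebra
  show "2 * \<alpha> * c - b * (B 0 + B 1) = as 2 * \<alpha> * (h + B 2 * (B 0 + B 1) - C 2 - 3 * (\<alpha>\<^sup>2 - 1))
      - bs 2 * \<alpha> * (B 0 + B 1) + cs 2 * \<alpha>"
    using eqs(2) unfolding h_def by simp algebra
  show "- c * (B 0 + B 1) = as 2 * (- B 2 * h + C 2 * B 0 + (B 0 + B 1 + B 2) * (\<alpha>\<^sup>2 - 1))
      + bs 2 * (h + 1 - \<alpha>\<^sup>2) - cs 2 * B 0"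
    using eqs(1) unfolding h_def by simp algebra
qed

text \<open>The left-hand side is \<open>Z X + 2 (4 \<alpha>\<^sup>2 - 1) Y\<close>, where \<open>X\<close> and \<open>Y\<close> are the two expressions of
  condition (ii); all but the factor \<open>a\<close> on the right comes from the constant term of the structure
  relation for \<^term>\<open>P 2\<close>.\<close>

lemma condition_ii_identity:
  defines "f \<equiv> 4 * \<alpha>\<^sup>2 - 3" and "A2 \<equiv> 2 * \<alpha>\<^sup>2 - 1" and "G3 \<equiv> 4 * \<alpha>\<^sup>2 - 1"
  assumes Y: "2 * Y = 2 * (a * (B 2 + B 1) + b / \<alpha>) * C 2 - (cs 2 + 2 * a * C 2) * (B 1 - B 0)"
  shows "f * A2 * \<alpha> * (Z * (bs 2 + 2 * a * B 2 + b / \<alpha>) + G3 * (2 * Y))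
    = a * A2 * \<alpha> * ((8 * B 2 * \<alpha>\<^sup>2 - 2 * B 0 - 2 * B 1 - 4 * B 2) * (Z + G3 * (1 - t) * C 2) + C 2 * (2 * G3) * R)"
proof -
  define h where "h = B 0 * B 1 - C 1"
  define s1 where "s1 = B 0 + B 1"
  note str = structure_2[folded f_def A2_def h_def s1_def]
  \<comment> \<open>\<open>bsf\<close> and \<open>csf\<close> are \<open>bs 2\<close> and
    \<open>cs 2\<close> cleared of the denominators f, A2 and \<alpha>.\<close>
  define bsf where "bsf = f * (2 * \<alpha> * b - a * s1) + 2 * a * A2 * (s1 + B 2)"
  define csf where "csf = f * A2 * (2 * \<alpha> * c - b * s1) - 2 * a * A2 * \<alpha> * (h + B 2 * s1 - C 2 - 3 * (\<alpha>\<^sup>2 - 1)) + \<alpha> * s1 * bsf"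
  have bs: "f * A2 * bs 2 = bsf"
    unfolding bsf_def using str(1,2) by algebra
  have cs: "f * A2 * \<alpha> * cs 2 = csf"
  proof -
    have "f * A2 * \<alpha> * cs 2 = f * A2 * (cs 2 * \<alpha>)" by simp
    also have "cs 2 * \<alpha> = 2 * \<alpha> * c - b * s1 - as 2 * \<alpha> * (h + B 2 * s1 - C 2 - 3 * (\<alpha>\<^sup>2 - 1)) + bs 2 * \<alpha> * s1"
      using str(3) by algebra
    also have "f * A2 * \<dots> = f * A2 * (2 * \<alpha> * c - b * s1)
        - (as 2 * f) * A2 * \<alpha> * (h + B 2 * s1 - C 2 - 3 * (\<alpha>\<^sup>2 - 1)) + \<alpha> * s1 * (f * A2 * bs 2)"
      by (simp add: algebra_simps)
    finally show ?thesis unfolding csf_def bs str(1) .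
  qed
  \<comment> \<open>The constant-term equation after elimination of \<open>as 2\<close>,
    \<open>bs 2\<close> and \<open>cs 2\<close>.\<close>
  define E where "E = \<alpha> * (f * A2 * c * s1 + 2 * a * A2 * (- B 2 * h + C 2 * B 0 + (s1 + B 2) * (\<alpha>\<^sup>2 - 1)) + bsf * (h + 1 - \<alpha>\<^sup>2)) - csf * B 0"
  have E: "E = 0"
  proof -
    have "E = \<alpha> * (f * A2) * (c * s1 + as 2 * (- B 2 * h + C 2 * B 0 + (s1 + B 2) * (\<alpha>\<^sup>2 - 1)) + bs 2 * (h + 1 - \<alpha>\<^sup>2) - cs 2 * B 0)"
      unfolding E_def bs[symmetric] cs[symmetric] using str(1) by algebra
    also have "c * s1 + as 2 * (- B 2 * h + C 2 * B 0 + (s1 + B 2) * (\<alpha>\<^sup>2 - 1)) + bs 2 * (h + 1 - \<alpha>\<^sup>2) - cs 2 * B 0 = 0"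
      using str(4) by algebra
    finally show ?thesis by simp
  qed
  define \<beta> where "\<beta> = b / \<alpha>"
  have \<beta>: "b = \<alpha> * \<beta>" by (simp add: \<beta>_def)
  have "f * A2 * \<alpha> * (Z * (bs 2 + 2 * a * B 2 + \<beta>) + G3 * (2 * Y))
    = Z * (\<alpha> * (f * A2 * bs 2) + f * A2 * \<alpha> * (2 * a * B 2 + \<beta>))
      + G3 * (2 * f * A2 * \<alpha> * (a * (B 2 + B 1) + \<beta>) * C 2 - (f * A2 * \<alpha> * cs 2 + 2 * f * A2 * \<alpha> * a * C 2) * (B 1 - B 0))"
    unfolding Y \<beta>_def[symmetric] by algebra
  also have "\<dots> = a * A2 * \<alpha> * ((8 * B 2 * \<alpha>\<^sup>2 - 2 * B 0 - 2 * B 1 - 4 * B 2) * (Z + G3 * (1 - t) * C 2) + C 2 * (2 * G3) * R)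
      - 2 * G3 * E"
    unfolding bs cs unfolding E_def csf_def bsf_def \<beta> Z_def R_def f_def A2_def G3_def h_def s1_def by algebra
  finally show ?thesis unfolding E \<beta>_def by simp
qed

text \<open>Since 2 a C_3 = r_3 (1 - t), the factor r_3 divides out of both conditions. The first
  becomes the claim on \<open>Z\<close>, the second (1 - t) C_2 X = 2 Y. Together they make Z X + 2
  (4 \<alpha>^2 - 1) Y vanish, and the preceding identity reduces this to \<open>R\<close> =
  0.\<close>

lemma Z_R:
  assumes i: "(4 * \<alpha>\<^sup>2 - 1) * a * C 2 * C 3 + (cs 3 + 2 * a * C 3) / 2 * Z = 0"
    and ii: "a * C 2 * C 3 * (bs 2 + 2 * a * B 2 + b / \<alpha>) - (cs 3 + 2 * a * C 3)
      * (a * (B 2 + B 1) * C 2 + b / \<alpha> * C 2 - (cs 2 + 2 * a * C 2) / 2 * (B 1 - B 0)) = 0"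
  shows "Z + (4 * \<alpha>\<^sup>2 - 1) * (1 - t) * C 2 = 0" "R = 0"
proof -
  define r3 where "r3 = cs 3 + 2 * a * C 3"
  define X where "X = bs 2 + 2 * a * B 2 + b / \<alpha>"
  define Y where "Y = a * (B 2 + B 1) * C 2 + b / \<alpha> * C 2 - (cs 2 + 2 * a * C 2) / 2 * (B 1 - B 0)"
  have r3: "r3 \<noteq> 0" "2 * a * C 3 = r3 * (1 - t)"
    using r3_nz t_eq by (simp_all add: r3_def)
  have "r3 * (Z + (4 * \<alpha>\<^sup>2 - 1) * (1 - t) * C 2) = 0"
    using i r3(2) unfolding r3_def[symmetric] by algebra
  then show Z: "Z + (4 * \<alpha>\<^sup>2 - 1) * (1 - t) * C 2 = 0" using r3(1) by simp
  have "r3 * ((1 - t) * C 2 * X - 2 * Y) = 0"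
    using ii r3(2) unfolding r3_def[symmetric] X_def[symmetric] Y_def[symmetric] by algebra
  then have XY: "(1 - t) * C 2 * X = 2 * Y" using r3(1) by simp
  have "Z * X + (4 * \<alpha>\<^sup>2 - 1) * (2 * Y) = 0" using Z XY by algebra
  moreover have "2 * Y = 2 * (a * (B 2 + B 1) + b / \<alpha>) * C 2 - (cs 2 + 2 * a * C 2) * (B 1 - B 0)"
  proof -
    have "2 * (m * n + k * n - x / 2 * y) = 2 * (m + k) * n - x * y" for m n k x y :: complex
      by (simp add: algebra_simps)
    then show ?thesis unfolding Y_def .
  qed
  ultimately have "a * (2 * \<alpha>\<^sup>2 - 1) * \<alpha> * (C 2 * (2 * (4 * \<alpha>\<^sup>2 - 1)) * R) = 0"
    using condition_ii_identity[of Y] Z unfolding X_def by (simp only:) simp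
  moreover have "2 * \<alpha>\<^sup>2 - 1 \<noteq> 0" "4 * \<alpha>\<^sup>2 - 1 \<noteq> 0"
    using A_nz[of 2] G_nz[of 3] by (simp_all only: A_2 G_3) simp_all
  ultimately show "R = 0" using a_nz C_nz[of 1] by (simp add: numeral_2_eq_2)
qed

text \<open>D D maps z^2, z^3, z^4 to polynomials of degrees exactly 0, 1, 2. The three tests thus
  give v (F g) = 0 up to degree 2, which reaches \<open>degree F\<close>, the bound that
  \<open>vanish_multiples\<close> asks for.\<close>

lemma Pearson_L:
  assumes "Z + (4 * \<alpha>\<^sup>2 - 1) * (1 - t) * C 2 = 0" "R = 0"
  shows "L (phi * D f + P 1 * S f) = 0"
proof -
  obtain F where F: "degree F \<le> 2" "\<And>f. 2 * \<alpha> * kap * L (phi * D f + P 1 * S f) = v (F * D (D f))"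
    using L_phi by blast
  have E: "kap * Epol f = v (F * D (D f))" for f
    using F(2)[of f] by (simp add: Epol_def mult_ac)
  have E0: "Epol [:0, 0, 1:] = 0" "Epol [:0, 0, 0, 1:] = 0" "Epol [:0, 0, 0, 0, 1:] = 0"
    using Epol_2 Epol_3 Epol_4 assms by simp_all
  have DD: "D (D [:0, 0, 1:]) = [:2 * \<alpha>:]" "D (D [:0, 0, 0, 1:]) = [:0, 2 * \<alpha> * (4 * \<alpha>\<^sup>2 - 1):]"
    "D (D [:0, 0, 0, 0, 1:]) = [:- 4 * \<alpha> * (\<alpha>\<^sup>2 - 1) + (8 * \<alpha> ^ 3 - 4 * \<alpha>) * (1 - \<alpha>\<^sup>2), 0,
      (4 * \<alpha>\<^sup>2 - 1) * (8 * \<alpha> ^ 3 - 4 * \<alpha>):]"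
    unfolding D_S_powers by (simp_all add: D_pCons S_pCons U2_def algebra_simps eval_nat_numeral)
  have G3: "4 * \<alpha>\<^sup>2 - 1 \<noteq> 0" using G_nz[of 3] by (simp only: G_3)
  have G4: "8 * \<alpha> ^ 3 - 4 * \<alpha> \<noteq> 0"
    using G_nz[of 4] by (simp add: eval_nat_numeral G_Suc A_Suc A_1 algebra_simps)
  define w0 w1 w2 where "w0 = v (F * [:1:])" and "w1 = v (F * [:0, 1:])" and "w2 = v (F * [:0, 0, 1:])"
  have vF: "v (F * [:x, y, z:]) = x * w0 + y * w1 + z * w2" for x y z
  proof -
    have "F * [:x, y, z:] = smult x (F * [:1:]) + smult y (F * [:0, 1:]) + smult z (F * [:0, 0, 1:])"
      by (simp add: algebra_simps)
    then show ?thesis unfolding w0_def w1_def w2_def by (simp only: v.v_add v.v_smult)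
  qed
  have "v (F * [:2 * \<alpha>, 0, 0:]) = 0" "v (F * [:0, 2 * \<alpha> * (4 * \<alpha>\<^sup>2 - 1), 0:]) = 0"
    using E[of "[:0, 0, 1:]"] E[of "[:0, 0, 0, 1:]"] E0 DD by simp_all
  then have w: "w0 = 0" "w1 = 0" unfolding vF using G3 by simp_all
  have "(4 * \<alpha>\<^sup>2 - 1) * (8 * \<alpha> ^ 3 - 4 * \<alpha>) * w2 = 0"
    using E[of "[:0, 0, 0, 0, 1:]"] E0(3) unfolding DD vF by (simp add: w)
  then have w2: "w2 = 0" using G3 G4 by simp
  moreover have "v (F * g) = 0" if "degree g \<le> 2" for g
  proof -
    have "g = [:coeff g 0, coeff g 1, coeff g 2:]"
      using that by (intro poly_eqI) (auto simp: coeff_pCons coeff_eq_0 numeral_2_eq_2 split: nat.split)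
    then have "v (F * g) = coeff g 0 * w0 + coeff g 1 * w1 + coeff g 2 * w2" using vF by metis
    then show ?thesis using w w2 by simp
  qed
  ultimately have "v (F * g) = 0" for g
    using v.vanish_multiples[of F] F(1) by (meson order_trans)
  then have "2 * \<alpha> * kap * L (phi * D f + P 1 * S f) = 0" using F(2) by simp
  then show ?thesis using kap_nz by simp
qed

end

section \<open>The second-order equation\<close>

locale aw_classical = aw_ops q L P B C \<kappa>
  for q :: real and L :: "complex poly \<Rightarrow> complex" and P :: "nat \<Rightarrow> complex poly"
    and B C \<kappa> :: "nat \<Rightarrow> complex" +
  fixes fa fb fc :: complex
  assumes pearson_L: "L ([:fc, fb, fa:] * D f + P 1 * S f) = 0"
begin

sublocale L: pearson q L "[:fc, fb, fa:]" "P 1"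
proof unfold_locales
  show "L 1 \<noteq> 0" using L_1 kappa_nz by simp
  show "(\<And>g. L (Q * g) = 0) \<Longrightarrow> Q = 0" for Q by (rule L_torsion_free)
qed (use lead_P[of 1] pearson_L in simp_all)

lemma L_d: "L.d n = fa * G n + A n"
  unfolding L.d_def using lead_P[of 1] by (simp add: numeral_2_eq_2)

definition Lop :: "complex poly \<Rightarrow> complex poly" where
  "Lop f = [:fc, fb, fa:] * D (D f) + P 1 * S (D f)"

text \<open>The Casorati-type expression f = D p S g - S p D g satisfies D f = g D D p - p D D g and
  S f = g S D p - p S D g, by the product and commutation rules. Hence g \<open>Lop\<close> p - p
  \<open>Lop\<close> g is the Pearson expression of f.\<close>

lemma Lop_symmetric: "L (g * Lop p) = L (p * Lop g)"
proof -
  define f where "f = D p * S g - S p * D g"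
  have "x1 * (g + U1 * y1 + K * U2 * y2) + z1 * (K * y1 + U1 * y2) - ((K * z1 + U1 * x1) * y1 + (p + U1 * z1 + K * U2 * x1) * y2)
      = g * x1 - p * y2" for x1 y1 y2 z1 K :: "complex poly" by algebra
  from this[of "D (D p)" "S (D g)" "[:\<alpha>:]" "D (D g)" "S (D p)"]
  have Df: "D f = g * D (D p) - p * D (D g)"
    unfolding f_def D_diff D_mult D_S S_S .
  have "z1 * (g + U1 * y1 + K * U2 * y2) + U2 * x1 * (K * y1 + U1 * y2)
      - ((p + U1 * z1 + K * U2 * x1) * y1 + U2 * (K * z1 + U1 * x1) * y2)
      = g * z1 - p * y1" for x1 y1 y2 z1 K :: "complex poly" by algebra
  from this[of "S (D p)" "S (D g)" "[:\<alpha>:]" "D (D g)" "D (D p)"]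
  have Sf: "S f = g * S (D p) - p * S (D g)"
    unfolding f_def S_diff S_mult D_S S_S .
  have "g * Lop p - p * Lop g = [:fc, fb, fa:] * D f + P 1 * S f"
  proof -
    have "g * (F * x + H * y) - p * (F * x' + H * y') = F * (g * x - p * x') + H * (g * y - p * y')"
      for F H x y x' y' :: "complex poly" by algebra
    then show ?thesis unfolding Lop_def Df Sf .
  qed
  then have "L (g * Lop p - p * Lop g) = 0" using pearson_L by simp
  then show ?thesis by (simp add: v_diff)
qed

lemma Lop_top:
  assumes "degree f \<le> Suc n"
  shows "degree (Lop f) \<le> Suc n" "coeff (Lop f) (Suc n) = G (Suc n) * (fa * G n + A n) * coeff f (Suc n)"
proof -
  have dD: "degree (D f) \<le> n" using degree_D_le[of f] assms by linarith
  have "Lop f = L.Gp (D f)" unfolding Lop_def L.Gp_def ..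
  then show "degree (Lop f) \<le> Suc n" "coeff (Lop f) (Suc n) = G (Suc n) * (fa * G n + A n) * coeff f (Suc n)"
    using L.Gp_top[OF dD, unfolded L_d] coeff_D_top[OF assms] by simp_all
qed

text \<open>\<open>Lop\<close> does not raise degrees, so by symmetry \<open>Lop\<close> P_(n+1) is
  orthogonal to all lower degrees. A nonzero remainder r would contradict this when tested against
  the P_m of its own degree.\<close>

lemma Lop_P: "Lop (P (Suc n)) = smult (G (Suc n) * (fa * G n + A n)) (P (Suc n))"
proof (rule ccontr)
  define r where "r = Lop (P (Suc n)) - smult (G (Suc n) * (fa * G n + A n)) (P (Suc n))"
  assume "Lop (P (Suc n)) \<noteq> smult (G (Suc n) * (fa * G n + A n)) (P (Suc n))"
  then have r0: "r \<noteq> 0" by (simp add: r_def)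
  have "degree r \<le> Suc n" unfolding r_def
    using Lop_top(1)[of "P (Suc n)" n] by (intro degree_diff_le) (auto intro: order.trans[OF degree_smult_le])
  moreover have "coeff r (Suc n) = 0"
    using Lop_top(2)[of "P (Suc n)" n] by (simp add: r_def)
  ultimately have dr: "degree r < Suc n"
    using r0 by (metis leading_coeff_0_iff le_neq_implies_less)
  define m where "m = degree r"
  have "degree (Lop (P m)) < Suc n"
  proof (cases m)
    case (Suc k)
    then show ?thesis using Lop_top(1)[of "P m" k] dr by (simp add: m_def)
  qed (simp add: Lop_def)
  then have "L (P m * Lop (P (Suc n))) = 0"
    using L_P_below[of "Lop (P m)" "Suc n"] by (simp add: Lop_symmetric[of "P m"] mult.commute)
  moreover have "L (P m * P (Suc n)) = 0" using dr by (simp add: orth m_def)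
  moreover have "r * P m = P m * Lop (P (Suc n)) - smult (G (Suc n) * (fa * G n + A n)) (P m * P (Suc n))"
    by (simp add: r_def algebra_simps)
  ultimately have "L (r * P m) = 0" by (simp add: v_diff v_smult)
  then have "coeff r m * \<kappa> m = 0" using L_P_top[of r m] by (simp add: m_def)
  then show False using r0 kappa_nz by (simp add: m_def)
qed

end

section \<open>The top three coefficients of the eigenfunctions\<close>

context askey_wilson_base
begin

text \<open>Integer indices, because comparing coefficients at degree n reaches down to index n - 3,
  which may be negative.\<close>

definition Az :: "int \<Rightarrow> complex" where "Az i = (u powi i + inverse u powi i) / 2"
definition Gz :: "int \<Rightarrow> complex" where "Gz i = (u powi i - inverse u powi i) / (u - inverse u)"

lemma Az_Gz_0 [simp]: "Az 0 = 1" "Gz 0 = 0"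
  by (simp_all add: Az_def Gz_def)

lemma Az_add_1: "Az (i + 1) = \<alpha> * Az i + (\<alpha>\<^sup>2 - 1) * Gz i"
  and Gz_add_1: "Gz (i + 1) = \<alpha> * Gz i + Az i"
proof -
  have p: "u powi (i + 1) = u powi i * u" "inverse u powi (i + 1) = inverse u powi i * inverse u"
    by (simp_all add: power_int_add)
  have two_Az: "2 * Az j = u powi j + inverse u powi j" and Gz_mult: "(u - inverse u) * Gz j = u powi j - inverse u powi j" for j
    by (simp_all add: Az_def Gz_def)
  have "4 * a' = 4 * (al * a + (al\<^sup>2 - 1) * g)"
    if "2 * a = x + y" "2 * a' = x * v + y * w" "(v - w) * g = x - y" "2 * al = v + w"
      "4 * (al\<^sup>2 - 1) = (v - w)\<^sup>2" for a a' al g x y v w :: complex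
    using that by algebra
  from this[OF two_Az[of i] two_Az[of "i + 1", unfolded p] Gz_mult two_alpha four_alpha_sq_sub_1]
  show "Az (i + 1) = \<alpha> * Az i + (\<alpha>\<^sup>2 - 1) * Gz i" by (metis mult_left_cancel zero_neq_numeral)
  have "2 * (v - w) * g' = 2 * (v - w) * (al * g + a)"
    if "2 * a = x + y" "(v - w) * g = x - y" "(v - w) * g' = x * v - y * w" "2 * al = v + w"
    for a al g g' x y v w :: complex
    using that by algebra
  from this[OF two_Az Gz_mult[of i] Gz_mult[of "i + 1", unfolded p] two_alpha]
  show "Gz (i + 1) = \<alpha> * Gz i + Az i" by simp
qed

lemma Az_nat: "Az (int n) = A n" and Gz_nat: "Gz (int n) = G n"
  by (simp_all add: Az_def Gz_def A_def G_def)

text \<open>With value 0 at negative indices, multiplication by z is a plain shift of the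
  index.\<close>

definition cf :: "complex poly \<Rightarrow> int \<Rightarrow> complex" where
  "cf f i = (if i < 0 then 0 else coeff f (nat i))"

lemma cf_add: "cf (f + g) i = cf f i + cf g i" and cf_diff: "cf (f - g) i = cf f i - cf g i"
  and cf_smult: "cf (smult x f) i = x * cf f i" and cf_0 [simp]: "cf 0 i = 0"
  and cf_pCons: "cf (pCons x f) i = (if i = 0 then x else 0) + cf f (i - 1)"
  and cf_int [simp]: "cf f (int n) = coeff f n"
  by (auto simp: cf_def coeff_pCons nat_diff_distrib split: nat.split) 

lemma cf_above: "int (degree f) < i \<Longrightarrow> cf f i = 0"
  by (auto simp: cf_def intro!: coeff_eq_0)

text \<open>The three leading coefficients in the normalisation of the Chebyshev expansion, on which
  \<^const>\<open>aw_S\<close> acts diagonally and \<^const>\<open>aw_D\<close> by a triangular matrix.\<close>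

lemma cf_S_D:
  "int (degree f) \<le> n \<Longrightarrow> cf (S f) n = Az n * cf f n \<and> cf (S f) (n - 1) = Az (n - 1) * cf f (n - 1)
    \<and> 4 * cf (S f) (n - 2) + of_int n * cf (S f) n = Az (n - 2) * (4 * cf f (n - 2) + of_int n * cf f n)
    \<and> cf (D f) n = 0 \<and> cf (D f) (n - 1) = Gz n * cf f n \<and> cf (D f) (n - 2) = Gz (n - 1) * cf f (n - 1)
    \<and> 4 * cf (D f) (n - 3) + of_int (n - 1) * cf (D f) (n - 1)
        = Gz (n - 2) * (4 * cf f (n - 2) + of_int n * cf f n) + Gz n * cf f n"
proof (induction f arbitrary: n)
  case 0
  show ?case by simp
next
  case (pCons c f)
  show ?case
  proof (cases "n = 0")
    case True
    then have "degree (pCons c f) = 0" using pCons.prems by simp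
    then have "f = 0" by (simp add: degree_pCons_eq_if split: if_splits)
    then show ?thesis using True by (simp add: cf_def)
  next
    case False
    define m where "m = n - 1"
    have df: "int (degree f) \<le> m"
      using pCons.prems False by (auto simp: m_def degree_pCons_eq_if split: if_splits)
    note IH = pCons.IH[OF df]
    have n: "n = m + 1" "m + 1 - 1 = m" "m + 1 - 2 = m - 1" "m + 1 - 3 = m - 2" "m - 1 - 1 = m - 2"
      "m - 2 - 1 = m - 3" "m - 1 - 2 = m - 3" by (simp_all add: m_def)
    have D: "cf (D (pCons c f)) i = \<alpha> * cf (D f) (i - 1) + cf (S f) i" for i
      by (simp add: D_pCons cf_add cf_pCons cf_smult)
    have U2: "U2 * h = smult (\<alpha>\<^sup>2 - 1) (pCons 0 (pCons 0 h) - h)" for h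
    proof -
      have "U2 * h = smult (1 - \<alpha>\<^sup>2) h + pCons 0 (pCons 0 (smult (\<alpha>\<^sup>2 - 1) h))" by (simp add: U2_def)
      then show ?thesis
        by (intro poly_eqI) (auto simp: coeff_pCons algebra_simps split: nat.split)
    qed
    have S: "cf (S (pCons c f)) i = (if i = 0 then c else 0) + \<alpha> * cf (S f) (i - 1) + (\<alpha>\<^sup>2 - 1) * (cf (D f) (i - 2) - cf (D f) i)" for i
      by (simp add: S_pCons cf_add cf_pCons cf_smult U2 cf_diff)
    have f: "cf (pCons c f) i = (if i = 0 then c else 0) + cf f (i - 1)" for i by (simp add: cf_pCons)
    have D0: "cf (D f) (m + 1) = 0" "cf (D f) m = 0"
      using IH degree_D_le[of f] df by (auto intro: cf_above)
    have AG: "Az (m + 1) = \<alpha> * Az m + (\<alpha>\<^sup>2 - 1) * Gz m" "Gz (m + 1) = \<alpha> * Gz m + Az m"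
      "Az m = \<alpha> * Az (m - 1) + (\<alpha>\<^sup>2 - 1) * Gz (m - 1)" "Gz m = \<alpha> * Gz (m - 1) + Az (m - 1)"
      "Az (m - 1) = \<alpha> * Az (m - 2) + (\<alpha>\<^sup>2 - 1) * Gz (m - 2)" "Gz (m - 1) = \<alpha> * Gz (m - 2) + Az (m - 2)"
      using Az_add_1[of m] Gz_add_1[of m] Az_add_1[of "m - 1"] Gz_add_1[of "m - 1"] Az_add_1[of "m - 2"] Gz_add_1[of "m - 2"]
      by simp_all
    have S0: "cf (S f) (m + 1) = 0" using df by (auto intro: cf_above)
    have m0: "m + 1 \<noteq> 0" using df by simp
    have of_m: "of_int (m + 1) = of_int m + (1 :: complex)" "of_int (m - 1) = of_int m - (1 :: complex)" by simp_all
    consider "m = 0" | "m = 1" | "m \<noteq> 0" "m \<noteq> 1" by blast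
    \<comment> \<open>The new constant term interferes only at m = 0 and m = 1, where
      \<open>Az 0\<close> = 1 and \<open>Gz 0\<close> = 0 absorb it.\<close>
    then have c: "(if m = 0 then c else 0) = Az m * (if m = 0 then c else 0)"
      "(if m = 0 then c else 0) = Gz m * 0 + (if m = 0 then c else 0)"
      "(if m - 1 = 0 then c else 0) = Az (m - 1) * (if m - 1 = 0 then c else 0)"
      "Gz m * (if m = 0 then c else 0) = 0" "Gz (m - 1) * (if m - 1 = 0 then c else 0) = 0"
      by cases auto
    define c0 c1 where "c0 = (if m = 0 then c else 0)" and "c1 = (if m - 1 = 0 then c else 0)"
    note c = c[folded c0_def c1_def]
    define W where "W = 4 * cf f (m - 2) + of_int m * cf f m"
    define N :: complex where "N = of_int m"
    from IH have sx: "cf (S f) m = Az m * cf f m" and sy: "cf (S f) (m - 1) = Az (m - 1) * cf f (m - 1)"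
      and dx: "cf (D f) (m - 1) = Gz m * cf f m" and dy: "cf (D f) (m - 2) = Gz (m - 1) * cf f (m - 1)"
      and sw: "4 * cf (S f) (m - 2) = Az (m - 2) * W - N * (Az m * cf f m)"
      and dw: "4 * cf (D f) (m - 3) = Gz (m - 2) * W + Gz m * cf f m - (N - 1) * (Gz m * cf f m)"
      unfolding W_def N_def by (auto simp: algebra_simps)
    have W: "4 * (c1 + cf f (m - 2)) + (N + 1) * cf f m = 4 * c1 + W + cf f m"
      by (simp add: W_def N_def algebra_simps)
    have AG': "Az (m - 1) = \<alpha> * Az m - (\<alpha>\<^sup>2 - 1) * Gz m" "Gz (m - 1) = \<alpha> * Gz m - Az m"
      using AG(3,4) by algebra+
    have S3: "4 * (c1 + \<alpha> * cf (S f) (m - 2) + (\<alpha>\<^sup>2 - 1) * (cf (D f) (m - 3) - cf (D f) (m - 1)))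
        + (N + 1) * (0 + \<alpha> * cf (S f) m + (\<alpha>\<^sup>2 - 1) * (cf (D f) (m - 1) - cf (D f) (m + 1)))
        = Az (m - 1) * (4 * (c1 + cf f (m - 2)) + (N + 1) * (0 + cf f m))"
    proof -
      have "4 * (c1 + \<alpha> * cf (S f) (m - 2) + (\<alpha>\<^sup>2 - 1) * (cf (D f) (m - 3) - cf (D f) (m - 1)))
        + (N + 1) * (0 + \<alpha> * cf (S f) m + (\<alpha>\<^sup>2 - 1) * (cf (D f) (m - 1) - cf (D f) (m + 1)))
        = 4 * c1 + \<alpha> * (4 * cf (S f) (m - 2)) + (\<alpha>\<^sup>2 - 1) * (4 * cf (D f) (m - 3)) - 4 * (\<alpha>\<^sup>2 - 1) * cf (D f) (m - 1)
          + (N + 1) * (\<alpha> * cf (S f) m + (\<alpha>\<^sup>2 - 1) * cf (D f) (m - 1))"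
        unfolding D0 by (simp add: algebra_simps)
      also have "\<dots> = 4 * c1 + (\<alpha> * Az (m - 2) + (\<alpha>\<^sup>2 - 1) * Gz (m - 2)) * W
          + (\<alpha> * Az m - (\<alpha>\<^sup>2 - 1) * Gz m) * cf f m"
        unfolding sx dx sw dw by (simp add: algebra_simps)
      finally show ?thesis
        unfolding add_0 W AG(5)[symmetric] AG'(1)[symmetric] using c(3) by (simp add: algebra_simps)
    qed
    \<comment> \<open>The additional last term arises because D sends the monic Chebyshev polynomial
      T_n to \<gamma>_n times the monic U_(n-1), whose expansion in monic T_k begins with T_(n-1) +
      T_(n-3) / 4.\<close>
    have D3: "4 * (\<alpha> * cf (D f) (m - 3) + cf (S f) (m - 2)) + N * (\<alpha> * cf (D f) (m - 1) + cf (S f) m)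
        = Gz (m - 1) * (4 * (c1 + cf f (m - 2)) + (N + 1) * (0 + cf f m)) + Gz (m + 1) * (0 + cf f m)"
    proof -
      have "4 * (\<alpha> * cf (D f) (m - 3) + cf (S f) (m - 2)) + N * (\<alpha> * cf (D f) (m - 1) + cf (S f) m)
        = \<alpha> * (4 * cf (D f) (m - 3)) + 4 * cf (S f) (m - 2) + N * (\<alpha> * cf (D f) (m - 1) + cf (S f) m)"
        by (simp add: algebra_simps)
      also have "\<dots> = (\<alpha> * Gz (m - 2) + Az (m - 2)) * W + (\<alpha> * Gz m - Az m) * cf f m + (\<alpha> * Gz m + Az m) * cf f m"
        unfolding sx dx sw dw by (simp add: algebra_simps)
      finally show ?thesis
        unfolding add_0 W AG(2) AG(6)[symmetric] AG'(2)[symmetric] using c(5) by (simp add: algebra_simps)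
    qed
    show ?thesis
      unfolding D S f n if_not_P[OF m0] of_m c0_def[symmetric] c1_def[symmetric] N_def[symmetric]
    proof (intro conjI)
      show "0 + \<alpha> * cf (S f) m + (\<alpha>\<^sup>2 - 1) * (cf (D f) (m - 1) - cf (D f) (m + 1)) = Az (m + 1) * (0 + cf f m)"
        unfolding sx dx D0 AG(1) by (simp add: algebra_simps)
      show "c0 + \<alpha> * cf (S f) (m - 1) + (\<alpha>\<^sup>2 - 1) * (cf (D f) (m - 2) - cf (D f) m) = Az m * (c0 + cf f (m - 1))"
        unfolding sy dy D0 distrib_left c(1)[symmetric] unfolding AG(3) by (simp add: algebra_simps)
      show "\<alpha> * cf (D f) m + cf (S f) (m + 1) = 0" by (simp add: D0 S0)
      show "\<alpha> * cf (D f) (m - 1) + cf (S f) m = Gz (m + 1) * (0 + cf f m)"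
        unfolding sx dx AG(2) by (simp add: algebra_simps)
      show "\<alpha> * cf (D f) (m - 2) + cf (S f) (m - 1) = Gz m * (c0 + cf f (m - 1))"
        unfolding sy dy distrib_left c(4) unfolding AG(4) by (simp add: algebra_simps)
    qed (rule S3 D3)+
  qed
qed

end

text \<open>Here t stands for q^(n-2), V for u^(-n), d for u - 1/u, and the g's and a's for \<gamma>
  and \<alpha> at n, n-1, n-2, n-3. After multiplication by d^2 the half-integer powers collect into
  a factor V^2 u, which is cancelled, and only q and t remain.\<close>

lemma top_coefficient_conversion:
  fixes u q V t d fa fb fc B0 m0 m1 m2 m3 m4 y W g0 g1 g2 g3 a1 a2 a3 :: complex
  assumes nz: "u \<noteq> 0" "V \<noteq> 0" "d \<noteq> 0" and q: "q = u\<^sup>2" and d: "u * d = q - 1"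
    and g: "d * g0 = V * (q\<^sup>2 * t - 1)" "d * g1 = V * u * (q * t - 1)" "d * g2 = V * q * (t - 1)"
      "d * g3 = V * u * (t - q)"
    and a: "2 * a1 = V * u * (q * t + 1)" "2 * a2 = V * q * (t + 1)" "2 * a3 = V * u * (t + q)"
    and m: "8 * m4 = 2 * fa + d" "8 * m0 = 2 * fa - d" "- 4 * m3 = 2 * fb - B0 * d"
      "- 4 * m1 = 2 * fb + B0 * d" "2 * m2 = 2 * fc + fa"
    and E1: "(g0 * (fa * g1 + a1) - g1 * (fa * g2 + a2)) * y = g0 * (fb * g1 - B0 * a1)"
    and E2: "(g0 * (fa * g1 + a1) - g2 * (fa * g3 + a3)) * W
      = g0 * (fa * (g3 + 3 * g1) + 4 * fc * g1 + a3 + a1) + 4 * y * (g1 * (fb * g2 - B0 * a2))"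
  shows "2 * (q - 1) * (m0 - m4 * (q * t)\<^sup>2) * y = (q * (q * t) - 1) * (m3 * (q * t) - m1)"
    and "(q\<^sup>2 - 1) * (m0 - m4 * q * t\<^sup>2) * W
      = (q\<^sup>2 * t - 1) * ((q + 1) * (m0 - m4 * t) + m2 * (1 - q * t)) + 2 * q * y * (q * t - 1) * (m3 * t - m1)"
proof -
  have "2 * (d * (fa * g1 + a1)) = 2 * (4 * V * u * (m4 * q * t - m0))"
    "2 * (d * (fa * g2 + a2)) = 2 * (4 * V * q * (m4 * t - m0))"
    "2 * (d * (fa * g3 + a3)) = 2 * (4 * V * u * (m4 * t - m0 * q))"
    "2 * (d * (fb * g1 - B0 * a1)) = 2 * (- 2 * V * u * (m3 * q * t - m1))"
    "2 * (d * (fb * g2 - B0 * a2)) = 2 * (- 2 * V * q * (m3 * t - m1))"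
    "2 * (d * (fa * (g3 + 3 * g1) + 4 * fc * g1 + a3 + a1))
      = 2 * (4 * V * u * ((q + 1) * (m4 * t - m0) + m2 * (q * t - 1)))"
    using g a m by algebra+
  then have f: "d * (fa * g1 + a1) = 4 * V * u * (m4 * q * t - m0)"
    "d * (fa * g2 + a2) = 4 * V * q * (m4 * t - m0)"
    "d * (fa * g3 + a3) = 4 * V * u * (m4 * t - m0 * q)"
    "d * (fb * g1 - B0 * a1) = - 2 * V * u * (m3 * q * t - m1)"
    "d * (fb * g2 - B0 * a2) = - 2 * V * q * (m3 * t - m1)"
    "d * (fa * (g3 + 3 * g1) + 4 * fc * g1 + a3 + a1) = 4 * V * u * ((q + 1) * (m4 * t - m0) + m2 * (q * t - 1))"
    by (metis mult_left_cancel zero_neq_numeral)+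
  have "((d * g0) * (d * (fa * g1 + a1)) - (d * g1) * (d * (fa * g2 + a2))) * y = (d * g0) * (d * (fb * g1 - B0 * a1))"
    using E1 by algebra
  then have "V\<^sup>2 * u * 2 * (2 * (q - 1) * (m0 - m4 * (q * t)\<^sup>2) * y)
      = V\<^sup>2 * u * 2 * ((q * (q * t) - 1) * (m3 * (q * t) - m1))"
    unfolding f g by algebra
  then show y: "2 * (q - 1) * (m0 - m4 * (q * t)\<^sup>2) * y = (q * (q * t) - 1) * (m3 * (q * t) - m1)"
    using nz by simp
  have "((d * g0) * (d * (fa * g1 + a1)) - (d * g2) * (d * (fa * g3 + a3))) * W
      = (d * g0) * (d * (fa * (g3 + 3 * g1) + 4 * fc * g1 + a3 + a1)) + 4 * y * ((d * g1) * (d * (fb * g2 - B0 * a2)))"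
    using E2 by algebra
  then have "V\<^sup>2 * u * 4 * ((q\<^sup>2 - 1) * (m0 - m4 * q * t\<^sup>2) * W)
      = V\<^sup>2 * u * 4 * ((q\<^sup>2 * t - 1) * ((q + 1) * (m0 - m4 * t) + m2 * (1 - q * t)) + 2 * q * y * (q * t - 1) * (m3 * t - m1))"
    unfolding f g by algebra
  then show "(q\<^sup>2 - 1) * (m0 - m4 * q * t\<^sup>2) * W
      = (q\<^sup>2 * t - 1) * ((q + 1) * (m0 - m4 * t) + m2 * (1 - q * t)) + 2 * q * y * (q * t - 1) * (m3 * t - m1)"
    using nz by simp
qed

context aw_classical
begin

text \<open>The subleading coefficient. \<open>W n\<close> is four times the coefficient of P_n at
  the monic Chebyshev polynomial of degree n - 2.\<close>

definition y :: "nat \<Rightarrow> complex" where "y n = cf (P n) (int n - 1)"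
definition W :: "nat \<Rightarrow> complex" where "W n = 4 * cf (P n) (int n - 2) + of_nat n"

lemma y_W_0: "y 0 = 0" "W 0 = 0" "W (Suc 0) = 1"
  by (simp_all add: y_def W_def cf_def)

lemma y_W_Suc: "y (Suc n) = y n - B n" "W (Suc (Suc n)) = W (Suc n) + 1 - 4 * (B (Suc n) * y (Suc n) + C (Suc n))"
proof -
  have cfP: "cf (P (Suc n)) i = cf (P n) (i - 1) - B n * cf (P n) i - C n * cf (prev P n) i" for n i
    by (simp add: P_Suc cf_add cf_diff cf_smult cf_pCons)
  have "cf (prev P n) (int n) = 0"
    by (cases n) (auto simp: prev_def cf_def intro!: coeff_eq_0)
  then show "y (Suc n) = y n - B n"
    unfolding y_def cfP by simp
  have "cf (prev P (Suc n)) (int n) = 1" by (simp add: prev_def)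
  then show "W (Suc (Suc n)) = W (Suc n) + 1 - 4 * (B (Suc n) * y (Suc n) + C (Suc n))"
    unfolding y_def W_def cfP[of "Suc n"] by (simp add: algebra_simps)
qed

lemma Lop_P_int: "n \<noteq> 0 \<Longrightarrow> Lop (P n) = smult (Gz (int n) * (fa * Gz (int n - 1) + Az (int n - 1))) (P n)"
  using Lop_P[of "n - 1"] Gz_nat[of n] Gz_nat[of "n - 1"] Az_nat[of "n - 1"] by (simp add: of_nat_diff)

text \<open>Degrees n - 1 and n - 2 of the eigenvalue equation. The second is taken four times and
  rewritten in the Chebyshev normalisation, where terms with an explicit factor n drop out.\<close>

lemma top_equations:
  assumes n: "n \<noteq> 0"
  defines "N \<equiv> int n"
  shows "(Gz N * (fa * Gz (N - 1) + Az (N - 1)) - Gz (N - 1) * (fa * Gz (N - 2) + Az (N - 2))) * y n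
      = Gz N * (fb * Gz (N - 1) - B 0 * Az (N - 1))"
    and "(Gz N * (fa * Gz (N - 1) + Az (N - 1)) - Gz (N - 2) * (fa * Gz (N - 3) + Az (N - 3))) * W n
      = Gz N * (fa * (Gz (N - 3) + 3 * Gz (N - 1)) + 4 * fc * Gz (N - 1) + Az (N - 3) + Az (N - 1))
        + 4 * y n * (Gz (N - 1) * (fb * Gz (N - 2) - B 0 * Az (N - 2)))"
proof -
  define f where "f = D (P n)"
  have df: "int (degree f) \<le> N - 1" using n degree_D_le[of "P n"] by (simp add: f_def N_def)
  have cN: "cf (P n) N = 1" by (simp add: N_def)
  have M: "N - 1 - 1 = N - 2" "N - 1 - 2 = N - 3" "N - 1 - 3 = N - 4" "N - 2 - 1 = N - 3" "N - 2 - 2 = N - 4" by simp_all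
  have PW: "4 * cf (P n) (N - 2) + of_int N * 1 = W n" by (simp add: W_def N_def)
  have dP: "int (degree (P n)) \<le> N" by (simp add: N_def)
  have yn: "cf (P n) (N - 1) = y n" by (simp add: y_def N_def)
  have f1: "cf f (N - 1) = Gz N" "cf f (N - 2) = Gz (N - 1) * y n"
    "4 * cf f (N - 3) + of_int (N - 1) * Gz N = Gz (N - 2) * W n + Gz N"
  proof -
    have c: "cf f (N - 1) = Gz N * 1" "cf f (N - 2) = Gz (N - 1) * y n"
      "4 * cf f (N - 3) + of_int (N - 1) * cf f (N - 1) = Gz (N - 2) * W n + Gz N * 1"
      using cf_S_D[OF dP] unfolding cN PW yn f_def[symmetric] by blast+
    then show "cf f (N - 1) = Gz N" "cf f (N - 2) = Gz (N - 1) * y n"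
      "4 * cf f (N - 3) + of_int (N - 1) * Gz N = Gz (N - 2) * W n + Gz N"
      by (simp_all only: mult_1_right)
  qed
  note f2 = cf_S_D[OF df, unfolded M f1]
  have S1: "cf (S f) (N - 1) = Az (N - 1) * Gz N" and D2: "cf (D f) (N - 2) = Gz (N - 1) * Gz N"
    using f2 by blast+
  have f3: "cf (S f) (N - 1) = Az (N - 1) * Gz N" "cf (S f) (N - 2) = Az (N - 2) * (Gz (N - 1) * y n)"
    "4 * cf (S f) (N - 3) + of_int (N - 1) * (Az (N - 1) * Gz N) = Az (N - 3) * (Gz (N - 2) * W n + Gz N)"
    "cf (D f) (N - 1) = 0" "cf (D f) (N - 2) = Gz (N - 1) * Gz N" "cf (D f) (N - 3) = Gz (N - 2) * (Gz (N - 1) * y n)"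
    "4 * cf (D f) (N - 4) + of_int (N - 2) * (Gz (N - 1) * Gz N) = Gz (N - 3) * (Gz (N - 2) * W n + Gz N) + Gz (N - 1) * Gz N"
    using f2 unfolding S1 D2 by blast+
  have Lcf: "cf (Lop (P n)) i = fc * cf (D f) i + fb * cf (D f) (i - 1) + fa * cf (D f) (i - 2) + cf (S f) (i - 1) - B 0 * cf (S f) i" for i
    unfolding Lop_def f_def[symmetric] by (simp add: P_1 cf_add cf_pCons cf_smult cf_diff)
  have e: "fc * cf (D f) i + fb * cf (D f) (i - 1) + fa * cf (D f) (i - 2) + cf (S f) (i - 1) - B 0 * cf (S f) i
      = Gz N * (fa * Gz (N - 1) + Az (N - 1)) * cf (P n) i" for i
    unfolding Lcf[symmetric] using Lop_P_int[OF n] by (simp add: cf_smult N_def)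
  show "(Gz N * (fa * Gz (N - 1) + Az (N - 1)) - Gz (N - 1) * (fa * Gz (N - 2) + Az (N - 2))) * y n
      = Gz N * (fb * Gz (N - 1) - B 0 * Az (N - 1))"
    using e[of "N - 1", unfolded M f3 yn] by (simp add: algebra_simps)
  have i1: "of_int (N - 1) = of_int N - (1 :: complex)" "of_int (N - 2) = of_int N - (2 :: complex)" by simp_all
  have Wn: "4 * cf (P n) (N - 2) = W n - of_int N" using PW by (simp add: algebra_simps)
  have e4: "4 * cf (D f) (N - 4) = Gz (N - 3) * (Gz (N - 2) * W n + Gz N) + Gz (N - 1) * Gz N - (of_int N - 2) * (Gz (N - 1) * Gz N)"
    "4 * cf (S f) (N - 3) = Az (N - 3) * (Gz (N - 2) * W n + Gz N) - (of_int N - 1) * (Az (N - 1) * Gz N)"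
    using f3(7,3) unfolding i1 by (simp_all add: algebra_simps)
  have "4 * (fc * (Gz (N - 1) * Gz N) + fb * (Gz (N - 2) * (Gz (N - 1) * y n)) - B 0 * (Az (N - 2) * (Gz (N - 1) * y n)))
      + fa * (4 * cf (D f) (N - 4)) + 4 * cf (S f) (N - 3)
      = Gz N * (fa * Gz (N - 1) + Az (N - 1)) * (4 * cf (P n) (N - 2))"
    using arg_cong[OF e[of "N - 2", unfolded M f3], of "\<lambda>x. 4 * x"] by (simp add: algebra_simps)
  then show "(Gz N * (fa * Gz (N - 1) + Az (N - 1)) - Gz (N - 2) * (fa * Gz (N - 3) + Az (N - 3))) * W n
      = Gz N * (fa * (Gz (N - 3) + 3 * Gz (N - 1)) + 4 * fc * Gz (N - 1) + Az (N - 3) + Az (N - 1))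
        + 4 * y n * (Gz (N - 1) * (fb * Gz (N - 2) - B 0 * Az (N - 2)))"
    unfolding e4 Wn by (simp add: algebra_simps)
qed

text \<open>At z = (w + 1/w) / 2 the neighbours satisfy X - Y = (u - 1/u) (w - 1/w) / 2, and m0 - m1
  w + m2 w^2 - m3 w^3 + m4 w^4 is w^2 (\<phi>(z) + \<psi>(z) (X - Y) / 2).\<close>

definition m0 :: complex where "m0 = (2 * fa - (u - inverse u)) / 8"
definition m1 :: complex where "m1 = - (2 * fb + B 0 * (u - inverse u)) / 4"
definition m2 :: complex where "m2 = fc + fa / 2"
definition m3 :: complex where "m3 = - (2 * fb - B 0 * (u - inverse u)) / 4"
definition m4 :: complex where "m4 = (2 * fa + (u - inverse u)) / 8"

lemma y_W_formula:
  assumes n: "n \<noteq> 0"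
  defines "Q \<equiv> of_real q :: complex"
  defines "t \<equiv> Q powi (int n - 2)"
  shows "2 * (Q - 1) * (m0 - m4 * (Q * t)\<^sup>2) * y n = (Q * (Q * t) - 1) * (m3 * (Q * t) - m1)"
    and "(Q\<^sup>2 - 1) * (m0 - m4 * Q * t\<^sup>2) * W n
      = (Q\<^sup>2 * t - 1) * ((Q + 1) * (m0 - m4 * t) + m2 * (1 - Q * t)) + 2 * Q * y n * (Q * t - 1) * (m3 * t - m1)"
proof -
  define N where "N = int n"
  define V where "V = inverse u powi N"
  define d where "d = u - inverse u"
  have q: "Q = u\<^sup>2" by (simp add: Q_def u_sq)
  have UV: "u powi N * V = 1" by (simp add: V_def power_int_inverse)
  have t: "t * u ^ 4 = u powi N * u powi N"
  proof -
    have "t = (u powi 2) powi (N - 2)" by (simp add: t_def q N_def)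
    then have "t = u powi (2 * (N - 2))" by (simp only: power_int_mult)
    then have "t * u ^ 4 = u powi (2 * (N - 2)) * u powi 4" by simp
    also have "\<dots> = u powi (2 * (N - 2) + 4)" by (rule power_int_add[symmetric]) simp
    also have "2 * (N - 2) + 4 = N + N" by simp
    also have "u powi (N + N) = u powi N * u powi N" by (rule power_int_add) simp
    finally show ?thesis .
  qed
  have Ui: "u powi (N - 1) = u powi N * inverse u" "u powi (N - 2) = u powi N * inverse u ^ 2"
    "u powi (N - 3) = u powi N * inverse u ^ 3"
    "inverse u powi (N - 1) = V * u" "inverse u powi (N - 2) = V * u ^ 2" "inverse u powi (N - 3) = V * u ^ 3"
    by (simp_all add: V_def power_int_diff field_simps)
  define U where "U = u powi N"
  note UV = UV[folded U_def] and t = t[folded U_def] and Ui = Ui[folded U_def]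
  have tt: "t * u ^ 3 = U * U * inverse u" "t * u ^ 2 = U * U * inverse u ^ 2" "t * u = U * U * inverse u ^ 3"
    unfolding t[symmetric] by (simp_all add: eval_nat_numeral field_simps)
  have VU: "V * (U * U * x) = U * x" for x
  proof -
    have "V * (U * U * x) = (U * V) * (U * x)" by (simp only: ac_simps)
    then show ?thesis unfolding UV by simp
  qed
  have Gm: "d * Gz i = u powi i - inverse u powi i" and Am: "2 * Az i = u powi i + inverse u powi i" for i
    by (simp_all add: Gz_def Az_def d_def)
  have x: "V * (Q\<^sup>2 * t - 1) = V * (U * U * 1) - V" "V * u * (Q * t - 1) = V * (U * U * inverse u) - V * u"
    "V * u * (Q * t + 1) = V * (U * U * inverse u) + V * u" "V * Q * (t - 1) = V * (U * U * inverse u ^ 2) - V * u ^ 2"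
    "V * Q * (t + 1) = V * (U * U * inverse u ^ 2) + V * u ^ 2" "V * u * (t - Q) = V * (U * U * inverse u ^ 3) - V * u ^ 3"
    "V * u * (t + Q) = V * (U * U * inverse u ^ 3) + V * u ^ 3"
    unfolding tt[symmetric] q mult_1_right t[symmetric] by (simp_all add: algebra_simps eval_nat_numeral)
  have Gs: "d * Gz N = V * (Q\<^sup>2 * t - 1)" "d * Gz (N - 1) = V * u * (Q * t - 1)"
    "d * Gz (N - 2) = V * Q * (t - 1)" "d * Gz (N - 3) = V * u * (t - Q)"
    "2 * Az (N - 1) = V * u * (Q * t + 1)" "2 * Az (N - 2) = V * Q * (t + 1)" "2 * Az (N - 3) = V * u * (t + Q)"
    unfolding x VU Gm Am Ui U_def[symmetric] V_def[symmetric] by simp_all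
  have ud: "u * d = Q - 1" by (simp add: d_def q algebra_simps power2_eq_square)
  have ms: "8 * m4 = 2 * fa + d" "8 * m0 = 2 * fa - d" "- 4 * m3 = 2 * fb - B 0 * d"
    "- 4 * m1 = 2 * fb + B 0 * d" "2 * m2 = 2 * fc + fa"
    by (simp_all add: m0_def m1_def m2_def m3_def m4_def d_def field_simps)
  have nz: "u \<noteq> 0" "V \<noteq> 0" "d \<noteq> 0" by (simp_all add: V_def d_def)
  show "2 * (Q - 1) * (m0 - m4 * (Q * t)\<^sup>2) * y n = (Q * (Q * t) - 1) * (m3 * (Q * t) - m1)"
    and "(Q\<^sup>2 - 1) * (m0 - m4 * Q * t\<^sup>2) * W n
      = (Q\<^sup>2 * t - 1) * ((Q + 1) * (m0 - m4 * t) + m2 * (1 - Q * t)) + 2 * Q * y n * (Q * t - 1) * (m3 * t - m1)"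
    using top_coefficient_conversion[OF nz q ud Gs ms top_equations[OF n, folded N_def]] .
qed

end

section \<open>Comparison with the Askey-Wilson recurrence\<close>

text \<open>The formula for \<eta>_(n+1) with denominators cleared, t being q^(n-1). The bracket on
  the right is the product of all 1 - a_i a_j q t, in the form that \<open>prod_pairs\<close> gives
  it.\<close>

lemma aw_eta_polynomial_identity:
  fixes q t s s1 s2 s3 :: complex
  shows "(1 - s * q\<^sup>2 * t\<^sup>2) * (1 - s * q ^ 3 * t\<^sup>2) * ((q - 1) * (1 - s * q\<^sup>2 * t\<^sup>2)
          * ((q\<^sup>2 * t - 1) * ((q + 1) * (1 - s * t) + s2 * (1 - q * t)))
        + q * ((q\<^sup>2 * t - 1) * (s3 * (q * t) - s1)) * (q * t - 1) * (s3 * t - s1))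
      + (1 - s * q * t\<^sup>2) * (1 - s * q\<^sup>2 * t\<^sup>2) * (((q\<^sup>2 * t - 1) * (s3 * (q * t) - s1)) * ((q ^ 3 * t - 1) * (s3 * (q\<^sup>2 * t) - s1))
        - (q - 1) * (1 - s * q\<^sup>2 * t\<^sup>2) * ((q ^ 3 * t - 1) * ((q + 1) * (1 - s * q * t) + s2 * (1 - q\<^sup>2 * t))))
      + (q - 1) * (q\<^sup>2 - 1) * (1 - s * q * t\<^sup>2) * (1 - s * q\<^sup>2 * t\<^sup>2)\<^sup>2 * (1 - s * q ^ 3 * t\<^sup>2)
      - (q + 1) * (1 - s * q * t\<^sup>2) * (1 - s * q ^ 3 * t\<^sup>2) * ((q\<^sup>2 * t - 1) * (s3 * (q * t) - s1))\<^sup>2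
    = (q - 1) * (q\<^sup>2 - 1) * ((1 - q\<^sup>2 * t) * (1 - s * t)
        * ((1 + s * (q * t)\<^sup>2) ^ 3 - (1 + s * (q * t)\<^sup>2)\<^sup>2 * s2 * (q * t) + (1 + s * (q * t)\<^sup>2) * (q * t)\<^sup>2 * (s1 * s3 - 4 * s)
          - (q * t) ^ 3 * (s3\<^sup>2 + s1\<^sup>2 * s - 4 * s2 * s)))"
  by algebra

text \<open>The formula for \<beta>_n singles out a = a_1; f1, f2, f3 are the elementary symmetric
  functions of the other three parameters. The right side, apart from the factor a, depends on
  symmetric functions of all four.\<close>

lemma aw_beta_polynomial_identity:
  fixes q x a f1 f2 f3 :: complex
  assumes "s = a * f3" "s1 = a + f1" "s3 = a * f2 + f3"
  shows "(q - 1) * ((a\<^sup>2 + 1) * (1 - s * x\<^sup>2) * (1 - s * q * x\<^sup>2) * (1 - s * q\<^sup>2 * x\<^sup>2)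
      - (1 - a * f1 * (q * x) + a\<^sup>2 * f2 * (q * x)\<^sup>2 - a ^ 3 * f3 * (q * x) ^ 3) * (1 - s * x) * (1 - s * x\<^sup>2)
      - a\<^sup>2 * (1 - q * x) * (1 - f2 * x + f1 * f3 * x\<^sup>2 - f3\<^sup>2 * x ^ 3) * (1 - s * q\<^sup>2 * x\<^sup>2))
    = a * (1 - s * q * x\<^sup>2) * ((q * x - 1) * (s3 * x - s1) * (1 - s * q\<^sup>2 * x\<^sup>2)
      - (q\<^sup>2 * x - 1) * (s3 * (q * x) - s1) * (1 - s * x\<^sup>2))"
  unfolding assms by algebra

text \<open>The coefficients of the three-term recurrence as functions of the coefficients of the quartic
  \<open>m\<^sub>0 - m\<^sub>1 w + m\<^sub>2 w\<^sup>2 - m\<^sub>3 w\<^sup>3 + m\<^sub>4 w\<^sup>4\<close>; they are homogeneous of degree \<open>0\<close>.\<close>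

definition quartic_y :: "complex \<Rightarrow> (nat \<Rightarrow> complex) \<Rightarrow> nat \<Rightarrow> complex" where
  "quartic_y q m n = (case n of 0 \<Rightarrow> 0 | Suc k \<Rightarrow>
     (q * q ^ k - 1) * (m 3 * q ^ k - m 1) / (2 * (q - 1) * (m 0 - m 4 * (q ^ k)\<^sup>2)))"

definition quartic_W :: "complex \<Rightarrow> (nat \<Rightarrow> complex) \<Rightarrow> nat \<Rightarrow> complex" where
  "quartic_W q m n = (case n of 0 \<Rightarrow> 0 | Suc 0 \<Rightarrow> 1 | Suc (Suc k) \<Rightarrow>
     ((q\<^sup>2 * q ^ k - 1) * ((q + 1) * (m 0 - m 4 * q ^ k) + m 2 * (1 - q * q ^ k))
       + 2 * q * quartic_y q m n * (q * q ^ k - 1) * (m 3 * q ^ k - m 1))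
     / ((q\<^sup>2 - 1) * (m 0 - m 4 * q * (q ^ k)\<^sup>2)))"

text \<open>\<open>quartic_B\<close> and \<open>quartic_C\<close> solve the recurrences
  \<open>y_W_Suc\<close> for the coefficients B and C.\<close>

definition quartic_B :: "complex \<Rightarrow> (nat \<Rightarrow> complex) \<Rightarrow> nat \<Rightarrow> complex" where
  "quartic_B q m n = quartic_y q m n - quartic_y q m (Suc n)"

definition quartic_C :: "complex \<Rightarrow> (nat \<Rightarrow> complex) \<Rightarrow> nat \<Rightarrow> complex" where
  "quartic_C q m n = (quartic_W q m n - quartic_W q m (Suc n) + 1) / 4 - quartic_B q m n * quartic_y q m n"

lemma quartic_y_scale: "c \<noteq> 0 \<Longrightarrow> quartic_y q (\<lambda>i. c * m i) n = quartic_y q m n"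
proof -
  assume c: "c \<noteq> 0"
  have "x * (c * e * z - c * f) / (y * (c * g - c * h * w)) = x * (e * z - f) / (y * (g - h * w))" for x y z w e f g h
  proof -
    have "x * (c * e * z - c * f) = c * (x * (e * z - f))" "y * (c * g - c * h * w) = c * (y * (g - h * w))"
      by (simp_all add: algebra_simps)
    then show ?thesis by (simp only: nonzero_mult_divide_mult_cancel_left[OF c])
  qed
  then show ?thesis by (simp add: quartic_y_def split: nat.split)
qed

lemma quartic_W_scale: "c \<noteq> 0 \<Longrightarrow> quartic_W q (\<lambda>i. c * m i) n = quartic_W q m n"
proof -
  assume c: "c \<noteq> 0"
  have "(x * (x' * (c * e - c * f * z) + c * g * w) + y * (c * h * z - c * k)) / (x'' * (c * e - c * f * q * w'))
      = (x * (x' * (e - f * z) + g * w) + y * (h * z - k)) / (x'' * (e - f * q * w'))" for x x' x'' y z w w' e f g h k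
  proof -
    have "x * (x' * (c * e - c * f * z) + c * g * w) + y * (c * h * z - c * k) = c * (x * (x' * (e - f * z) + g * w) + y * (h * z - k))"
      "x'' * (c * e - c * f * q * w') = c * (x'' * (e - f * q * w'))"
      by (simp_all add: algebra_simps)
    then show ?thesis by (simp only: nonzero_mult_divide_mult_cancel_left[OF c])
  qed
  then show ?thesis unfolding quartic_W_def quartic_y_scale[OF c] by (simp split: nat.split)
qed

lemma quartic_B_scale: "c \<noteq> 0 \<Longrightarrow> quartic_B q (\<lambda>i. c * m i) n = quartic_B q m n"
  and quartic_C_scale: "c \<noteq> 0 \<Longrightarrow> quartic_C q (\<lambda>i. c * m i) n = quartic_C q m n"
  by (simp_all add: quartic_B_def quartic_C_def quartic_y_scale quartic_W_scale)

section \<open>The Askey-Wilson coefficients as functions of the quartic\<close>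

context
  fixes a1 a2 a3 a4 :: complex
begin

definition esym :: "nat \<Rightarrow> complex" where
  "esym i = [1, a1 + a2 + a3 + a4, a1 * a2 + a1 * a3 + a1 * a4 + a2 * a3 + a2 * a4 + a3 * a4,
     a1 * a2 * a3 + a1 * a2 * a4 + a1 * a3 * a4 + a2 * a3 * a4, a1 * a2 * a3 * a4] ! i"

lemma esym_simps:
  "esym 0 = 1" "esym 1 = a1 + a2 + a3 + a4"
  "esym 2 = a1 * a2 + a1 * a3 + a1 * a4 + a2 * a3 + a2 * a4 + a3 * a4"
  "esym 3 = a1 * a2 * a3 + a1 * a2 * a4 + a1 * a3 * a4 + a2 * a3 * a4"
  "esym 4 = a1 * a2 * a3 * a4"
  by (simp_all add: esym_def)

text \<open>Complementary pairs multiply to \<open>esym 4\<close>, so (1 - a_i a_j x) (1 - a_k a_l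
  x) = c - (a_i a_j + a_k a_l) x. The right side is the cubic resolvent of the quartic, homogenised
  in c and x.\<close>

lemma prod_pairs:
  fixes x :: complex
  defines "c \<equiv> 1 + esym 4 * x\<^sup>2"
  shows "(1 - a1 * a2 * x) * (1 - a1 * a3 * x) * (1 - a1 * a4 * x) * (1 - a2 * a3 * x) * (1 - a2 * a4 * x) * (1 - a3 * a4 * x)
    = c ^ 3 - c\<^sup>2 * esym 2 * x + c * x\<^sup>2 * (esym 1 * esym 3 - 4 * esym 4)
      - x ^ 3 * ((esym 3)\<^sup>2 + (esym 1)\<^sup>2 * esym 4 - 4 * esym 2 * esym 4)"
  unfolding c_def esym_simps by algebra

lemma admissible_nz:
  assumes "aw_admissible q a1 a2 a3 a4"
  shows "a1 \<noteq> 0" "1 - esym 4 * of_real q ^ n \<noteq> 0"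
  using assms by (auto simp: aw_admissible_def Let_def esym_simps)

lemma aw_beta_eq:
  assumes q: "0 < q" "q < 1" and adm: "aw_admissible q a1 a2 a3 a4"
  shows "aw_beta q a1 a2 a3 a4 n = quartic_B (of_real q) esym n"
proof -
  define Q where "Q = (of_real q :: complex)"
  define s where "s = a1 * a2 * a3 * a4"
  have Q: "Q \<noteq> 0" "Q - 1 \<noteq> 0" using q by (auto simp: Q_def)
  note a1 = admissible_nz(1)[OF adm]
  have nz: "1 - s * Q ^ k \<noteq> 0" for k
    using admissible_nz(2)[OF adm, of k] by (simp add: Q_def esym_simps s_def)
  show ?thesis
  proof (cases n)
    case 0
    have s: "s \<noteq> 1" using nz[of 0] by auto
    have 1: "quartic_B Q esym 0 = (esym 1 - esym 3) / (2 * (1 - s))"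
    proof -
      have "quartic_B Q esym 0 = 0 - (Q * 1 - 1) * (esym 3 * 1 - esym 1) / (2 * (Q - 1) * (1 - s * 1\<^sup>2))"
        unfolding quartic_B_def quartic_y_def esym_simps(1,5) s_def[symmetric] by simp
      moreover have "0 - (Q * 1 - 1) * (z * 1 - z') / (2 * (Q - 1) * (1 - s * 1\<^sup>2)) = (z' - z) / (2 * (1 - s))" for z z'
      proof -
        have "k * w / (2 * k * e) = w / (2 * e)" if "k \<noteq> 0" for k w e :: complex using that by simp
        from this[OF Q(2)] show ?thesis by (simp add: minus_divide_left)
      qed
      ultimately show ?thesis by (simp only:)
    qed
    have "aw_beta q a1 a2 a3 a4 0 = (a1 + 1 / a1 - (1 - a1 * a2) * (1 - a1 * a3) * (1 - a1 * a4) / (a1 * (1 - s))) / 2"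
      by (simp add: aw_beta_def Let_def s_def)
    also have "\<dots> = ((a1\<^sup>2 + 1) * (1 - s) - (1 - a1 * a2) * (1 - a1 * a3) * (1 - a1 * a4)) / (a1 * (2 * (1 - s)))"
      using a1 s by (simp add: field_simps power2_eq_square)
    also have "(a1\<^sup>2 + 1) * (1 - s) - (1 - a1 * a2) * (1 - a1 * a3) * (1 - a1 * a4) = a1 * (esym 1 - esym 3)"
      unfolding s_def esym_simps by algebra
    finally show ?thesis using a1 1 0 by (simp add: Q_def)
  next
    case (Suc k)
    define x where "x = Q ^ k"
    define f1 f2 f3 where "f1 = a2 + a3 + a4" and "f2 = a2 * a3 + a2 * a4 + a3 * a4" and "f3 = a2 * a3 * a4"
    define D1 D2 D3 where "D1 = 1 - s * x\<^sup>2" and "D2 = 1 - s * Q * x\<^sup>2" and "D3 = 1 - s * Q\<^sup>2 * x\<^sup>2"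
    have D: "D1 \<noteq> 0" "D2 \<noteq> 0" "D3 \<noteq> 0"
      using nz[of "2 * k"] nz[of "2 * k + 1"] nz[of "2 * k + 2"]
      by (simp_all add: D1_def D2_def D3_def x_def power_add power_mult power_commutes mult_ac power2_eq_square power_mult_distrib)
    have pw: "Q powi int n = Q * x" "Q powi (int n - 1) = x" "Q powi (2 * int n - 1) = Q * x\<^sup>2"
      "Q powi (2 * int n) = Q\<^sup>2 * x\<^sup>2" "Q powi (2 * int n - 2) = x\<^sup>2"
    proof -
      have e: "2 * int n - 1 = int (2 * k + 1)" "2 * int n = int (2 * k + 2)" "2 * int n - 2 = int (2 * k)" "int n - 1 = int k"
        using Suc by simp_all
      have p: "Q ^ (2 * k) = (Q ^ k)\<^sup>2" by (simp add: power_mult power2_eq_square flip: power_mult_distrib)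
      show "Q powi int n = Q * x" unfolding Suc power_int_of_nat x_def by simp
      show "Q powi (int n - 1) = x" unfolding e(4) power_int_of_nat x_def ..
      show "Q powi (2 * int n - 1) = Q * x\<^sup>2" unfolding e(1) power_int_of_nat x_def power_add p by simp
      show "Q powi (2 * int n) = Q\<^sup>2 * x\<^sup>2" unfolding e(2) power_int_of_nat x_def power_add p by simp
      show "Q powi (2 * int n - 2) = x\<^sup>2" unfolding e(3) power_int_of_nat x_def p ..
    qed
    define N1 where "N1 = 1 - a1 * f1 * (Q * x) + a1\<^sup>2 * f2 * (Q * x)\<^sup>2 - a1 ^ 3 * f3 * (Q * x) ^ 3"
    define N2 where "N2 = 1 - f2 * x + f1 * f3 * x\<^sup>2 - f3\<^sup>2 * x ^ 3"
    have N: "(1 - a1 * a2 * (Q * x)) * (1 - a1 * a3 * (Q * x)) * (1 - a1 * a4 * (Q * x)) = N1"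
      "(1 - a2 * a3 * x) * (1 - a2 * a4 * x) * (1 - a3 * a4 * x) = N2"
      unfolding N1_def N2_def f1_def f2_def f3_def by algebra+
    have "aw_beta q a1 a2 a3 a4 n = (a1 + 1 / a1 - N1 * (1 - s * x) / (a1 * D2 * D3) - a1 * ((1 - Q * x) * N2) / (D2 * D1)) / 2"
      unfolding aw_beta_def Let_def Q_def[symmetric] s_def[symmetric] pw N[symmetric] D1_def D2_def D3_def
      using Suc by (simp add: mult_ac)
    also have "\<dots> = ((Q - 1) * ((a1\<^sup>2 + 1) * D1 * D2 * D3 - N1 * (1 - s * x) * D1 - a1\<^sup>2 * (1 - Q * x) * N2 * D3))
        / (2 * a1 * (Q - 1) * D1 * D2 * D3)"
      using D Q a1 by (simp add: field_simps power2_eq_square)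
    also have "(Q - 1) * ((a1\<^sup>2 + 1) * D1 * D2 * D3 - N1 * (1 - s * x) * D1 - a1\<^sup>2 * (1 - Q * x) * N2 * D3)
       = a1 * D2 * ((Q * x - 1) * (esym 3 * x - esym 1) * D3 - (Q\<^sup>2 * x - 1) * (esym 3 * (Q * x) - esym 1) * D1)"
      unfolding N1_def N2_def D1_def D2_def D3_def
      by (rule aw_beta_polynomial_identity) (unfold esym_simps s_def f1_def f2_def f3_def, simp_all add: algebra_simps)
    also have "\<dots> / (2 * a1 * (Q - 1) * D1 * D2 * D3)
       = (Q * x - 1) * (esym 3 * x - esym 1) / (2 * (Q - 1) * D1) - (Q\<^sup>2 * x - 1) * (esym 3 * (Q * x) - esym 1) / (2 * (Q - 1) * D3)"
    proof -
      have "e * f2 * (z * f3 - w * f1) / (2 * e * k * f1 * f2 * f3) = z / (2 * k * f1) - w / (2 * k * f3)"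
        if "e \<noteq> 0" "k \<noteq> 0" "f1 \<noteq> 0" "f2 \<noteq> 0" "f3 \<noteq> 0" for e f1 f2 f3 k z w :: complex
        using that by (simp add: field_simps)
      from this[OF a1 Q(2) D] show ?thesis .
    qed
    also have "\<dots> = quartic_B Q esym n"
      unfolding quartic_B_def quartic_y_def Suc esym_simps(1,5) s_def[symmetric] D1_def D3_def x_def
      by (simp add: power2_eq_square mult_ac)
    finally show ?thesis by (simp add: Q_def)
  qed
qed

end

text \<open>W' contains y', whose denominator is D4. The last assumption makes D4 cancel in 4 y y' -
  W', in accordance with the denominators of \<eta>.\<close>

lemma quartic_K:
  fixes q D2 D3 D4 y y' W' Y Y' w' :: complex
  assumes "2 * (q - 1) * D2 * y = Y" "2 * (q - 1) * D4 * y' = Y'" "(q\<^sup>2 - 1) * D3 * W' = w' + 2 * q * y' * Y"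
    "(q + 1) * D3 - q * D2 = D4"
  shows "(q - 1) * (q\<^sup>2 - 1) * D2 * D3 * (4 * y * y' - W') = Y * Y' - (q - 1) * D2 * w'"
proof -
  have "(q - 1) * (q\<^sup>2 - 1) * D2 * D3 * (4 * y * y' - W')
      = 2 * (q\<^sup>2 - 1) * D3 * y' * (2 * (q - 1) * D2 * y) - (q - 1) * D2 * ((q\<^sup>2 - 1) * D3 * W')"
    by algebra
  also have "\<dots> = Y * (2 * (q - 1) * ((q + 1) * D3 - q * D2) * y') - (q - 1) * D2 * w'"
    unfolding assms(1,3) by algebra
  finally show ?thesis unfolding assms(4) assms(2) .
qed

lemma aw_eta_eq:
  assumes q: "0 < q" "q < 1" and adm: "aw_admissible q a1 a2 a3 a4"
  shows "aw_eta q a1 a2 a3 a4 n = quartic_C (of_real q) (esym a1 a2 a3 a4) (Suc n)"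
proof -
  define e where "e = esym a1 a2 a3 a4"
  note esym_simps = esym_simps[of a1 a2 a3 a4, folded e_def]
  define Q where "Q = (of_real q :: complex)"
  define s where "s = a1 * a2 * a3 * a4"
  define prs where "prs x = (1 - a1 * a2 * x) * (1 - a1 * a3 * x) * (1 - a1 * a4 * x) * (1 - a2 * a3 * x) * (1 - a2 * a4 * x) * (1 - a3 * a4 * x)" for x
  have Pi: "prs x = (1 + s * x\<^sup>2) ^ 3 - (1 + s * x\<^sup>2)\<^sup>2 * e 2 * x + (1 + s * x\<^sup>2) * x\<^sup>2 * (e 1 * e 3 - 4 * s)
      - x ^ 3 * ((e 3)\<^sup>2 + (e 1)\<^sup>2 * s - 4 * e 2 * s)" for x
    unfolding prs_def using prod_pairs[of a1 a2 x a3 a4] by (simp only: esym_simps(5) s_def e_def[symmetric])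
  have "sqrt q < 1" using q by simp
  then have "\<bar>q\<bar> < 1" using q by simp
  then have "q\<^sup>2 \<noteq> 1" by (simp add: abs_square_eq_1)
  then have Q: "Q \<noteq> 0" "Q - 1 \<noteq> 0" "Q\<^sup>2 - 1 \<noteq> 0" using q by (auto simp: Q_def simp flip: of_real_power)
  have nz: "1 - s * Q ^ k \<noteq> 0" for k
    using admissible_nz(2)[OF adm, of k] by (simp add: Q_def esym_simps(5) s_def e_def[symmetric])
  have e4: "e 4 = s" "e 0 = 1" by (simp_all add: esym_simps s_def)
  have y_eq: "2 * (Q - 1) * (1 - s * (Q ^ k)\<^sup>2) * quartic_y Q e (Suc k) = (Q * Q ^ k - 1) * (e 3 * Q ^ k - e 1)" for k
    using nz[of "2 * k"] Q unfolding quartic_y_def e4 by (simp add: power_even_eq)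
  have W_eq: "(Q\<^sup>2 - 1) * (1 - s * Q * (Q ^ k)\<^sup>2) * quartic_W Q e (Suc (Suc k))
      = (Q\<^sup>2 * Q ^ k - 1) * ((Q + 1) * (1 - s * Q ^ k) + e 2 * (1 - Q * Q ^ k))
       + 2 * Q * quartic_y Q e (Suc (Suc k)) * (Q * Q ^ k - 1) * (e 3 * Q ^ k - e 1)" for k
  proof -
    have "1 - s * Q * (Q ^ k)\<^sup>2 \<noteq> 0"
      using nz[of "Suc (2 * k)"] unfolding power_Suc power_even_eq by (simp only: mult.assoc) simp
    then show ?thesis using Q unfolding quartic_W_def e4 by simp
  qed
  have C_eq: "4 * quartic_C Q e k = quartic_W Q e k + 1 + (4 * quartic_y Q e k * quartic_y Q e (Suc k) - quartic_W Q e (Suc k))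
      - 4 * (quartic_y Q e k)\<^sup>2" for k
    by (simp add: quartic_C_def quartic_B_def field_simps power2_eq_square)
  show ?thesis
  proof (cases n)
    case 0
    define y y' W' where "y = quartic_y Q e 1" and "y' = quartic_y Q e 2" and "W' = quartic_W Q e 2"
    define D2 D3 D4 where "D2 = 1 - s" and "D3 = 1 - s * Q" and "D4 = 1 - s * Q\<^sup>2"
    have D: "D2 \<noteq> 0" "D3 \<noteq> 0" using nz[of 0] nz[of 1] by (simp_all add: D2_def D3_def)
    define Y where "Y = (Q - 1) * (e 3 - e 1)"
    define Y' where "Y' = (Q\<^sup>2 - 1) * (e 3 * Q - e 1)"
    define w' where "w' = (Q\<^sup>2 - 1) * ((Q + 1) * (1 - s) + e 2 * (1 - Q))"
    have y: "2 * (Q - 1) * D2 * y = Y" using y_eq[of 0] by (simp add: Y_def D2_def y_def)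
    have y': "2 * (Q - 1) * D4 * y' = Y'" using y_eq[of 1] by (simp add: Y'_def D4_def y'_def numeral_2_eq_2)
    have "2 * Q * y' * (Q - 1) * (e 3 - e 1) = 2 * Q * y' * Y" by (simp add: Y_def)
    then have W': "(Q\<^sup>2 - 1) * D3 * W' = w' + 2 * Q * y' * Y"
      using W_eq[of 0] by (simp add: W'_def y'_def w'_def D3_def numeral_2_eq_2)
    have K: "(Q - 1) * (Q\<^sup>2 - 1) * D2 * D3 * (4 * y * y' - W') = Y * Y' - (Q - 1) * D2 * w'"
      by (rule quartic_K[OF y y' W']) (simp add: D2_def D3_def D4_def algebra_simps power2_eq_square)
    define M where "M = (Q - 1) * (Q\<^sup>2 - 1)"
    have C4: "4 * quartic_C Q e 1 = 2 + (4 * y * y' - W') - 4 * y\<^sup>2"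
      using C_eq[of 1] by (simp add: y_def y'_def W'_def quartic_W_def numeral_2_eq_2)
    have "M * (4 * D2\<^sup>2 * D3 * quartic_C Q e 1)
        = 2 * M * D2\<^sup>2 * D3 + D2 * ((Q - 1) * (Q\<^sup>2 - 1) * D2 * D3 * (4 * y * y' - W')) - (Q + 1) * D3 * (2 * (Q - 1) * D2 * y)\<^sup>2"
      using C4 unfolding M_def by algebra
    also have "\<dots> = M * ((1 - Q) * prs 1)"
    proof -
      have Pi1: "prs 1 = (1 + s) ^ 3 - (1 + s)\<^sup>2 * e 2 + (1 + s) * (e 1 * e 3 - 4 * s)
          - ((e 3)\<^sup>2 + (e 1)\<^sup>2 * s - 4 * e 2 * s)"
        using Pi[of 1] by simp
      show ?thesis unfolding K y Pi1 unfolding M_def Y_def Y'_def w'_def D2_def D3_def by algebra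
    qed
    finally have "4 * D2\<^sup>2 * D3 * quartic_C Q e 1 = (1 - Q) * prs 1"
      using Q by (simp add: M_def)
    then have "quartic_C Q e 1 = (1 - Q) * prs 1 / (4 * D2\<^sup>2 * D3)"
      using D by (simp add: field_simps)
    then show ?thesis
      using 0 unfolding prs_def D2_def D3_def e_def[symmetric]
      by (simp add: aw_eta_def Let_def Q_def[symmetric] s_def[symmetric])
  next
    case (Suc k)
    define t where "t = Q ^ k"
    define y y' W W' where "y = quartic_y Q e (Suc n)" and "y' = quartic_y Q e (Suc (Suc n))"
      and "W = quartic_W Q e (Suc n)" and "W' = quartic_W Q e (Suc (Suc n))"
    define D1 D2 D3 D4 where "D1 = 1 - s * Q * t\<^sup>2" and "D2 = 1 - s * Q\<^sup>2 * t\<^sup>2" and "D3 = 1 - s * Q ^ 3 * t\<^sup>2" and "D4 = 1 - s * Q ^ 4 * t\<^sup>2"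
    have pk: "Q ^ (2 * k) = t\<^sup>2" by (simp add: t_def power_mult power2_eq_square flip: power_mult_distrib)
    have D: "D1 \<noteq> 0" "D2 \<noteq> 0" "D3 \<noteq> 0"
      using nz[of "1 + 2 * k"] nz[of "2 + 2 * k"] nz[of "3 + 2 * k"]
      unfolding power_add pk by (simp_all add: D1_def D2_def D3_def mult.assoc)
    define Y where "Y = (Q\<^sup>2 * t - 1) * (e 3 * (Q * t) - e 1)"
    define Y' where "Y' = (Q ^ 3 * t - 1) * (e 3 * (Q\<^sup>2 * t) - e 1)"
    define w where "w = (Q\<^sup>2 * t - 1) * ((Q + 1) * (1 - s * t) + e 2 * (1 - Q * t))"
    define w' where "w' = (Q ^ 3 * t - 1) * ((Q + 1) * (1 - s * Q * t) + e 2 * (1 - Q\<^sup>2 * t))"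
    have p1: "Q ^ Suc k = Q * t" "Q ^ Suc (Suc k) = Q\<^sup>2 * t" by (simp_all add: t_def power2_eq_square)
    have y: "2 * (Q - 1) * D2 * y = Y"
      using y_eq[of "Suc k"] unfolding p1 y_def Suc Y_def D2_def by (simp add: power_mult_distrib power2_eq_square mult_ac)
    have y': "2 * (Q - 1) * D4 * y' = Y'"
      using y_eq[of "Suc (Suc k)"] unfolding p1 y'_def Suc Y'_def D4_def by (simp add: eval_nat_numeral mult_ac)
    have W: "(Q\<^sup>2 - 1) * D1 * W = w + 2 * Q * y * ((Q * t - 1) * (e 3 * t - e 1))"
      using W_eq[of k] unfolding t_def[symmetric] W_def y_def Suc w_def D1_def by (simp add: mult.assoc)
    have W': "(Q\<^sup>2 - 1) * D3 * W' = w' + 2 * Q * y' * Y"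
      using W_eq[of "Suc k"] unfolding p1 W'_def y'_def Suc w'_def Y_def D3_def by (simp add: eval_nat_numeral mult_ac)
    have K: "(Q - 1) * (Q\<^sup>2 - 1) * D2 * D3 * (4 * y * y' - W') = Y * Y' - (Q - 1) * D2 * w'"
      by (rule quartic_K[OF y y' W']) (simp add: D2_def D3_def D4_def algebra_simps eval_nat_numeral)
    define M where "M = (Q - 1) * (Q\<^sup>2 - 1)"
    have C4: "4 * quartic_C Q e (Suc n) = W + 1 + (4 * y * y' - W') - 4 * y\<^sup>2"
      using C_eq[of "Suc n"] by (simp add: y_def y'_def W_def W'_def)
    have "M * (4 * D1 * D2\<^sup>2 * D3 * quartic_C Q e (Suc n))
        = D2 * D3 * ((Q - 1) * D2 * ((Q\<^sup>2 - 1) * D1 * W)) + M * D1 * D2\<^sup>2 * D3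
          + D1 * D2 * ((Q - 1) * (Q\<^sup>2 - 1) * D2 * D3 * (4 * y * y' - W')) - (Q + 1) * D1 * D3 * (2 * (Q - 1) * D2 * y)\<^sup>2"
      using C4 unfolding M_def by algebra
    also have "(Q - 1) * D2 * ((Q\<^sup>2 - 1) * D1 * W) = (Q - 1) * D2 * w + Q * Y * ((Q * t - 1) * (e 3 * t - e 1))"
      unfolding W y[symmetric] by algebra
    also have "D2 * D3 * ((Q - 1) * D2 * w + Q * Y * ((Q * t - 1) * (e 3 * t - e 1))) + M * D1 * D2\<^sup>2 * D3
          + D1 * D2 * ((Q - 1) * (Q\<^sup>2 - 1) * D2 * D3 * (4 * y * y' - W')) - (Q + 1) * D1 * D3 * (2 * (Q - 1) * D2 * y)\<^sup>2
        = M * ((1 - Q\<^sup>2 * t) * (1 - s * t) * prs (Q * t))"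
      unfolding K y Pi M_def using aw_eta_polynomial_identity[of s Q t "e 2" "e 3" "e 1"]
      unfolding D1_def[symmetric] D2_def[symmetric] D3_def[symmetric] Y_def[symmetric] Y'_def[symmetric] w_def[symmetric] w'_def[symmetric]
      by (simp add: mult_ac add_ac)
    finally have "4 * D1 * D2\<^sup>2 * D3 * quartic_C Q e (Suc n) = (1 - Q\<^sup>2 * t) * (1 - s * t) * prs (Q * t)"
      using Q by (simp add: M_def)
    then have C: "quartic_C Q e (Suc n) = (1 - Q\<^sup>2 * t) * (1 - s * t) * prs (Q * t) / (4 * D1 * D2\<^sup>2 * D3)"
      using D by (simp add: field_simps)
    have e: "2 * int n - 1 = int (1 + 2 * k)" "2 * int n = int (2 + 2 * k)" "2 * int n + 1 = int (3 + 2 * k)" "int n - 1 = int k"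
        "int n + 1 = int (2 + k)" using Suc by simp_all
    have pw: "Q powi int n = Q * t" "Q powi (int n + 1) = Q\<^sup>2 * t" "Q powi (int n - 1) = t" "Q powi (2 * int n - 1) = Q * t\<^sup>2"
      "Q powi (2 * int n) = Q\<^sup>2 * t\<^sup>2" "Q powi (2 * int n + 1) = Q ^ 3 * t\<^sup>2"
    proof -
      show "Q powi int n = Q * t" unfolding Suc power_int_of_nat t_def by simp
      show "Q powi (int n + 1) = Q\<^sup>2 * t" unfolding e(5) power_int_of_nat t_def power_add ..
      show "Q powi (int n - 1) = t" unfolding e(4) power_int_of_nat t_def ..
      show "Q powi (2 * int n - 1) = Q * t\<^sup>2" unfolding e(1) power_int_of_nat power_add pk by simp
      show "Q powi (2 * int n) = Q\<^sup>2 * t\<^sup>2" unfolding e(2) power_int_of_nat power_add pk ..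
      show "Q powi (2 * int n + 1) = Q ^ 3 * t\<^sup>2" unfolding e(3) power_int_of_nat power_add pk ..
    qed
    show ?thesis
      unfolding Q_def[symmetric] e_def[symmetric] C aw_eta_def Let_def pw s_def[symmetric] prs_def D1_def D2_def D3_def
      using Suc by (simp add: mult_ac)
  qed
qed

section \<open>Continuity in the coefficients of the quartic\<close>

lemma quartic_y_tendsto:
  assumes m: "\<And>i. i \<le> 4 \<Longrightarrow> (\<lambda>k. m k i) \<longlonglongrightarrow> m' i" and nz: "q \<noteq> 1" "\<And>j. m' 0 - m' 4 * q ^ j \<noteq> 0"
  shows "(\<lambda>k. quartic_y q (m k) n) \<longlonglongrightarrow> quartic_y q m' n"
proof (cases n)
  case (Suc j)
  have "m' 0 - m' 4 * (q ^ j)\<^sup>2 \<noteq> 0" using nz(2)[of "j * 2"] by (simp add: power_mult)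
  then show ?thesis using nz(1) unfolding Suc quartic_y_def by (auto intro!: tendsto_intros m)
qed (simp add: quartic_y_def)

lemma quartic_W_tendsto:
  assumes m: "\<And>i. i \<le> 4 \<Longrightarrow> (\<lambda>k. m k i) \<longlonglongrightarrow> m' i" and nz: "q \<noteq> 1" "q\<^sup>2 \<noteq> 1" "\<And>j. m' 0 - m' 4 * q ^ j \<noteq> 0"
  shows "(\<lambda>k. quartic_W q (m k) n) \<longlonglongrightarrow> quartic_W q m' n"
proof -
  consider "n = 0" | "n = Suc 0" | j where "n = Suc (Suc j)" by (cases n rule: nat.exhaust; metis nat.exhaust)
  then show ?thesis
  proof cases
    case 3
    have "m' 0 - m' 4 * q * (q ^ j)\<^sup>2 \<noteq> 0" using nz(3)[of "1 + j * 2"] by (simp add: power_mult power_add mult.assoc)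
    then show ?thesis
      using nz(2) unfolding 3 quartic_W_def
      by (auto intro!: tendsto_intros m quartic_y_tendsto[OF m nz(1) nz(3)])
  qed (simp_all add: quartic_W_def)
qed

lemma quartic_B_C_tendsto:
  assumes m: "\<And>i. i \<le> 4 \<Longrightarrow> (\<lambda>k. m k i) \<longlonglongrightarrow> m' i" and nz: "q \<noteq> 1" "q\<^sup>2 \<noteq> 1" "\<And>j. m' 0 - m' 4 * q ^ j \<noteq> 0"
  shows "(\<lambda>k. quartic_B q (m k) n) \<longlonglongrightarrow> quartic_B q m' n"
    and "(\<lambda>k. quartic_C q (m k) n) \<longlonglongrightarrow> quartic_C q m' n"
  unfolding quartic_B_def quartic_C_def
  by (auto intro!: tendsto_intros quartic_y_tendsto[OF m nz(1) nz(3)] quartic_W_tendsto[OF m nz])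

section \<open>The recurrence of the P_n in terms of the quartic of the Pearson pair\<close>

context aw_classical
begin

definition mm :: "nat \<Rightarrow> complex" where "mm i = [m0, m1, m2, m3, m4] ! i"

lemma mm_simps: "mm 0 = m0" "mm 1 = m1" "mm 2 = m2" "mm 3 = m3" "mm 4 = m4"
  by (simp_all add: mm_def)

lemma q_complex: "(of_real q :: complex) \<noteq> 0" "(of_real q :: complex) - 1 \<noteq> 0" "(of_real q :: complex)\<^sup>2 - 1 \<noteq> 0"
proof -
  have "u ^ 2 \<noteq> 1" "u ^ 4 \<noteq> 1" by simp_all
  then show "(of_real q :: complex) - 1 \<noteq> 0" "(of_real q :: complex)\<^sup>2 - 1 \<noteq> 0"
    by (simp_all flip: u_sq power_mult)
qed (use q_pos in simp)

text \<open>Up to a nonzero factor this is the leading coefficient \<open>L.d j\<close>, so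
  \<open>d_nz\<close> keeps all denominators of the quartic expressions away from 0.\<close>

lemma m0_m4_nz: "m0 - m4 * of_real q ^ j \<noteq> 0"
proof -
  define w where "w = inverse u"
  have "(u - w) * (fa * G j + A j) * 2 * u ^ j = - 8 * (m0 - m4 * (u ^ j * u ^ j))"
  proof -
    have "u ^ j * w ^ j = 1" by (simp add: w_def flip: power_mult_distrib)
    moreover have "(u - w) * G j = u ^ j - w ^ j" "2 * A j = u ^ j + w ^ j"
      using G_mult two_A by (simp_all add: w_def)
    moreover have "8 * m0 = 2 * fa - (u - w)" "8 * m4 = 2 * fa + (u - w)"
      by (simp_all add: m0_def m4_def w_def)
    moreover have "(u - w) * (fa * g + e) * 2 * x = - 8 * (n0 - n4 * (x * x))"
      if "x * z = 1" "(u - w) * g = x - z" "2 * e = x + z" "8 * n0 = 2 * fa - (u - w)" "8 * n4 = 2 * fa + (u - w)"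
      for g e x z n0 n4
    proof -
      have "(u - w) * (fa * g + e) * 2 * x = (2 * fa * ((u - w) * g) + (u - w) * (2 * e)) * x" by (simp add: algebra_simps)
      also have "\<dots> = (2 * fa * (x - z) + (u - w) * (x + z)) * x" unfolding that ..
      also have "\<dots> = - 8 * (n0 - n4 * (x * x))" using that(1,4,5) by algebra
      finally show ?thesis .
    qed
    ultimately show ?thesis by blast
  qed
  moreover have "(u - w) * (fa * G j + A j) * 2 * u ^ j \<noteq> 0"
    using L.d_nz[of j] L_d by (simp add: w_def)
  moreover have "of_real q ^ j = u ^ j * u ^ j"
    by (simp add: power2_eq_square power_mult_distrib flip: u_sq)
  ultimately show ?thesis by (metis mult_zero_right)
qed

lemma y_W_quartic: "y n = quartic_y (of_real q) mm n" "W n = quartic_W (of_real q) mm n"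
proof -
  define Q where "Q = (of_real q :: complex)"
  note Q = q_complex[folded Q_def]
  have nz: "m0 - m4 * Q ^ j \<noteq> 0" for j using m0_m4_nz by (simp add: Q_def)
  show y: "y n = quartic_y (of_real q) mm n" for n
  proof (cases n)
    case (Suc k)
    have "Q powi (int n - 2) = Q powi (int k - 1)" using Suc by simp
    then have t: "Q * Q powi (int n - 2) = Q ^ k" using Q(1) by (simp add: power_int_diff)
    have "2 * (Q - 1) * (m0 - m4 * (Q ^ k)\<^sup>2) * y n = (Q * Q ^ k - 1) * (m3 * Q ^ k - m1)"
      using y_W_formula(1)[of n] Suc unfolding Q_def[symmetric] t by simp
    moreover have "m0 - m4 * (Q ^ k)\<^sup>2 \<noteq> 0" using nz[of "2 * k"] by (simp only: power_even_eq) simp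
    ultimately show ?thesis
      using Q unfolding Q_def[symmetric] quartic_y_def Suc mm_simps
      by (simp add: nonzero_eq_divide_eq mult_ac)
  qed (simp add: y_W_0 quartic_y_def)
  show "W n = quartic_W (of_real q) mm n"
  proof -
    consider "n = 0" | "n = Suc 0" | k where "n = Suc (Suc k)" by (cases n rule: nat.exhaust; metis nat.exhaust)
    then show ?thesis
    proof cases
      case 3
      then have t: "Q powi (int n - 2) = Q ^ k" by simp
      have "(Q\<^sup>2 - 1) * (m0 - m4 * Q * (Q ^ k)\<^sup>2) * W n
         = (Q\<^sup>2 * Q ^ k - 1) * ((Q + 1) * (m0 - m4 * Q ^ k) + m2 * (1 - Q * Q ^ k)) + 2 * Q * y n * (Q * Q ^ k - 1) * (m3 * Q ^ k - m1)"
        using y_W_formula(2)[of n, folded Q_def, unfolded t] 3 by simp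
      moreover have "m0 - m4 * Q * (Q ^ k)\<^sup>2 \<noteq> 0"
        using nz[of "Suc (2 * k)"] unfolding power_Suc power_even_eq by (simp only: mult.assoc) simp
      ultimately have "W n = ((Q\<^sup>2 * Q ^ k - 1) * ((Q + 1) * (m0 - m4 * Q ^ k) + m2 * (1 - Q * Q ^ k)) + 2 * Q * y n * (Q * Q ^ k - 1) * (m3 * Q ^ k - m1))
          / ((Q\<^sup>2 - 1) * (m0 - m4 * Q * (Q ^ k)\<^sup>2))"
        using Q by (simp add: nonzero_eq_divide_eq mult_ac)
      then show ?thesis
        unfolding Q_def[symmetric] quartic_W_def mm_simps y[folded Q_def] 3 by simp
    qed (simp_all add: y_W_0 quartic_W_def)
  qed
qed

lemma B_C_quartic: "B n = quartic_B (of_real q) mm n" "C (Suc n) = quartic_C (of_real q) mm (Suc n)"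
proof -
  show B: "B n = quartic_B (of_real q) mm n" for n
    using y_W_Suc(1)[of n] by (simp add: quartic_B_def y_W_quartic)
  have "4 * C (Suc n) = W (Suc n) - W (Suc (Suc n)) + 1 - 4 * (B (Suc n) * y (Suc n))"
    unfolding y_W_Suc(2) by (simp add: algebra_simps)
  then have "C (Suc n) = (W (Suc n) - W (Suc (Suc n)) + 1 - 4 * (B (Suc n) * y (Suc n))) / 4"
    by (metis nonzero_mult_div_cancel_left zero_neq_numeral)
  then show "C (Suc n) = quartic_C (of_real q) mm (Suc n)"
    unfolding quartic_C_def B[symmetric] y_W_quartic[symmetric] by (simp add: diff_divide_distrib add_divide_distrib)
qed

end

section \<open>Approximating a quartic by admissible parameters\<close>

lemma linear_factor_homogeneous:
  fixes p :: "complex poly"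
  assumes "degree p \<le> Suc n"
  shows "\<exists>x y r. p = [:x, - y:] * r \<and> degree r \<le> n"
proof (cases "degree p \<le> n")
  case True
  \<comment> \<open>A missing degree counts as a root at infinity: the split-off factor is the
    constant 1.\<close>
  then show ?thesis by (intro exI[of _ 1] exI[of _ 0] exI[of _ p]) simp
next
  case False
  then have d: "degree p = Suc n" using assms by simp
  then have "\<not> constant (poly p)" by (simp add: constant_degree)
  then obtain c where "poly p c = 0" using fundamental_theorem_of_algebra by blast
  then obtain r where r: "p = [:- c, 1:] * r" using poly_eq_0_iff_dvd by (metis dvd_def)
  then have "r \<noteq> 0" using d by auto
  then have "degree p = Suc (degree r)" unfolding r by (subst degree_mult_eq) auto
  then show ?thesis using d r by (intro exI[of _ "- c"] exI[of _ "- 1"] exI[of _ r]) simp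
qed

text \<open>Factors x - y w instead of 1 - a w also cover quartics of lower degree (y = 0) and roots
  at 0 (x = 0). The sign makes the coefficients elementary symmetric functions when all x are
  1.\<close>

definition quartic_coeff :: "(nat \<Rightarrow> complex) \<Rightarrow> (nat \<Rightarrow> complex) \<Rightarrow> nat \<Rightarrow> complex" where
  "quartic_coeff x y i = (- 1) ^ i * coeff ([:x 0, - y 0:] * ([:x 1, - y 1:] * ([:x 2, - y 2:] * [:x 3, - y 3:]))) i"

lemma quartic_coeff_simps:
  "quartic_coeff x y 0 = x 0 * x 1 * x 2 * x 3"
  "quartic_coeff x y 1 = y 0 * x 1 * x 2 * x 3 + x 0 * y 1 * x 2 * x 3 + x 0 * x 1 * y 2 * x 3 + x 0 * x 1 * x 2 * y 3"
  "quartic_coeff x y 2 = y 0 * y 1 * x 2 * x 3 + y 0 * x 1 * y 2 * x 3 + y 0 * x 1 * x 2 * y 3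
     + x 0 * y 1 * y 2 * x 3 + x 0 * y 1 * x 2 * y 3 + x 0 * x 1 * y 2 * y 3"
  "quartic_coeff x y 3 = y 0 * y 1 * y 2 * x 3 + y 0 * y 1 * x 2 * y 3 + y 0 * x 1 * y 2 * y 3 + x 0 * y 1 * y 2 * y 3"
  "quartic_coeff x y 4 = y 0 * y 1 * y 2 * y 3"
  by (simp_all add: quartic_coeff_def eval_nat_numeral algebra_simps)

lemma quartic_factor:
  obtains x y where "\<And>i. i \<le> 4 \<Longrightarrow> quartic_coeff x y i = m i"
proof -
  define p where "p = [:m 0, - m 1, m 2, - m 3, m 4:]"
  have "degree p \<le> Suc 3" by (simp add: p_def)
  then obtain x0 y0 p1 where 0: "p = [:x0, - y0:] * p1" "degree p1 \<le> Suc 2"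
    using linear_factor_homogeneous[of p 3] by (auto simp: numeral_3_eq_3 numeral_2_eq_2)
  then obtain x1 y1 p2 where 1: "p1 = [:x1, - y1:] * p2" "degree p2 \<le> Suc 1"
    using linear_factor_homogeneous[of p1 2] by (auto simp: numeral_2_eq_2)
  then obtain x2 y2 p3 where 2: "p2 = [:x2, - y2:] * p3" "degree p3 \<le> Suc 0"
    using linear_factor_homogeneous[of p2 1] by auto
  then obtain x3 y3 where 3: "p3 = [:x3, - y3:]"
    using degree_le_1E[of p3] by (metis minus_minus)
  define x where "x i = [x0, x1, x2, x3] ! i" for i
  define y where "y i = [y0, y1, y2, y3] ! i" for i
  have "p = [:x 0, - y 0:] * ([:x 1, - y 1:] * ([:x 2, - y 2:] * [:x 3, - y 3:]))"
    unfolding 0(1) 1(1) 2(1) 3 by (simp add: x_def y_def numeral_3_eq_3 numeral_2_eq_2)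
  then have c: "quartic_coeff x y i = (- 1) ^ i * coeff p i" for i
    by (simp only: quartic_coeff_def)
  have "quartic_coeff x y i = m i" if i: "i \<le> 4" for i
  proof -
    consider "i = 0" | "i = 1" | "i = 2" | "i = 3" | "i = 4" using i by linarith
    then show ?thesis by cases (simp_all add: c p_def eval_nat_numeral)
  qed
  then show ?thesis by (rule that)
qed

lemma quartic_coeff_esym:
  assumes "x 0 \<noteq> 0" "x 1 \<noteq> 0" "x 2 \<noteq> 0" "x 3 \<noteq> 0" "i \<le> 4"
  shows "quartic_coeff x y i = x 0 * x 1 * x 2 * x 3 * esym (y 0 / x 0) (y 1 / x 1) (y 2 / x 2) (y 3 / x 3) i"
proof -
  consider "i = 0" | "i = 1" | "i = 2" | "i = 3" | "i = 4" using assms(5) by linarith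
  then show ?thesis
    by cases (simp_all only: quartic_coeff_simps esym_simps, insert assms, simp_all add: field_simps)
qed

lemma exists_near_avoiding:
  fixes c :: complex
  assumes "countable S" "e > 0"
  shows "\<exists>z. dist z c < e \<and> z \<notin> S"
proof (rule ccontr)
  assume "\<not> ?thesis"
  then have "ball c e \<subseteq> S" by (auto simp: dist_commute)
  then have "countable (ball c e)" using assms(1) countable_subset by blast
  then show False using uncountable_ball[of e c] assms(2) by blast
qed

lemma countable_resonances:
  fixes w x Q :: complex
  assumes "Q \<noteq> 0"
  shows "countable {z. \<exists>n::nat. 1 - w * (z / x) * Q ^ n = 0}"
proof -
  have "{z. \<exists>n::nat. 1 - w * (z / x) * Q ^ n = 0} \<subseteq> range (\<lambda>n. x / (w * Q ^ n))"
  proof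
    fix z assume "z \<in> {z. \<exists>n::nat. 1 - w * (z / x) * Q ^ n = 0}"
    then obtain n where n: "w * (z / x) * Q ^ n = 1" by auto
    then have "w \<noteq> 0" "x \<noteq> 0" by auto
    then have "z = x / (w * Q ^ n)" using n assms by (simp add: field_simps)
    then show "z \<in> range (\<lambda>n. x / (w * Q ^ n))" by blast
  qed
  then show ?thesis by (rule countable_subset) simp
qed

text \<open>The numerators are chosen one after the other. Each condition is imposed when the last
  parameter in it is chosen, and it then excludes only countably many values.\<close>

lemma exists_admissible_near:
  assumes q: "0 < q" and e: "e > 0"
  shows "\<exists>x' y'. (\<forall>i\<le>3. dist (x' i) (x i) < e \<and> dist (y' i) (y i) < e \<and> x' i \<noteq> 0)
    \<and> aw_admissible q (y' 0 / x' 0) (y' 1 / x' 1) (y' 2 / x' 2) (y' 3 / x' (3::nat))"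
proof -
  define Q where "Q = (of_real q :: complex)"
  have Q: "Q \<noteq> 0" using q by (simp add: Q_def)
  define bad where "bad w x = {z. \<exists>n::nat. 1 - w * (z / x) * Q ^ n = 0}" for w x
  have bad: "countable (bad w x)" for w x unfolding bad_def by (rule countable_resonances[OF Q])
  have "\<forall>i. \<exists>z. dist z (x i) < e \<and> z \<noteq> 0" using exists_near_avoiding[of "{0}" e] e by auto
  then obtain x' where x': "\<And>i. dist (x' i) (x i) < e" "\<And>i. x' i \<noteq> 0" by metis
  \<comment> \<open>The formula for \<beta>_n divides by the first parameter, so y0 has to avoid
    0.\<close>
  obtain y0 where y0: "dist y0 (y 0) < e" "y0 \<noteq> 0" using exists_near_avoiding[of "{0}" e] e by auto
  define a0 where "a0 = y0 / x' 0"
  obtain y1 where y1: "dist y1 (y 1) < e" "y1 \<notin> bad a0 (x' 1)" using exists_near_avoiding[OF bad e] by metis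
  define a1 where "a1 = y1 / x' 1"
  have "countable (bad a0 (x' 2) \<union> bad a1 (x' 2))" using bad by simp
  then obtain y2 where y2: "dist y2 (y 2) < e" "y2 \<notin> bad a0 (x' 2) \<union> bad a1 (x' 2)" using exists_near_avoiding[OF _ e] by metis
  define a2 where "a2 = y2 / x' 2"
  have "countable (bad a0 (x' 3) \<union> bad a1 (x' 3) \<union> bad a2 (x' 3) \<union> bad (a0 * a1 * a2) (x' 3))" using bad by simp
  then obtain y3 where y3: "dist y3 (y 3) < e"
    "y3 \<notin> bad a0 (x' 3) \<union> bad a1 (x' 3) \<union> bad a2 (x' 3) \<union> bad (a0 * a1 * a2) (x' 3)"
    using exists_near_avoiding[OF _ e] by metis
  define a3 where "a3 = y3 / x' 3"
  have "a0 \<noteq> 0" using y0 x' by (simp add: a0_def)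
  moreover have "1 - a0 * a1 * Q ^ n \<noteq> 0" "1 - a0 * a2 * Q ^ n \<noteq> 0" "1 - a1 * a2 * Q ^ n \<noteq> 0"
    "1 - a0 * a3 * Q ^ n \<noteq> 0" "1 - a1 * a3 * Q ^ n \<noteq> 0" "1 - a2 * a3 * Q ^ n \<noteq> 0" "1 - a0 * a1 * a2 * a3 * Q ^ n \<noteq> 0" for n
    using y1(2) y2(2) y3(2) unfolding bad_def Un_iff mem_Collect_eq a1_def[symmetric] a2_def[symmetric] a3_def[symmetric]
    by blast+
  ultimately have "aw_admissible q a0 a1 a2 a3"
    unfolding aw_admissible_def Let_def Q_def[symmetric] by simp
  moreover define y' where "y' i = [y0, y1, y2, y3] ! i" for i
  moreover have "dist (y' i) (y i) < e" if i: "i \<le> 3" for i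
  proof -
    consider "i = 0" | "i = 1" | "i = 2" | "i = 3" using i by linarith
    then show ?thesis using y0 y1 y2 y3 by cases (simp_all add: y'_def)
  qed
  moreover have "y' 0 = y0" "y' 1 = y1" "y' 2 = y2" "y' 3 = y3" by (simp_all add: y'_def)
  ultimately show ?thesis using x' unfolding a0_def a1_def a2_def a3_def by metis
qed

text \<open>Parameters may run off to infinity while \<open>c k\<close>, the product of the x's,
  tends to 0; only the scaled symmetric functions converge. The scaling is harmless, since the
  recurrence coefficients are homogeneous of degree 0.\<close>

lemma exists_admissible_sequence:
  assumes q: "0 < q"
  obtains a1 a2 a3 a4 c :: "nat \<Rightarrow> complex" where "\<And>k. aw_admissible q (a1 k) (a2 k) (a3 k) (a4 k)" "\<And>k. c k \<noteq> 0"
    "\<And>i. i \<le> 4 \<Longrightarrow> (\<lambda>k. c k * esym (a1 k) (a2 k) (a3 k) (a4 k) i) \<longlonglongrightarrow> m i"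
proof -
  obtain x y where xy: "\<And>i. i \<le> 4 \<Longrightarrow> quartic_coeff x y i = m i" using quartic_factor by blast
  have "\<forall>k. \<exists>x' y'. (\<forall>i\<le>3. dist (x' i) (x i) < 1 / real (Suc k) \<and> dist (y' i) (y i) < 1 / real (Suc k) \<and> x' i \<noteq> 0)
    \<and> aw_admissible q (y' 0 / x' 0) (y' 1 / x' 1) (y' 2 / x' 2) (y' 3 / x' (3::nat))"
    using exists_admissible_near[OF q] by simp
  then obtain X Y where XY: "\<And>k i. i \<le> 3 \<Longrightarrow> dist (X k i) (x i) < 1 / real (Suc k)"
    "\<And>k i. i \<le> 3 \<Longrightarrow> dist (Y k i) (y i) < 1 / real (Suc k)" "\<And>k i. i \<le> 3 \<Longrightarrow> X k i \<noteq> 0"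
    "\<And>k. aw_admissible q (Y k 0 / X k 0) (Y k 1 / X k 1) (Y k 2 / X k 2) (Y k 3 / X k 3)"
    by metis
  have lim: "(\<lambda>k. X k i) \<longlonglongrightarrow> x i" "(\<lambda>k. Y k i) \<longlonglongrightarrow> y i" if "i \<le> 3" for i
    using XY(1,2)[OF that]
    by (auto intro!: metric_tendsto_imp_tendsto[OF LIMSEQ_inverse_real_of_nat] always_eventually simp: inverse_eq_divide intro: less_imp_le)
  show ?thesis
  proof (rule that[of "\<lambda>k. Y k 0 / X k 0" "\<lambda>k. Y k 1 / X k 1" "\<lambda>k. Y k 2 / X k 2" "\<lambda>k. Y k 3 / X k 3"
        "\<lambda>k. X k 0 * X k 1 * X k 2 * X k 3"])
    fix i :: nat assume i: "i \<le> 4"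
    have "(\<lambda>k. quartic_coeff (X k) (Y k) i) \<longlonglongrightarrow> quartic_coeff x y i"
    proof -
      consider "i = 0" | "i = 1" | "i = 2" | "i = 3" | "i = 4" using i by linarith
      then show ?thesis
        by cases (simp_all only: quartic_coeff_simps, auto intro!: tendsto_intros lim)
    qed
    then show "(\<lambda>k. X k 0 * X k 1 * X k 2 * X k 3 * esym (Y k 0 / X k 0) (Y k 1 / X k 1) (Y k 2 / X k 2) (Y k 3 / X k 3) i) \<longlonglongrightarrow> m i"
      using quartic_coeff_esym[of "X _" i "Y _"] XY(3) i xy[OF i] by simp
  qed (use XY(3,4) in auto)
qed

context aw_classical
begin

text \<open>By \<open>m0_m4_nz\<close> the recurrence coefficients are continuous at
  \<open>mm\<close>, so those of the chosen Askey-Wilson polynomials tend to B and C; the recurrence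
  carries the limit to every polynomial coefficient.\<close>

lemma aw_limiting_case_P: "aw_limiting_case q P"
proof -
  define Q where "Q = (of_real q :: complex)"
  obtain a1 a2 a3 a4 c where adm: "\<And>k. aw_admissible q (a1 k) (a2 k) (a3 k) (a4 k)" and c: "\<And>k. c k \<noteq> 0"
    and lim: "\<And>i. i \<le> 4 \<Longrightarrow> (\<lambda>k. c k * esym (a1 k) (a2 k) (a3 k) (a4 k) i) \<longlonglongrightarrow> mm i"
    using exists_admissible_sequence[OF q_pos, of mm] by blast
  have nz: "Q \<noteq> 1" "Q\<^sup>2 \<noteq> 1" "\<And>j. mm 0 - mm 4 * Q ^ j \<noteq> 0"
    using q_complex m0_m4_nz by (simp_all add: Q_def mm_simps)
  have beta: "(\<lambda>k. aw_beta q (a1 k) (a2 k) (a3 k) (a4 k) n) \<longlonglongrightarrow> B n" for n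
  proof -
    have "(\<lambda>k. quartic_B Q (\<lambda>i. c k * esym (a1 k) (a2 k) (a3 k) (a4 k) i) n) \<longlonglongrightarrow> quartic_B Q mm n"
      by (rule quartic_B_C_tendsto[OF lim nz])
    then show ?thesis
      by (simp add: quartic_B_scale c B_C_quartic Q_def aw_beta_eq[OF q_pos q_less_1 adm])
  qed
  have eta: "(\<lambda>k. aw_eta q (a1 k) (a2 k) (a3 k) (a4 k) n) \<longlonglongrightarrow> C (Suc n)" for n
  proof -
    have "(\<lambda>k. quartic_C Q (\<lambda>i. c k * esym (a1 k) (a2 k) (a3 k) (a4 k) i) (Suc n)) \<longlonglongrightarrow> quartic_C Q mm (Suc n)"
      by (rule quartic_B_C_tendsto[OF lim nz])
    then show ?thesis
      by (simp add: quartic_C_scale c B_C_quartic Q_def aw_eta_eq[OF q_pos q_less_1 adm])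
  qed
  have step: "coeff ([:- x, 1:] * p) i = (case i of 0 \<Rightarrow> 0 | Suc j \<Rightarrow> coeff p j) - x * coeff p i" for x :: complex and p i
    by (cases i) simp_all
  have "(\<lambda>k. coeff (aw_poly q (a1 k) (a2 k) (a3 k) (a4 k) n) i) \<longlonglongrightarrow> coeff (P n) i" for n i
  proof (induction n arbitrary: i rule: less_induct)
    case (less n)
    consider "n = 0" | "n = Suc 0" | j where "n = Suc (Suc j)" by (cases n rule: nat.exhaust; metis nat.exhaust)
    then show ?case
    proof cases
      case 1
      then show ?thesis by simp
    next
      case 2
      then show ?thesis using beta[of 0]
        by (auto simp: P_1 coeff_pCons split: nat.split intro!: tendsto_intros)
    next
      case 3
      have "(\<lambda>k. coeff (aw_poly q (a1 k) (a2 k) (a3 k) (a4 k) (Suc j)) i) \<longlonglongrightarrow> coeff (P (Suc j)) i"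
        "(\<lambda>k. coeff (aw_poly q (a1 k) (a2 k) (a3 k) (a4 k) j) i) \<longlonglongrightarrow> coeff (P j) i" for i
        using less.IH 3 by simp_all
      note IH = this
      show ?thesis
        unfolding 3 aw_poly.simps(3) P_Suc_Suc coeff_diff coeff_smult step
        by (cases i) (auto intro!: tendsto_intros IH beta eta)
    qed
  qed
  then show ?thesis unfolding aw_limiting_case_def using adm by blast
qed

end

theorem theorem3p1:
  fixes q :: real
    and P :: "nat \<Rightarrow> complex poly"
    and B C :: "nat \<Rightarrow> complex"
    and a b c :: complex
    and as bs cs :: "nat \<Rightarrow> complex"
    and \<alpha> r2 r3 \<aa> \<bb> \<cc> :: complex
    and \<phi> \<psi> h :: "complex poly"
    and ev :: "nat \<Rightarrow> complex"
  assumes q: "0 < q" "q < 1"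
    and alpha: "\<alpha> = aw_alpha q 1"
    and ops: "monic_OPS P"
    and ttrr: "TTRR B C P" "\<forall>n\<ge>1. C n \<noteq> 0"
    and cs: "\<forall>n. cs n \<noteq> 0"
    and structure_relation: "\<forall>n. [:c, b, a:] * aw_D q (P n) =
          smult (as n) (aw_S q (P (n + 1))) + smult (bs n) (aw_S q (P n))
          + smult (cs n) (aw_S q (prev P n))"
    and r2: "r2 = cs 2 + 2 * a * C 2"
    and r3: "r3 = cs 3 + 2 * a * C 3"
    and cond_i: "a \<noteq> 0 \<longrightarrow>
          (4 * \<alpha>^2 - 1) * a * C 2 * C 3
          + r3 / 2 * ((B 0 + B 1)^2 + 4 * \<alpha>^2 * (C 1 - B 0 * B 1 + \<alpha>^2 - 1)
                      - 2 * (2 * \<alpha>^2 - 1) * C 2) = 0"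
    and cond_ii:
         "a * C 2 * C 3 * (bs 2 + 2 * a * B 2 + b / \<alpha>)
          - r3 * (a * (B 2 + B 1) * C 2 + b / \<alpha> * C 2 - r2 / 2 * (B 1 - B 0)) = 0"
    and fa: "\<aa> = - ((a * C 3 + (\<alpha>^2 - 1) * r3) / (\<alpha> * r3))"
    and fb: "\<bb> = - (1 / (2 * \<alpha>))
               * ((1 - 2 * a * (C 3 / r3)) * (B 0 + B 1) - 2 * \<alpha>^2 * B 0)"
    and fc: "\<cc> = - (1 / (2 * \<alpha>))
               * ((1 - 2 * a * (C 3 / r3)) * (C 1 - B 0 * B 1) + C 1 + (B 0)^2)"
    and phi: "\<phi> = [:\<cc>, \<bb>, \<aa>:]"
    and psi: "\<psi> = [:- B 0, 1:]"
    and h: "h = 0"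
    and ev: "\<forall>n. ev n = aw_gamma q (int n) * (\<aa> * aw_gamma q (int n - 1) + aw_alpha q (int n - 1))"
  shows "multiples_of_aw_or_limiting q P \<and>
    (\<forall>n. \<phi> * aw_D q (aw_D q (P n)) + \<psi> * aw_S q (aw_D q (P n)) + h * P n = smult (ev n) (P n))"
proof -
  obtain L \<kappa> where lin: "Vector_Spaces.linear smult (*) L" and kappa: "\<And>n. \<kappa> n \<noteq> 0"
    and orth: "\<And>n m. L (P n * P m) = (if n = m then \<kappa> n else 0)"
    and deg: "\<And>n. degree (P n) = n" and lead: "\<And>n. lead_coeff (P n) = 1"
    using ops unfolding monic_OPS_def by blast
  have hom: "module_hom smult (*) L"
    using lin by (simp add: Vector_Spaces.linear_def)
  interpret aw: aw_structure q L P B C \<kappa> a b c as bs cs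
  proof unfold_locales
    show "L (f + g) = L f + L g" for f g using module_hom.add[OF hom] .
    show "L (smult x f) = x * L f" for x f using module_hom.scale[OF hom] .
    show "coeff (P n) n = 1" for n using lead[of n] deg[of n] by simp
    show "[:c, b, a:] * aw_D q (P n) = smult (as n) (aw_S q (P (Suc n))) + smult (bs n) (aw_S q (P n))
        + smult (cs n) (aw_S q (prev P n))" for n
      using structure_relation by simp
  qed (use q deg kappa orth ttrr cs in \<open>auto simp: TTRR_def\<close>)
  have al: "\<alpha> = aw.\<alpha>" using alpha aw.aw_alpha_nat[of 1] by (simp add: aw.A_1)
  have r: "r3 \<noteq> 0" "aw.t = 1 - 2 * a * (C 3 / r3)"
    using aw.r3_nz aw.t_eq r3 by simp_all
  have zero: "aw.Z + (4 * aw.\<alpha>\<^sup>2 - 1) * (1 - aw.t) * C 2 = 0" "aw.R = 0"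
  proof -
    have "(4 * aw.\<alpha>\<^sup>2 - 1) * a * C 2 * C 3 + (cs 3 + 2 * a * C 3) / 2 * aw.Z = 0"
      \<comment> \<open>Condition (i) is stated under a \<noteq> 0, which is now known.\<close>
      using cond_i aw.a_nz unfolding al r3 aw.Z_def by simp
    moreover have "a * C 2 * C 3 * (bs 2 + 2 * a * B 2 + b / aw.\<alpha>) - (cs 3 + 2 * a * C 3)
        * (a * (B 2 + B 1) * C 2 + b / aw.\<alpha> * C 2 - (cs 2 + 2 * a * C 2) / 2 * (B 1 - B 0)) = 0"
      using cond_ii unfolding al r2 r3 .
    ultimately show "aw.Z + (4 * aw.\<alpha>\<^sup>2 - 1) * (1 - aw.t) * C 2 = 0" "aw.R = 0" by (rule aw.Z_R)+
  qed
  have phi_eq: "aw.phi = [:\<cc>, \<bb>, \<aa>:]"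
  proof -
    \<comment> \<open>The stated leading coefficient, rewritten through t = 1 - 2 a C_3 / r_3, is (t
      + 1 - 2 \<alpha>^2) / (2 \<alpha>), the one read off from \<open>aw.phi\<close>.\<close>
    have "- ((a * C 3 + (al\<^sup>2 - 1) * r3) / (al * r3)) = 1 / (2 * al) * ((1 - 2 * a * (C 3 / r3)) + 1 - 2 * al\<^sup>2)"
      if "al \<noteq> 0" for al using that r(1) by (simp add: field_simps power2_eq_square)
    then have "\<aa> = 1 / (2 * aw.\<alpha>) * (aw.t + 1 - 2 * aw.\<alpha>\<^sup>2)"
      unfolding fa al r(2) by simp
    moreover have "\<bb> = 1 / (2 * aw.\<alpha>) * (- ((aw.t + 1) * (B 0 + B 1)) + (B 0 + B 1) + 2 * aw.\<alpha>\<^sup>2 * B 0)"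
      unfolding fb al r(2)[symmetric] by (simp add: algebra_simps)
    moreover have "\<cc> = 1 / (2 * aw.\<alpha>) * ((aw.t + 1) * (B 0 * B 1 - C 1) - (B 0 + B 1) * B 0)"
      unfolding fc al r(2)[symmetric] by (simp add: algebra_simps power2_eq_square)
    ultimately show ?thesis
      unfolding aw.phi_def aw.P_2 by (simp add: aw.P_1 algebra_simps)
  qed
  interpret cl: aw_classical q L P B C \<kappa> \<aa> \<bb> \<cc>
    using aw.Pearson_L[OF zero] unfolding phi_eq by unfold_locales
  have "multiples_of_aw_or_limiting q P"
    unfolding multiples_of_aw_or_limiting_def using cl.aw_limiting_case_P
    by (intro exI[of _ P] exI[of _ "\<lambda>_. 1"]) simp
  moreover have "\<phi> * aw_D q (aw_D q (P n)) + \<psi> * aw_S q (aw_D q (P n)) + h * P n = smult (ev n) (P n)" for n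
  proof (cases n)
    case 0
    \<comment> \<open>Here the index n - 1 is -1; the factor \<gamma>_0 = 0 settles the case, since
      D kills P_0.\<close>
    have "ev 0 = 0" using ev aw.aw_gamma_nat[of 0] by simp
    then show ?thesis using 0 h by simp
  next
    case (Suc m)
    have "ev n = aw.G (Suc m) * (\<aa> * aw.G m + aw.A m)"
      using ev aw.aw_gamma_nat[of "Suc m"] aw.aw_gamma_nat[of m] aw.aw_alpha_nat[of m] Suc by simp
    then show ?thesis
      using cl.Lop_P[of m] Suc phi psi h by (simp add: cl.Lop_def aw.P_1)
  qed
  ultimately show ?thesis by blast
qed

end
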